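(* Let $E$ be a Banach space and $L$ be a metric compact space. Then the following assertions are equivalent: (i) $\mathcal{C}(L)$ is isomorphic to a complemented subspace of $E$; (ii) $E$ admits a projectional tree of rank $ht(L)$ and order $1$.
   Context: Conventions: $\omega=\{0,1,2,\dots\}$, $\mathbb{N}=\{1,2,\dots\}$; Banach spaces are real, operators are linear, topological spaces are Hausdorff; $\mathcal{C}(L)$ is the space of continuous real functions on $L$ with the sup norm. A closed subspace is complemented if it is the range of a bounded linear projection. An isomorphic embedding is a linear isomorphism onto its (closed) range. Height. $X^{(0)}=X$, $X^{(1)}$ is the set of non-isolated points of $X$, $X^{(\alpha+1)}=(X^{(\alpha)})^{(1)}$, $X^{(\alpha)}=\bigcap_{\beta<\alpha}X^{(\beta)}$ for limit $\alpha$. If some $X^{(\alpha)}=\emptyset$ ($X$ scattered), $ht(X)$ is the least such $\alpha$; otherwise $ht(X)=\infty$. (For a nonempty scattered compact space, $ht$ is a successor ordinal; a compact metric space is scattered iff it is countable, and then its height is countable.) Trees. $\mathbb{L}=\omega^{<\omega}$ is the set of finite sequences in $\omega$, $\epsilon$ the empty sequence, $l(s)$ the length of $s$, $s\preceq t$ means $s$ is an initial segment of $t$, $s\prec t$ means $s\preceq t$ and $s\ne t$, $s*n$ is $s$ with $n$ appended. $\Lambda\subseteq\mathbb{L}$ is hereditary if $s\preceq t\in\Lambda$ implies $s\in\Lambda$. A leaf of $\Lambda$ is an $s\in\Lambda$ with no $t\in\Lambda$, $s\prec t$; $NL(\Lambda)$ is the set of non-leaves. If $\Lambda$ is hereditary,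 $\epsilon\in\Lambda$, and $\Lambda$ has no infinite branch (no infinite $\prec$-increasing sequence), set $r(s)=0$ for leaves and $r(s)=\sup\{r(t)+1: t\in\Lambda, s\prec t\}$ otherwise. For a countable ordinal $\alpha$, a tree of rank $\alpha+1$ is a hereditary $\Lambda\subseteq\mathbb{L}$ with $\epsilon\in\Lambda$, without infinite branches, with $r(\epsilon)=\alpha$, such that each $s\in\Lambda$ is a leaf or satisfies $s*n\in\Lambda$ for all $n\in\omega$, and for each $s\in NL(\Lambda)$ the sequence $(r(s*n))_{n\in\omega}$ is constant or strictly increasing. The tree of rank $\infty$ is $\mathbb{L}$ itself. Spaces $\mathcal{A}_\Lambda$. For a tree $\Lambda$ and $a=(a_s)_{s\in\Lambda}\in\mathbb{R}^\Lambda$ let $\|a\|^\Lambda=\sup_{t\in\Lambda}|\sum_{s\preceq t}a_s|$. For $\Omega\subseteq\Lambda$, $a\restriction\Omega\in\mathbb{R}^\Lambda$ equals $a$ on $\Omega$ and $0$ off $\Omega$. Let $\Lambda_s=\{t\in\Lambda:s\preceq t\}$. $\mathcal{A}_\Lambda$ is the normed space (norm $\|\cdot\|^\Lambda$) of all $a\in\mathbb{R}^\Lambda$ with (A.1) $\|a\|^\Lambda<\infty$; (A.2) $\lim_{n}\|a\restriction\Lambda_{s*n}\|^\Lambda=0$ for each $s\in NL(\Lambda)$; (A.3) $\lim_n\|a\restriction\{t\in\Lambda:l(t)\ge n\}\|^\Lambda=0$. For $s\in\Lambda$, $\tilde\delta_{s}\in\mathcal{A}_\Lambda^*$ is $\tilde\delta_{s}\big((a_t)_{t}\big)=\sum_{t\preceq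 s}a_{t}$. Metric on trees. For $s=\langle s_1,\dots,s_n\rangle\in\mathbb{L}$ let $R(s)\in 2^\omega$ be the sequence consisting of $s_1$ ones, a zero, $s_2$ ones, a zero, …, $s_n$ ones, a zero, followed by infinitely many ones ($R(\epsilon)$ is constantly $1$). $R$ is injective; trees are metrized by $d(s,t)=d_{2^\omega}(R(s),R(t))$, where $d_{2^\omega}(x,y)=2^{-k}$ with $k$ the first index at which $x\ne y$ differ, and $d_{2^\omega}(x,x)=0$. A map $\rho:X\to E^*$ on a metric space $(X,d)$ is uniformly weak$^*$ continuous if for all $e\in E$ and sequences $(x_n),(y_n)$ in $X$, $d(x_n,y_n)\to0$ implies $\langle\rho(x_n)-\rho(y_n),e\rangle\to0$. Projectional tree (order $1$). Let $\beta$ be a countable successor ordinal or $\infty$. A projectional tree of rank $\beta$ and order $1$ in $E$ is a triple $(\Lambda,T,\rho)$ where $\Lambda$ is a tree of rank $\beta$, $T:\mathcal{A}_\Lambda\to E$ is an isomorphic embedding, and $\rho:\Lambda\to E^*$ is uniformly weak$^*$ continuous with bounded range and satisfies $T^*(\rho(s))=\tilde\delta_{s}$ for all $s\in\Lambda$.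
   Formalization: The formal statement excludes the case L finite with 0 < dim E < |L|, where the equivalence always fails (e.g. L two points, E = ℝ: (ii) holds, (i) does not), and takes L nonempty, since a tree of rank 0 is undefined. *)

theory Defs
  imports
    "HOL-Analysis.Analysis"
    "HOL-Library.Sublist"
begin

section \<open>Ordinals\<close>

text \<open>
  The type \<open>'a ordinal\<close> consists of the order types of all well-orders whose field is a subset
  of \<open>nat + 'a\<close>, i.e. of all ordinals of cardinality at most \<open>max \<aleph>\<^sub>0 |'a|\<close>.
  It contains every countable ordinal, and also every ordinal that can be the height of a
  scattered subset of \<open>'a\<close> (a strictly decreasing transfinite sequence of subsets of
  \<open>'a\<close> has a length of cardinality at most \<open>|'a|\<close>).
\<close>

quotient_type 'a ordinal = "(nat + 'a) rel" / partial: "\<lambda>r s. (r, s) \<in> ordIso"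
proof (rule part_equivpI)
  show "\<exists>r :: (nat + 'a) rel. (r, r) \<in> ordIso"
    using ordIso_reflexive[of "{}"] well_order_on_empty by (metis Field_empty)
  show "symp (\<lambda>r s :: (nat + 'a) rel. (r, s) \<in> ordIso)"
    by (auto intro: sympI ordIso_symmetric)
  show "transp (\<lambda>r s :: (nat + 'a) rel. (r, s) \<in> ordIso)"
    by (auto intro: transpI ordIso_transitive)
qed

instantiation ordinal :: (type) linorder
begin

lift_definition less_eq_ordinal :: "'a ordinal \<Rightarrow> 'a ordinal \<Rightarrow> bool"
  is "\<lambda>r s. (r, s) \<in> ordLeq"
  by (meson ordIso_ordLeq_trans ordIso_symmetric ordLeq_ordIso_trans)

lift_definition less_ordinal :: "'a ordinal \<Rightarrow> 'a ordinal \<Rightarrow> bool"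
  is "\<lambda>r s. (r, s) \<in> ordLess"
  by (meson ordIso_ordLess_trans ordIso_symmetric ordLess_ordIso_trans)

instance
proof
  fix x y z :: "'a ordinal"
  show "(x < y) = (x \<le> y \<and> \<not> y \<le> x)"
    by transfer (metis ordIso_iff_ordLeq ordLeq_reflexive not_ordLeq_ordLess ordLess_imp_ordLeq
        ordLess_or_ordLeq ordLeq_Well_order_simp ordIso_imp_ordLeq)
  show "x \<le> x"
    by transfer (rule ordIso_imp_ordLeq)
  show "x \<le> y \<Longrightarrow> y \<le> z \<Longrightarrow> x \<le> z"
    by transfer (rule ordLeq_transitive)
  show "x \<le> y \<Longrightarrow> y \<le> x \<Longrightarrow> x = y"
    by transfer (simp add: ordIso_iff_ordLeq)
  show "x \<le> y \<or> y \<le> x"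
    by transfer (metis ordIso_imp_ordLeq ordLeq_Well_order_simp ordLeq_total)
qed

end

lemma wf_less_ordinal: "wf {(x, y :: 'a ordinal). x < y}"
proof -
  have "{(x, y :: 'a ordinal). x < y} \<subseteq> inv_image ordLess rep_ordinal"
  proof (clarsimp)
    fix x y :: "'a ordinal"
    assume "x < y"
    moreover have "abs_ordinal (rep_ordinal x) = x" "abs_ordinal (rep_ordinal y) = y"
      by (rule Quotient3_abs_rep[OF Quotient3_ordinal])+
    moreover have "(rep_ordinal x, rep_ordinal x) \<in> ordIso" "(rep_ordinal y, rep_ordinal y) \<in> ordIso"
      by (rule Quotient3_rep_reflp[OF Quotient3_ordinal])+
    ultimately show "(rep_ordinal x, rep_ordinal y) \<in> ordLess"
      by (metis less_ordinal.abs_eq)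
  qed
  then show ?thesis
    using wf_subset wf_inv_image wf_ordLess by blast
qed

instance ordinal :: (type) wellorder
proof
  fix P :: "'a ordinal \<Rightarrow> bool" and a
  assume "\<And>x. (\<And>y. y < x \<Longrightarrow> P y) \<Longrightarrow> P x"
  then show "P a"
    using wf_induct[OF wf_less_ordinal, of P a] by auto
qed

lemma ordinal_no_max: "\<exists>y. (x :: 'a ordinal) < y"
proof transfer
  fix r :: "(nat + 'a) rel"
  assume "(r, r) \<in> ordIso"
  then have r: "Well_order r"
    by (simp add: ordIso_def)
  define f :: "nat + 'a \<Rightarrow> nat + 'a" where "f = case_sum (Inl \<circ> Suc) Inr"
  define p :: "nat + 'a" where "p = Inl 0"
  define q where "q = dir_image r f"
  define s where "s = q \<union> (insert p (Field q)) \<times> {p}"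
  have inj: "inj f"
    unfolding f_def by (rule injI) (auto split: sum.splits)
  have p: "p \<notin> range f"
    unfolding f_def p_def by (auto split: sum.splits)
  have q: "Well_order q" "(r, q) \<in> ordIso"
    unfolding q_def using Well_order_dir_image dir_image_ordIso r inj
    by (metis inj_on_subset subset_UNIV)+
  have pq: "p \<notin> Field q"
    using p unfolding q_def dir_image_Field by auto
  have Fs: "Field s = insert p (Field q)"
    unfolding s_def by (auto simp: Field_def)
  have qF: "\<And>x y. (x, y) \<in> q \<Longrightarrow> x \<in> Field q \<and> y \<in> Field q"
    by (auto simp: Field_def)
  have lin: "Refl q" "trans q" "antisym q" "Total q" "wf (q - Id)"
    using q(1) by (auto simp: order_on_defs well_order_on_def)
  have "wf ((q - Id) \<union> Field q \<times> {p})"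
  proof (rule wf_Un[OF lin(5)])
    show "wf (Field q \<times> {p})"
      using pq by (intro wf_no_loop) auto
    show "Domain (q - Id) \<inter> Range (Field q \<times> {p}) = {}"
      using pq qF by auto
  qed
  then have "wf (s - Id)"
    by (rule wf_subset) (auto simp: s_def)
  moreover have "Refl s"
    using lin(1) unfolding refl_on_def Fs by (auto simp: s_def)
  moreover have "trans s"
  proof (rule transI)
    fix x y z
    assume "(x, y) \<in> s" "(y, z) \<in> s"
    then show "(x, z) \<in> s"
      using pq transD[OF lin(2), of x y z] by (auto simp: s_def dest: qF)
  qed
  moreover have "antisym s"
  proof (rule antisymI)
    fix x y
    assume "(x, y) \<in> s" "(y, x) \<in> s"
    then show "x = y"
      using pq antisymD[OF lin(3), of x y] by (auto simp: s_def dest: qF)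
  qed
  moreover have "Total s"
    using lin(4) unfolding total_on_def Fs by (auto simp: s_def)
  moreover have "s \<subseteq> Field s \<times> Field s"
    by (auto simp: Field_def)
  ultimately have s: "Well_order s"
    by (auto simp: order_on_defs well_order_on_def)
  have "underS s p = Field q"
    using pq qF by (auto simp: underS_def s_def)
  moreover have "Restr s (Field q) = q"
    using pq qF by (auto simp: s_def)
  ultimately have "(q, s) \<in> ordLess"
    using underS_Restr_ordLess[OF s, of p] Fs by auto
  then have "(r, s) \<in> ordLess"
    using q(2) ordIso_ordLess_trans by blast
  then show "\<exists>s\<in>{s :: (nat + 'a) rel. (s, s) \<in> ordIso}. (r, s) \<in> ordLess"
    using ordIso_reflexive[OF s] by (intro bexI[of _ s]) simp_all
qed

instantiation ordinal :: (type) zero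
begin
definition zero_ordinal :: "'a ordinal" where "zero_ordinal = (LEAST \<alpha>. True)"
instance ..
end

definition osuc :: "'a ordinal \<Rightarrow> 'a ordinal" where
  "osuc \<alpha> = (LEAST \<beta>. \<alpha> < \<beta>)"

definition osup :: "'a ordinal set \<Rightarrow> 'a ordinal" where
  "osup A = (LEAST \<beta>. \<forall>\<alpha>\<in>A. \<alpha> \<le> \<beta>)"

lemma less_osuc: "\<alpha> < osuc \<alpha>"
  unfolding osuc_def using ordinal_no_max by (metis LeastI_ex)

lemma osuc_le: "\<alpha> < \<beta> \<Longrightarrow> osuc \<alpha> \<le> \<beta>"
  unfolding osuc_def by (rule Least_le)

lemma osuc_inject: "osuc \<alpha> = osuc \<beta> \<longleftrightarrow> \<alpha> = \<beta>"
  by (metis leD less_osuc linorder_cases osuc_le)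

definition opred :: "'a ordinal \<Rightarrow> 'a ordinal" where
  "opred \<alpha> = (THE \<beta>. \<alpha> = osuc \<beta>)"

lemma opred_osuc: "opred (osuc \<alpha>) = \<alpha>"
  unfolding opred_def by (auto simp: osuc_inject)


section \<open>Height\<close>

definition nonisolated :: "'a::topological_space set \<Rightarrow> 'a set" where
  "nonisolated X = {x \<in> X. \<not> x isolated_in X}"

function derived :: "'a::topological_space set \<Rightarrow> 'a ordinal \<Rightarrow> 'a set" where
  "derived X \<alpha> =
    (if \<alpha> = 0 then X
     else if \<exists>\<beta>. \<alpha> = osuc \<beta> then nonisolated (derived X (opred \<alpha>))
     else (\<Inter>\<beta>\<in>{..<\<alpha>}. derived X \<beta>))"
  by pat_completeness auto
termination
proof (relation "inv_image {(x, y). x < y} snd")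
  show "wf (inv_image {(x, y). x < y} (snd :: 'a set \<times> 'a ordinal \<Rightarrow> _))"
    by (intro wf_inv_image wf_less_ordinal)
qed (auto simp: opred_osuc less_osuc)

declare derived.simps [simp del]

text \<open>Heights and ranks live in \<open>'a ordinal option\<close>, where \<open>None\<close> stands for \<open>\<infinity>\<close>.\<close>

definition ht :: "'a::topological_space set \<Rightarrow> 'a ordinal option" where
  "ht X = (if \<exists>\<alpha>. derived X \<alpha> = {} then Some (LEAST \<alpha>. derived X \<alpha> = {}) else None)"


section \<open>Trees\<close>

definition hereditary :: "nat list set \<Rightarrow> bool" where
  "hereditary \<Lambda> \<longleftrightarrow> (\<forall>s t. prefix s t \<and> t \<in> \<Lambda> \<longrightarrow> s \<in> \<Lambda>)"

definition is_leaf :: "nat list set \<Rightarrow> nat list \<Rightarrow> bool" where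
  "is_leaf \<Lambda> s \<longleftrightarrow> s \<in> \<Lambda> \<and> \<not> (\<exists>t\<in>\<Lambda>. strict_prefix s t)"

definition nonleaves :: "nat list set \<Rightarrow> nat list set" where
  "nonleaves \<Lambda> = {s \<in> \<Lambda>. \<not> is_leaf \<Lambda> s}"

definition no_infinite_branch :: "nat list set \<Rightarrow> bool" where
  "no_infinite_branch \<Lambda> \<longleftrightarrow>
    \<not> (\<exists>f :: nat \<Rightarrow> nat list. \<forall>n. f n \<in> \<Lambda> \<and> strict_prefix (f n) (f (Suc n)))"

definition extension_rel :: "nat list set \<Rightarrow> nat list rel" where
  "extension_rel \<Lambda> = {(t, s). s \<in> \<Lambda> \<and> t \<in> \<Lambda> \<and> strict_prefix s t}"

definition tree_rank :: "nat list set \<Rightarrow> nat list \<Rightarrow> 'a ordinal" where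
  "tree_rank \<Lambda> = wfrec (extension_rel \<Lambda>)
    (\<lambda>r s. if is_leaf \<Lambda> s then 0
           else osup {osuc (r t) |t. t \<in> \<Lambda> \<and> strict_prefix s t})"

lemma tree_rank_eq:
  assumes "no_infinite_branch \<Lambda>" and "s \<in> \<Lambda>"
  shows "tree_rank \<Lambda> s =
    (if is_leaf \<Lambda> s then 0
     else osup {osuc (tree_rank \<Lambda> t) |t. t \<in> \<Lambda> \<and> strict_prefix s t})"
proof -
  have "wf (extension_rel \<Lambda>)"
    using assms(1) unfolding wf_iff_no_infinite_down_chain
    by (auto simp: no_infinite_branch_def extension_rel_def)
  note * = wfrec[OF this, of _ s]
  have "{osuc (cut (tree_rank \<Lambda>) (extension_rel \<Lambda>) s t) |t. t \<in> \<Lambda> \<and> strict_prefix s t}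
      = {osuc (tree_rank \<Lambda> t :: 'a ordinal) |t. t \<in> \<Lambda> \<and> strict_prefix s t}"
    using assms(2) by (intro Collect_cong) (auto simp: cut_def extension_rel_def)
  then show ?thesis
    unfolding tree_rank_def by (subst *) simp
qed

fun tree_of_rank :: "'a ordinal option \<Rightarrow> nat list set \<Rightarrow> bool" where
  "tree_of_rank None \<Lambda> \<longleftrightarrow> \<Lambda> = UNIV"
| "tree_of_rank (Some \<beta>) \<Lambda> \<longleftrightarrow>
    (\<exists>\<alpha> :: 'a ordinal. \<beta> = osuc \<alpha> \<and> countable {..<\<alpha>} \<and>
       hereditary \<Lambda> \<and> [] \<in> \<Lambda> \<and> no_infinite_branch \<Lambda> \<and> tree_rank \<Lambda> [] = \<alpha> \<and>
       (\<forall>s\<in>\<Lambda>. is_leaf \<Lambda> s \<or> (\<forall>n. s @ [n] \<in> \<Lambda>)) \<and>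
       (\<forall>s\<in>nonleaves \<Lambda>.
          (\<exists>\<gamma> :: 'a ordinal. \<forall>n. tree_rank \<Lambda> (s @ [n]) = \<gamma>) \<or>
          strict_mono (\<lambda>n. tree_rank \<Lambda> (s @ [n]) :: 'a ordinal)))"


section \<open>The spaces \<open>\<A>\<^sub>\<Lambda>\<close>\<close>

definition tree_delta :: "nat list \<Rightarrow> (nat list \<Rightarrow> real) \<Rightarrow> real" where
  "tree_delta t a = (\<Sum>s | prefix s t. a s)"

text \<open>A real supremum, hence meaningful only for \<open>a\<close> of finite norm, which is the boundedness
  condition in \<open>tree_space\<close>; for hereditary \<open>\<Lambda>\<close> the two kinds of restrictions of \<open>a\<close>
  occurring there then have finite norm, too.\<close>

definition tree_norm :: "nat list set \<Rightarrow> (nat list \<Rightarrow> real) \<Rightarrow> real" where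
  "tree_norm \<Lambda> a = (SUP t\<in>\<Lambda>. \<bar>tree_delta t a\<bar>)"

definition restr :: "(nat list \<Rightarrow> real) \<Rightarrow> nat list set \<Rightarrow> nat list \<Rightarrow> real" where
  "restr a \<Omega> = (\<lambda>t. if t \<in> \<Omega> then a t else 0)"

text \<open>Elements of \<open>\<real>\<^sup>\<Lambda>\<close> are represented by functions that vanish outside \<open>\<Lambda>\<close>.\<close>

definition tree_space :: "nat list set \<Rightarrow> (nat list \<Rightarrow> real) set" where
  "tree_space \<Lambda> = {a.
     (\<forall>t. t \<notin> \<Lambda> \<longrightarrow> a t = 0) \<and>
     bdd_above ((\<lambda>t. \<bar>tree_delta t a\<bar>) ` \<Lambda>) \<and>
     (\<forall>s\<in>nonleaves \<Lambda>.
        (\<lambda>n. tree_norm \<Lambda> (restr a {t \<in> \<Lambda>. prefix (s @ [n]) t})) \<longlonglongrightarrow> 0) \<and>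
     (\<lambda>n. tree_norm \<Lambda> (restr a {t \<in> \<Lambda>. n \<le> length t})) \<longlonglongrightarrow> 0}"


section \<open>The metric on trees\<close>

text \<open>In \<open>cantor_code\<close>, \<open>True\<close> is the digit one and \<open>False\<close> the digit zero.\<close>

definition cantor_code :: "nat list \<Rightarrow> nat \<Rightarrow> bool" where
  "cantor_code s k =
    (let w = concat (map (\<lambda>m. replicate m True @ [False]) s)
     in if k < length w then w ! k else True)"

definition cantor_dist :: "(nat \<Rightarrow> bool) \<Rightarrow> (nat \<Rightarrow> bool) \<Rightarrow> real" where
  "cantor_dist x y = (if x = y then 0 else (1 / 2) ^ (LEAST k. x k \<noteq> y k))"

definition tree_dist :: "nat list \<Rightarrow> nat list \<Rightarrow> real" where
  "tree_dist s t = cantor_dist (cantor_code s) (cantor_code t)"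


section \<open>Projectional trees of order one\<close>

definition uniformly_weak_star_continuous ::
  "'x set \<Rightarrow> ('x \<Rightarrow> 'x \<Rightarrow> real) \<Rightarrow> ('x \<Rightarrow> 'e::real_normed_vector \<Rightarrow>\<^sub>L real) \<Rightarrow> bool" where
  "uniformly_weak_star_continuous X d \<rho> \<longleftrightarrow>
    (\<forall>e x y. (\<forall>n :: nat. x n \<in> X \<and> y n \<in> X) \<and> (\<lambda>n. d (x n) (y n)) \<longlonglongrightarrow> 0
       \<longrightarrow> (\<lambda>n. blinfun_apply (\<rho> (x n) - \<rho> (y n)) e) \<longlonglongrightarrow> 0)"

text \<open>Isomorphic embeddings of \<open>\<A>\<^sub>\<Lambda>\<close>; only the values of \<open>T\<close> on \<open>tree_space \<Lambda>\<close> matter.\<close>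

definition tree_embedding ::
  "nat list set \<Rightarrow> ((nat list \<Rightarrow> real) \<Rightarrow> 'e::real_normed_vector) \<Rightarrow> bool" where
  "tree_embedding \<Lambda> T \<longleftrightarrow>
    (\<forall>a\<in>tree_space \<Lambda>. \<forall>b\<in>tree_space \<Lambda>. T (\<lambda>s. a s + b s) = T a + T b) \<and>
    (\<forall>c. \<forall>a\<in>tree_space \<Lambda>. T (\<lambda>s. c * a s) = c *\<^sub>R T a) \<and>
    (\<exists>C. \<forall>a\<in>tree_space \<Lambda>. norm (T a) \<le> C * tree_norm \<Lambda> a) \<and>
    (\<exists>c>0. \<forall>a\<in>tree_space \<Lambda>. c * tree_norm \<Lambda> a \<le> norm (T a)) \<and>
    closed (T ` tree_space \<Lambda>)"

definition projectional_tree ::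
  "'a ordinal option \<Rightarrow> nat list set \<Rightarrow> ((nat list \<Rightarrow> real) \<Rightarrow> 'e::banach) \<Rightarrow>
    (nat list \<Rightarrow> 'e \<Rightarrow>\<^sub>L real) \<Rightarrow> bool" where
  "projectional_tree \<beta> \<Lambda> T \<rho> \<longleftrightarrow>
    tree_of_rank \<beta> \<Lambda> \<and>
    tree_embedding \<Lambda> T \<and>
    uniformly_weak_star_continuous \<Lambda> tree_dist \<rho> \<and>
    bounded (\<rho> ` \<Lambda>) \<and>
    (\<forall>s\<in>\<Lambda>. \<forall>a\<in>tree_space \<Lambda>. blinfun_apply (\<rho> s) (T a) = tree_delta s a)"


section \<open>Complemented subspaces\<close>

definition complemented :: "'e::real_normed_vector set \<Rightarrow> bool" where
  "complemented F \<longleftrightarrow>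
    subspace F \<and> closed F \<and>
    (\<exists>P :: 'e \<Rightarrow> 'e. bounded_linear P \<and> P \<circ> P = P \<and> range P = F)"

definition isomorphism_onto ::
  "('v::real_normed_vector \<Rightarrow> 'e::real_normed_vector) \<Rightarrow> 'e set \<Rightarrow> bool" where
  "isomorphism_onto J F \<longleftrightarrow>
    bounded_linear J \<and> (\<exists>c>0. \<forall>v. c * norm v \<le> norm (J v)) \<and> range J = F"

end

theory Submission
  imports Defs
begin

text \<open>
  Through \<open>a \<mapsto> (s \<mapsto> tree_delta s a)\<close> the space of a tree is identified with a space of functions
  on the tree (\<open>tree_cont\<close>), and a projectional tree amounts to bounded operators from and to this
  space whose composition is the identity. So one has to factor the identity of the space of tree
  functions through \<open>C(L)\<close>, and conversely.

  Both factorizations use the same series: if \<open>h\<close> assigns to the nodes nonnegative continuous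
  functions on \<open>L\<close> such that \<open>h [] = 1\<close> and the functions at the children of a node add up to at
  most the function at the node, then \<open>G \<mapsto> (\<Sum>s. (G s - G (butlast s)) * h s)\<close> has norm at most 1,
  because its partial sums are, by summation by parts, averages of values of \<open>G\<close>. The operator in
  the opposite direction evaluates at points \<open>x s\<close> of \<open>L\<close>.

  From \<open>C(L)\<close> to trees, the points are chosen in the derived sets prescribed by the ranks (or in a
  perfect kernel) with bumps \<open>h s\<close> around them, so that \<open>h t (x s)\<close> is 1 if \<open>t\<close> is a prefix of \<open>s\<close>
  and 0 otherwise. From trees to \<open>C(L)\<close>, the functions \<open>h s\<close> are products of members of finer and
  finer partitions of unity if \<open>L\<close> is not scattered, as in the proof of Milutin's lemma, and
  indicators of clopen sets splitting \<open>L\<close> according to the Cantor-Bendixson rank otherwise. For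
  finite \<open>L\<close> the Hahn-Banach theorem supplies the projection.
\<close>

section \<open>Ordinals and derived sets\<close>

text \<open>The differences \<open>G s - G (butlast s)\<close>, weighted by \<open>h s\<close>, need
  not be absolutely summable, so the series is summed along the finite truncations of nodes whose
  length and entries are at most \<open>N\<close>. Convergence rests on
  \<open>tree_cut_uniform\<close>: the two limit conditions of the tree space make \<open>G\<close>
  uniformly close to its composition with the retraction onto a large truncation. That two operators
  compose to the identity is checked pointwise: a partial sum at a point only involves nodes with
  nonzero weight there, so it suffices to locate these nodes. Ranks are built from
  \<open>osup\<close>, a LEAST that is a supremum only for bounded sets. A scattered compact metric
  space is countable, and countable sets of ordinals over a countable type are bounded, so ranks and
  derived sets can be compared within \<open>'l ordinal\<close>. A finite space has height 1, its
  tree is a single node, and a projectional tree of that rank merely says that the Banach space is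
  nonzero. This is where the dimension hypothesis enters, with \<open>dim\<close> being 0 on
  infinite-dimensional spaces.\<close>

lemma zero_le_ordinal: "(0::'a ordinal) \<le> \<alpha>"
  unfolding zero_ordinal_def by (rule Least_le) simp

lemma not_less_zero_ordinal: "\<not> \<alpha> < (0::'a ordinal)"
  using zero_le_ordinal[of \<alpha>] by simp

lemma less_osuc_iff: "\<alpha> < osuc \<beta> \<longleftrightarrow> \<alpha> \<le> \<beta>"
  by (meson leD leI less_osuc order_le_less_trans osuc_le)

lemma osuc_le_iff: "osuc \<alpha> \<le> \<beta> \<longleftrightarrow> \<alpha> < \<beta>"
  by (meson less_osuc order_less_le_trans osuc_le)

lemma osuc_neq_zero: "osuc \<alpha> \<noteq> 0"
  using less_osuc[of \<alpha>] not_less_zero_ordinal by metis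

section \<open>Order types, initial segments and countable suprema\<close>

lemma abs_ordinal_less:
  "Well_order r \<Longrightarrow> Well_order s \<Longrightarrow> (abs_ordinal r < abs_ordinal s) = ((r, s) \<in> ordLess)"
  by (rule less_ordinal.abs_eq) (auto intro: ordIso_reflexive)

lemma ordinal_cases_abs:
  obtains r :: "(nat + 'a) rel" where "Well_order r" "(x :: 'a ordinal) = abs_ordinal r"
proof -
  have "abs_ordinal (rep_ordinal x) = x"
    by (rule Quotient3_abs_rep[OF Quotient3_ordinal])
  moreover have "(rep_ordinal x, rep_ordinal x) \<in> ordIso"
    by (rule Quotient3_rep_reflp[OF Quotient3_ordinal])
  ultimately show ?thesis
    using that[of "rep_ordinal x"] by (simp add: ordIso_def)
qed

text \<open>Burali-Forti: otherwise the type would be order isomorphic to a proper initial segment of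
  itself.\<close>

lemma no_inj_ordinal: "\<not> inj (g :: 'a ordinal \<Rightarrow> nat + 'a)"
proof
  assume g: "inj g"
  define r where "r = {(g x, g y) | x y. x \<le> y}"
  have F: "Field r = range g"
    unfolding r_def Field_def by auto
  have r: "Well_order r"
  proof -
    have "wf (r - Id)"
    proof (rule wf_subset)
      show "wf (inv_image {(x, y). x < y} (inv g))"
        by (intro wf_inv_image wf_less_ordinal)
      show "r - Id \<subseteq> inv_image {(x, y). x < y} (inv g)"
        using g by (fastforce simp: r_def inv_image_def order_less_le)
    qed
    moreover have "Refl r"
      unfolding refl_on_def F by (auto simp: r_def)
    moreover have "Total r"
      unfolding total_on_def F using linear by (fastforce simp: r_def)
    moreover have "trans r" "antisym r"
      using g by (auto simp: r_def trans_def antisym_def inj_eq)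
    ultimately show ?thesis
      by (auto simp: order_on_defs well_order_on_def FieldI1 FieldI2)
  qed
  \<comment> \<open>The segment of \<open>r\<close> strictly below \<open>g x\<close> is a copy of
    the ordinals below \<open>x\<close>.\<close>
  define R where "R x = Restr r (underS r (g x))" for x
  have R: "Well_order (R x)" for x
    unfolding R_def by (rule Well_order_Restr[OF r])
  have FR: "Field (R x) = underS r (g x)" for x
    unfolding R_def using r
    by (simp add: wo_rel_def Field_Restr_ofilter wo_rel.underS_ofilter)
  have u: "underS r (g x) = g ` {..<x}" for x
    using g by (auto simp: r_def underS_def inj_eq)
  have lt: "abs_ordinal (R x) < abs_ordinal r" for x
    unfolding abs_ordinal_less[OF R r] using underS_Restr_ordLess[OF r, of "g x"] F
    by (auto simp: R_def)
  have mono: "abs_ordinal (R x) < abs_ordinal (R y)" if "x < y" for x y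
  proof -
    have "underS (R y) (g x) = underS r (g x)"
      using that g by (auto simp: R_def u) (auto simp: underS_def r_def inj_eq)
    moreover have "Restr (R y) (underS r (g x)) = R x"
      using that by (auto simp: R_def u)
    moreover have "Field (R y) \<noteq> {}"
      unfolding FR u using that by auto
    ultimately show ?thesis
      unfolding abs_ordinal_less[OF R R] using underS_Restr_ordLess[OF R, of y "g x"] by simp
  qed
  \<comment> \<open>A strictly increasing self-map of a well-order never falls below the identity.
    Taking \<open>abs_ordinal r\<close> for \<open>x\<close> then contradicts \<open>lt\<close>,
    which bounds all values strictly by \<open>abs_ordinal r\<close>.\<close>
  have "x \<le> abs_ordinal (R x)" for x
  proof (induction x rule: less_induct)
    case (less x)
    show ?case
    proof (rule ccontr)
      assume "\<not> ?case"
      then have "abs_ordinal (R x) < x"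
        by simp
      then show False
        using less mono by (meson leD)
    qed
  qed
  then show False
    using lt by (meson leD)
qed

text \<open>Every smaller ordinal is the type of the segment of a representing well-order below some
  point, and there are only countably many points in \<open>nat + 'a\<close>.\<close>

lemma countable_lessThan_ordinal:
  assumes "countable (UNIV :: 'a set)"
  shows "countable {..<(x :: 'a ordinal)}"
proof -
  obtain r :: "(nat + 'a) rel" where r: "Well_order r" "x = abs_ordinal r"
    by (rule ordinal_cases_abs)
  have "{..<x} \<subseteq> range (\<lambda>z. abs_ordinal (Restr r (underS r z)))"
  proof
    fix y
    assume y: "y \<in> {..<x}"
    obtain s :: "(nat + 'a) rel" where s: "Well_order s" "y = abs_ordinal s"
      by (rule ordinal_cases_abs)
    have "(s, r) \<in> ordLess"
      using y r s abs_ordinal_less by auto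
    then obtain z where "(s, Restr r (underS r z)) \<in> ordIso"
      using ordLess_iff_ordIso_Restr[OF r(1) s(1)] by auto
    then have "y = abs_ordinal (Restr r (underS r z))"
      unfolding s(2) by (rule Quotient3_rel_abs[OF Quotient3_ordinal])
    then show "y \<in> range (\<lambda>z. abs_ordinal (Restr r (underS r z)))"
      by auto
  qed
  moreover have "countable (UNIV :: (nat + 'a) set)"
    using assms by (metis UNIV_Plus_UNIV countableI_type countable_Plus)
  ultimately show ?thesis
    by (meson countable_image countable_subset)
qed

text \<open>If no bound existed, the whole type would be a countable union of countable initial
  segments, hence would inject into \<open>nat\<close>, contrary to
  \<open>no_inj_ordinal\<close>.\<close>

lemma countable_ordinals_bounded:
  assumes "countable (UNIV :: 'a set)" "countable A"
  shows "\<exists>b :: 'a ordinal. \<forall>a\<in>A. a \<le> b"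
proof (rule ccontr)
  assume "\<not> ?thesis"
  then have "UNIV = (\<Union>a\<in>A. {..<a})"
    by (auto simp: not_le)
  moreover have "countable (\<Union>a\<in>A. {..<a})"
    using assms by (simp add: countable_lessThan_ordinal)
  ultimately have "countable (UNIV :: 'a ordinal set)"
    by simp
  then have "inj (\<lambda>x :: 'a ordinal. Inl (to_nat_on UNIV x) :: nat + 'a)"
    using inj_on_to_nat_on by (auto simp: inj_def inj_on_def)
  then show False
    using no_inj_ordinal by blast
qed

text \<open>A bound must exist before the LEAST in \<open>osup\<close> means anything; countability
  supplies it.\<close>

lemma
  assumes "countable (UNIV :: 'a set)" "countable A"
  shows osup_upper: "a \<in> A \<Longrightarrow> a \<le> (osup A :: 'a ordinal)"
    and less_osup: "b < osup A \<Longrightarrow> \<exists>a\<in>A. b < a"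
proof -
  have *: "\<forall>a\<in>A. a \<le> osup A"
    unfolding osup_def using countable_ordinals_bounded[OF assms] by (rule LeastI_ex)
  show "a \<in> A \<Longrightarrow> a \<le> osup A"
    using * by simp
  show "b < osup A \<Longrightarrow> \<exists>a\<in>A. b < a"
    using not_less_Least[of b "\<lambda>b. \<forall>a\<in>A. a \<le> b"] unfolding osup_def by (auto simp: not_le)
qed

text \<open>Supplies the ranks of the children of a node of rank \<gamma>. A successor gives a
  constant sequence and a limit a strictly increasing one, which is the alternative demanded of
  trees.\<close>

lemma fundamental_sequence:
  assumes "countable {..<\<gamma> :: 'a ordinal}" "\<gamma> \<noteq> 0"
  shows "\<exists>\<sigma> :: nat \<Rightarrow> 'a ordinal. (\<forall>n. \<sigma> n < \<gamma>) \<and> (\<forall>b<\<gamma>. \<exists>n. b \<le> \<sigma> n) \<and>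
    ((\<exists>\<delta>. \<forall>n. \<sigma> n = \<delta>) \<or> strict_mono \<sigma>)"
proof (cases "\<exists>\<delta>. \<gamma> = osuc \<delta>")
  case True
  then obtain \<delta> where "\<gamma> = osuc \<delta>"
    by blast
  then show ?thesis
    by (intro exI[of _ "\<lambda>_. \<delta>"]) (auto simp: less_osuc less_osuc_iff)
next
  case False
  have lim: "osuc b < \<gamma>" if "b < \<gamma>" for b
    using that False osuc_le[OF that] by (metis order_le_less)
  have "0 < \<gamma>"
    using assms(2) zero_le_ordinal[of \<gamma>] by simp
  define e where "e = from_nat_into {..<\<gamma>}"
  have e: "e n < \<gamma>" for n
    using from_nat_into[of "{..<\<gamma>}" n] \<open>0 < \<gamma>\<close> unfolding e_def by auto
  \<comment> \<open>Staying above the enumeration \<open>e\<close> makes the sequence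
    cofinal.\<close>
  have "\<exists>\<sigma>. \<forall>n. (\<sigma> n < \<gamma> \<and> e n \<le> \<sigma> n) \<and> \<sigma> n < \<sigma> (Suc n)"
  proof (rule dependent_nat_choice)
    show "\<exists>x. x < \<gamma> \<and> e 0 \<le> x"
      using e by blast
    show "\<exists>y. (y < \<gamma> \<and> e (Suc n) \<le> y) \<and> x < y" if "x < \<gamma> \<and> e n \<le> x" for x n
      using that e[of "Suc n"] lim[of "max x (e (Suc n))"] less_osuc[of "max x (e (Suc n))"]
      by (intro exI[of _ "osuc (max x (e (Suc n)))"]) auto
  qed
  then obtain \<sigma> where \<sigma>: "\<And>n. \<sigma> n < \<gamma>" "\<And>n. e n \<le> \<sigma> n" "\<And>n. \<sigma> n < \<sigma> (Suc n)"
    by blast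
  moreover have "\<exists>n. b \<le> \<sigma> n" if "b < \<gamma>" for b
  proof -
    obtain n where "e n = b"
      using from_nat_into_surj[OF assms(1), of b] \<open>b < \<gamma>\<close> unfolding e_def by auto
    then show ?thesis
      using \<sigma>(2) by blast
  qed
  ultimately show ?thesis
    by (intro exI[of _ \<sigma>] conjI allI impI disjI2 strict_monoI_Suc)
qed

section \<open>Transfinite derivatives and the height\<close>

lemma derived_zero: "derived X 0 = X"
  by (subst derived.simps) simp

lemma derived_osuc: "derived X (osuc \<alpha>) = nonisolated (derived X \<alpha>)"
  by (subst derived.simps) (auto simp: osuc_neq_zero opred_osuc)

lemma derived_limit:
  "\<alpha> \<noteq> 0 \<Longrightarrow> (\<And>\<beta>. \<alpha> \<noteq> osuc \<beta>) \<Longrightarrow> derived X \<alpha> = (\<Inter>\<beta>\<in>{..<\<alpha>}. derived X \<beta>)"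
  by (subst derived.simps) auto

lemma nonisolated_subset: "nonisolated X \<subseteq> X"
  by (auto simp: nonisolated_def)

lemma nonisolated_iff: "x \<in> nonisolated X \<longleftrightarrow> x \<in> X \<and> x islimpt X"
  unfolding nonisolated_def isolated_in_islimpt_iff by auto

lemma closed_nonisolated: "closed X \<Longrightarrow> closed (nonisolated X)"
proof -
  assume "closed X"
  have "x \<in> nonisolated X" if "x islimpt nonisolated X" for x
  proof -
    have "x islimpt X"
      using that nonisolated_subset by (rule islimpt_subset)
    then show ?thesis
      using \<open>closed X\<close> by (simp add: closed_limpt nonisolated_iff)
  qed
  then show ?thesis
    by (simp add: closed_limpt)
qed

lemma derived_antimono: "\<beta> \<le> \<alpha> \<Longrightarrow> derived X \<alpha> \<subseteq> derived X \<beta>"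
proof (induction \<alpha> rule: less_induct)
  case (less \<alpha>)
  show ?case
  proof (cases "\<beta> = \<alpha>")
    case False
    then have "\<beta> < \<alpha>"
      using less.prems by simp
    show ?thesis
    proof (cases "\<exists>\<gamma>. \<alpha> = osuc \<gamma>")
      case True
      then obtain \<gamma> where \<gamma>: "\<alpha> = osuc \<gamma>"
        by blast
      then have "derived X \<gamma> \<subseteq> derived X \<beta>"
        using less.IH[of \<gamma>] \<open>\<beta> < \<alpha>\<close> by (simp add: less_osuc less_osuc_iff)
      then show ?thesis
        unfolding \<gamma> derived_osuc using nonisolated_subset by blast
    next
      case False
      have "\<alpha> \<noteq> 0"
        using \<open>\<beta> < \<alpha>\<close> not_less_zero_ordinal by blast
      then show ?thesis
        using derived_limit[of \<alpha> X] False \<open>\<beta> < \<alpha>\<close> by auto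
    qed
  qed simp
qed

lemma closed_derived: "closed X \<Longrightarrow> closed (derived X \<alpha>)"
proof (induction \<alpha> rule: less_induct)
  case (less \<alpha>)
  consider "\<alpha> = 0" | \<gamma> where "\<alpha> = osuc \<gamma>" | "\<alpha> \<noteq> 0" "\<And>\<beta>. \<alpha> \<noteq> osuc \<beta>"
    by blast
  then show ?case
  proof cases
    case 1
    then show ?thesis using less.prems by (simp add: derived_zero)
  next
    case (2 \<gamma>)
    then show ?thesis using less by (simp add: derived_osuc less_osuc closed_nonisolated)
  next
    case 3
    show ?thesis
      unfolding derived_limit[OF 3] using less by (intro closed_INT) auto
  qed
qed

lemma islimpt_derived:
  assumes "x \<in> derived X \<alpha>" "\<beta> < \<alpha>"
  shows "x islimpt derived X \<beta>"
  using assms derived_antimono[OF osuc_le[OF assms(2)], of X]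
  by (auto simp: derived_osuc nonisolated_iff)

text \<open>Compactness excludes a limit height: below a limit the derived sets are closed, nonempty
  and decreasing, so they have a common point.\<close>

lemma ht_Some_compact:
  assumes "compact (UNIV :: 'l::metric_space set)" "ht (UNIV :: 'l set) = Some \<beta>"
  obtains \<alpha> where "\<beta> = osuc \<alpha>" "derived (UNIV :: 'l set) \<alpha> \<noteq> {}" "derived (UNIV :: 'l set) \<beta> = {}"
proof -
  let ?D = "derived (UNIV :: 'l set)"
  have ex: "\<exists>\<alpha>. ?D \<alpha> = {}" and \<beta>: "\<beta> = (LEAST \<alpha>. ?D \<alpha> = {})"
    using assms(2) by (auto simp: ht_def split: if_splits)
  have e: "?D \<beta> = {}"
    unfolding \<beta> using ex by (rule LeastI_ex)
  have ne: "?D \<gamma> \<noteq> {}" if "\<gamma> < \<beta>" for \<gamma>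
    using that unfolding \<beta> by (rule not_less_Least)
  have "\<beta> \<noteq> 0"
    using e derived_zero by (metis UNIV_not_empty)
  have "\<exists>\<alpha>. \<beta> = osuc \<alpha>"
  proof (rule ccontr)
    assume "\<not> ?thesis"
    then have "(\<Inter>\<gamma>\<in>{..<\<beta>}. ?D \<gamma>) = {}"
      using derived_limit[OF \<open>\<beta> \<noteq> 0\<close>] e by auto
    moreover have "UNIV \<inter> (\<Inter>\<gamma>\<in>{..<\<beta>}. ?D \<gamma>) \<noteq> {}"
    proof (rule compact_imp_fip_image[OF assms(1)])
      show "closed (?D \<gamma>)" for \<gamma>
        by (simp add: closed_derived)
      fix I :: "'l ordinal set"
      assume I: "finite I" "I \<subseteq> {..<\<beta>}"
      show "UNIV \<inter> (\<Inter>\<gamma>\<in>I. ?D \<gamma>) \<noteq> {}"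
      proof (cases "I = {}")
        case False
        then have "?D (Max I) \<subseteq> (\<Inter>\<gamma>\<in>I. ?D \<gamma>)"
          using I by (intro INF_greatest derived_antimono) auto
        moreover have "?D (Max I) \<noteq> {}"
          using I False Max_in by (intro ne) blast
        ultimately show ?thesis
          by auto
      qed simp
    qed
    ultimately show False
      by simp
  qed
  then obtain \<alpha> where "\<beta> = osuc \<alpha>"
    by blast
  then show ?thesis
    using that e ne less_osuc by blast
qed

text \<open>The derived sets must become stationary, since otherwise choosing a point that is lost
  at each stage would inject \<open>'l ordinal\<close> into the space. The stationary set is the
  perfect kernel.\<close>

lemma ht_None_perfect:
  assumes "ht (UNIV :: 'l::metric_space set) = None"
  obtains K :: "'l::metric_space set" where "K \<noteq> {}" "\<And>x. x \<in> K \<Longrightarrow> x islimpt K"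
proof -
  let ?D = "derived (UNIV :: 'l set)"
  have ne: "?D \<alpha> \<noteq> {}" for \<alpha>
    using assms by (auto simp: ht_def split: if_splits)
  have "\<exists>\<alpha>. ?D \<alpha> = ?D (osuc \<alpha>)"
  proof (rule ccontr)
    assume *: "\<not> ?thesis"
    have "\<forall>\<alpha>. \<exists>x. x \<in> ?D \<alpha> \<and> x \<notin> ?D (osuc \<alpha>)"
    proof
      fix \<alpha>
      have "?D (osuc \<alpha>) \<subseteq> ?D \<alpha>"
        by (simp add: derived_antimono less_imp_le less_osuc)
      then show "\<exists>x. x \<in> ?D \<alpha> \<and> x \<notin> ?D (osuc \<alpha>)"
        using * by blast
    qed
    then obtain g where g: "\<And>\<alpha>. g \<alpha> \<in> ?D \<alpha>" "\<And>\<alpha>. g \<alpha> \<notin> ?D (osuc \<alpha>)"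
      by metis
    have "g \<alpha> \<noteq> g \<beta>" if "\<alpha> < \<beta>" for \<alpha> \<beta>
      using g(1)[of \<beta>] g(2)[of \<alpha>] derived_antimono[OF osuc_le[OF that], of UNIV] by auto
    then have "inj g"
      by (metis injI linorder_neqE)
    then have "inj (\<lambda>\<alpha>. Inr (g \<alpha>) :: nat + 'l)"
      by (auto simp: inj_def)
    then show False
      using no_inj_ordinal by blast
  qed
  then obtain \<alpha> where "?D \<alpha> = ?D (osuc \<alpha>)"
    by blast
  then have "\<And>x. x \<in> ?D \<alpha> \<Longrightarrow> x islimpt ?D \<alpha>"
    by (metis derived_osuc nonisolated_iff)
  then show ?thesis
    using ne[of \<alpha>] by (intro that[of "?D \<alpha>"])
qed

text \<open>Points are only lost at successor stages, so looking for the first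
  \<open>osuc \<beta>\<close> whose derived set misses the point makes \<beta> the last stage that
  still contains it.\<close>

definition cb_rank :: "'a::topological_space \<Rightarrow> 'a ordinal" where
  "cb_rank x = (LEAST \<beta>. x \<notin> derived UNIV (osuc \<beta>))"

lemma
  fixes x :: "'l::metric_space"
  assumes "derived (UNIV :: 'l set) (osuc \<alpha>) = {}"
  shows mem_derived_cb_rank: "x \<in> derived UNIV (cb_rank x)"
    and not_mem_derived_osuc_cb_rank: "x \<notin> derived UNIV (osuc (cb_rank x))"
    and cb_rank_le: "cb_rank x \<le> \<alpha>"
proof -
  let ?D = "derived (UNIV :: 'l set)"
  show "x \<notin> ?D (osuc (cb_rank x))"
    unfolding cb_rank_def by (rule LeastI[of _ \<alpha>]) (simp add: assms)
  show "cb_rank x \<le> \<alpha>"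
    unfolding cb_rank_def by (rule Least_le) (simp add: assms)
  have *: "x \<in> ?D (osuc \<gamma>)" if "\<gamma> < cb_rank x" for \<gamma>
    using not_less_Least that unfolding cb_rank_def by blast
  consider "cb_rank x = 0" | \<gamma> where "cb_rank x = osuc \<gamma>"
    | "cb_rank x \<noteq> 0" "\<And>\<beta>. cb_rank x \<noteq> osuc \<beta>"
    by blast
  then show "x \<in> ?D (cb_rank x)"
  proof cases
    case 1
    then show ?thesis by (simp add: derived_zero)
  next
    case (2 \<gamma>)
    then show ?thesis using *[of \<gamma>] by (simp add: less_osuc)
  next
    case 3
    have "x \<in> ?D \<gamma>" if "\<gamma> < cb_rank x" for \<gamma>
      using *[OF that] derived_antimono less_osuc by (metis less_imp_le subsetD)
    then show ?thesis
      using derived_limit[OF 3] by auto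
  qed
qed

lemma mem_derived_iff_cb_rank:
  fixes x :: "'l::metric_space"
  assumes "derived (UNIV :: 'l set) (osuc \<alpha>) = {}"
  shows "x \<in> derived UNIV \<beta> \<longleftrightarrow> \<beta> \<le> cb_rank x"
proof
  assume x: "x \<in> derived UNIV \<beta>"
  show "\<beta> \<le> cb_rank x"
  proof (rule ccontr)
    assume "\<not> \<beta> \<le> cb_rank x"
    then have "osuc (cb_rank x) \<le> \<beta>"
      by (simp add: osuc_le_iff)
    then show False
      using x derived_antimono not_mem_derived_osuc_cb_rank[OF assms, of x] by blast
  qed
next
  assume "\<beta> \<le> cb_rank x"
  then show "x \<in> derived UNIV \<beta>"
    using derived_antimono mem_derived_cb_rank[OF assms, of x] by blast
qed

text \<open>A point is isolated in the derived set of its own rank, so its other near neighbours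
  have already left that set.\<close>

lemma cb_rank_neighbourhood:
  fixes x :: "'l::metric_space"
  assumes "derived (UNIV :: 'l set) (osuc \<alpha>) = {}"
  obtains e where "e > 0" "\<And>y. dist x y < e \<Longrightarrow> y \<noteq> x \<Longrightarrow> cb_rank y < cb_rank x"
proof -
  have "\<not> x islimpt derived UNIV (cb_rank x)"
    using mem_derived_cb_rank[OF assms, of x] not_mem_derived_osuc_cb_rank[OF assms, of x]
    by (simp add: derived_osuc nonisolated_iff)
  then obtain e where "e > 0" "\<And>y. y \<in> derived UNIV (cb_rank x) \<Longrightarrow> y \<noteq> x \<Longrightarrow> \<not> dist y x < e"
    unfolding islimpt_approachable by blast
  then show ?thesis
    using that mem_derived_iff_cb_rank[OF assms] by (metis dist_commute not_le)
qed

text \<open>Each point is the only point of largest rank in some ball taken from a countable family,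
  namely balls around finite nets with radii \<open>inverse (real (Suc n))\<close>. The ball
  therefore determines the point.\<close>

lemma countable_if_derived_empty:
  assumes "compact (UNIV :: 'l::metric_space set)" "derived (UNIV :: 'l set) (osuc \<alpha>) = {}"
  shows "countable (UNIV :: 'l set)"
proof -
  have "\<forall>n. \<exists>A. finite A \<and> UNIV \<subseteq> (\<Union>c\<in>A. ball (c :: 'l) (inverse (real (Suc n))))"
    using assms(1) unfolding compact_eq_totally_bounded by (metis inverse_positive_iff_positive of_nat_0_less_iff zero_less_Suc)
  then obtain A :: "nat \<Rightarrow> 'l set" where A: "\<And>n. finite (A n)"
    "\<And>n. UNIV \<subseteq> (\<Union>c\<in>A n. ball c (inverse (real (Suc n))))"
    by metis
  have "\<exists>c n. c \<in> A n \<and> dist c x < inverse (real (Suc n)) \<and>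
      (\<forall>y. dist c y < inverse (real (Suc n)) \<longrightarrow> y \<noteq> x \<longrightarrow> cb_rank y < cb_rank x)" for x :: 'l
  proof -
    obtain e where e: "e > 0" "\<And>y. dist x y < e \<Longrightarrow> y \<noteq> x \<Longrightarrow> cb_rank y < cb_rank x"
      using cb_rank_neighbourhood[OF assms(2)] by blast
    obtain n where n: "inverse (real (Suc n)) < e / 2"
      using e(1) reals_Archimedean[of "e / 2"] by auto
    obtain c where c: "c \<in> A n" "dist c x < inverse (real (Suc n))"
      using A(2)[of n] UNIV_I[of x] unfolding subset_iff UN_iff mem_ball by blast
    have "dist x y < e" if "dist c y < inverse (real (Suc n))" for y
      using dist_triangle3[of x y c] that c n by linarith
    then show ?thesis
      using c e(2) by blast
  qed
  then obtain c n where cn: "\<And>x. c x \<in> A (n x)" "\<And>x. dist (c x) x < inverse (real (Suc (n x)))"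
    "\<And>x y. dist (c x) y < inverse (real (Suc (n x))) \<Longrightarrow> y \<noteq> x \<Longrightarrow> cb_rank y < cb_rank x"
    by metis
  have "inj (\<lambda>x. (c x, n x))"
  proof (rule injI)
    fix x y
    assume "(c x, n x) = (c y, n y)"
    then show "x = y"
      using cn(2,3)[of x] cn(2,3)[of y] by (metis Pair_inject not_less_iff_gr_or_eq)
  qed
  moreover have "range (\<lambda>x. (c x, n x)) \<subseteq> (\<Union>n. A n) \<times> UNIV"
    using cn(1) by auto
  moreover have "countable ((\<Union>n. A n) \<times> (UNIV :: nat set))"
    using A(1) by (intro countable_SIGMA countable_UN) (auto intro: countable_finite)
  ultimately show ?thesis
    by (meson countable_image_inj_on countable_subset)
qed

section \<open>Trees\<close>

lemma hereditary_prefix: "hereditary \<Lambda> \<Longrightarrow> t \<in> \<Lambda> \<Longrightarrow> prefix s t \<Longrightarrow> s \<in> \<Lambda>"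
  unfolding hereditary_def by blast

lemma strict_prefix_snoc: "strict_prefix u (s @ [n]) \<longleftrightarrow> prefix u s"
  by (auto simp: strict_prefix_def)

lemma strict_prefix_obtains_snoc:
  assumes "strict_prefix s t"
  obtains n where "prefix (s @ [n]) t"
proof -
  obtain r where "t = s @ r" "r \<noteq> []"
    using assms by (auto simp: strict_prefix_def prefix_def)
  then show ?thesis
    using that[of "hd r"] by (cases r) auto
qed

lemma nonleaves_iff:
  "hereditary \<Lambda> \<Longrightarrow> s \<in> nonleaves \<Lambda> \<longleftrightarrow> s \<in> \<Lambda> \<and> (\<exists>n. s @ [n] \<in> \<Lambda>)"
  unfolding nonleaves_def is_leaf_def
  by (auto elim!: strict_prefix_obtains_snoc intro: hereditary_prefix)
    (metis prefix_order.order_refl strict_prefix_snoc)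

text \<open>Dependent choice along all nodes at once: \<open>P\<close> is the invariant of a node,
  \<open>Q\<close> relates the choice at a node to the choices at its children.\<close>

lemma tree_choice:
  assumes "P [] p0"
    and "\<And>s p. P s p \<Longrightarrow> \<exists>q. (\<forall>n. P (s @ [n]) (q n)) \<and> Q s p q"
  shows "\<exists>F. F [] = p0 \<and> (\<forall>s :: 'a list. P s (F s)) \<and> (\<forall>s. Q s (F s) (\<lambda>n. F (s @ [n])))"
proof -
  obtain q where q: "\<And>s p n. P s p \<Longrightarrow> P (s @ [n]) (q s p n)" "\<And>s p. P s p \<Longrightarrow> Q s p (q s p)"
    using assms(2) by metis
  \<comment> \<open>Nodes grow at their end, so the recursion runs over the reversed list.\<close>
  define F where "F s = rec_list p0 (\<lambda>n r p. q (rev r) p n) (rev s)" for s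
  have F: "F [] = p0" "F (s @ [n]) = q s (F s) n" for s n
    by (auto simp: F_def)
  have P: "P s (F s)" for s
    by (induction s rule: rev_induct) (auto simp: F assms(1) q(1))
  then have "Q s (F s) (\<lambda>n. F (s @ [n]))" for s
    unfolding F(2) using q(2) by auto
  then show ?thesis
    using F(1) P by blast
qed

lemma wf_extension_rel: "no_infinite_branch \<Lambda> \<Longrightarrow> wf (extension_rel \<Lambda>)"
  unfolding wf_iff_no_infinite_down_chain by (auto simp: no_infinite_branch_def extension_rel_def)

lemma countable_ranks: "countable {osuc (tree_rank \<Lambda> t :: 'a ordinal) |t. t \<in> \<Lambda> \<and> strict_prefix s t}"
  by (simp add: setcompr_eq_image)

lemma tree_rank_less:
  assumes "countable (UNIV :: 'a set)" "no_infinite_branch \<Lambda>" "s \<in> \<Lambda>" "t \<in> \<Lambda>" "strict_prefix s t"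
  shows "tree_rank \<Lambda> t < (tree_rank \<Lambda> s :: 'a ordinal)"
proof -
  have "\<not> is_leaf \<Lambda> s"
    using assms by (auto simp: is_leaf_def)
  then have "tree_rank \<Lambda> s = osup {osuc (tree_rank \<Lambda> t :: 'a ordinal) |t. t \<in> \<Lambda> \<and> strict_prefix s t}"
    using tree_rank_eq[OF assms(2,3)] by simp
  moreover have "osuc (tree_rank \<Lambda> t) \<le> osup {osuc (tree_rank \<Lambda> t :: 'a ordinal) |t. t \<in> \<Lambda> \<and> strict_prefix s t}"
    using assms by (intro osup_upper countable_ranks) auto
  ultimately show ?thesis
    by (simp add: osuc_le_iff)
qed

text \<open>Lets pieces of a space be attached to children with arbitrarily large indices. Since the
  ranks of the children are constant or increasing, one suitable child makes all later ones
  suitable.\<close>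

lemma tree_rank_frequently:
  fixes \<gamma> :: "'a ordinal"
  assumes "countable (UNIV :: 'a set)" "tree_of_rank (Some \<beta> :: 'a ordinal option) \<Lambda>" "s \<in> nonleaves \<Lambda>"
    "\<gamma> < tree_rank \<Lambda> s"
  shows "\<exists>n\<ge>m. \<gamma> \<le> tree_rank \<Lambda> (s @ [n])"
proof -
  have her: "hereditary \<Lambda>" and nib: "no_infinite_branch \<Lambda>"
    and mono: "(\<exists>\<gamma> :: 'a ordinal. \<forall>n. tree_rank \<Lambda> (s @ [n]) = \<gamma>) \<or>
          strict_mono (\<lambda>n. tree_rank \<Lambda> (s @ [n]) :: 'a ordinal)"
    using assms(2,3) by auto
  have "s \<in> \<Lambda>" "\<not> is_leaf \<Lambda> s"
    using assms(3) by (auto simp: nonleaves_def)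
  then have "tree_rank \<Lambda> s = osup {osuc (tree_rank \<Lambda> t :: 'a ordinal) |t. t \<in> \<Lambda> \<and> strict_prefix s t}"
    using tree_rank_eq[OF nib \<open>s \<in> \<Lambda>\<close>] by simp
  then obtain t where t: "t \<in> \<Lambda>" "strict_prefix s t" "\<gamma> < osuc (tree_rank \<Lambda> t)"
    using less_osup[OF assms(1) countable_ranks] assms(4) by fastforce
  obtain n where n: "prefix (s @ [n]) t"
    using t(2) by (rule strict_prefix_obtains_snoc)
  have "s @ [n] \<in> \<Lambda>"
    using her t(1) n by (rule hereditary_prefix)
  then have "tree_rank \<Lambda> t \<le> (tree_rank \<Lambda> (s @ [n]) :: 'a ordinal)"
    using tree_rank_less[OF assms(1) nib, of "s @ [n]" t] n t(1) by (cases "t = s @ [n]") (auto simp: strict_prefix_def)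
  then have "\<gamma> \<le> tree_rank \<Lambda> (s @ [n])"
    using t(3) by (simp add: less_osuc_iff)
  moreover have "tree_rank \<Lambda> (s @ [n]) \<le> (tree_rank \<Lambda> (s @ [max m n]) :: 'a ordinal)"
    using mono strict_mono_less_eq[of "\<lambda>n. tree_rank \<Lambda> (s @ [n]) :: 'a ordinal" n "max m n"] by auto
  ultimately show ?thesis
    by (intro exI[of _ "max m n"]) auto
qed

text \<open>Nodes are labelled by ordinals: the root by \<alpha>, the children of a node by a
  fundamental sequence of its label, and label 0 makes a leaf. Labels drop along branches, so no
  branch is infinite, and cofinality makes each label equal to the rank.\<close>

lemma tree_of_rank_exists:
  fixes \<alpha> :: "'a ordinal"
  assumes "countable {..<\<alpha>}"
  shows "\<exists>\<Lambda>. tree_of_rank (Some (osuc \<alpha>)) \<Lambda>"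
proof -
  have "\<forall>\<gamma>. \<exists>\<sigma> :: nat \<Rightarrow> 'a ordinal. \<gamma> \<le> \<alpha> \<longrightarrow> \<gamma> \<noteq> 0 \<longrightarrow> (\<forall>n. \<sigma> n < \<gamma>) \<and>
      (\<forall>b<\<gamma>. \<exists>n. b \<le> \<sigma> n) \<and> ((\<exists>\<delta>. \<forall>n. \<sigma> n = \<delta>) \<or> strict_mono \<sigma>)"
    (is "\<forall>\<gamma>. ?seq \<gamma>")
  proof (intro allI)
    fix \<gamma> :: "'a ordinal"
    show "?seq \<gamma>"
    proof (cases "\<gamma> \<le> \<alpha> \<and> \<gamma> \<noteq> 0")
      case True
      then have "countable {..<\<gamma>}"
        using countable_subset[OF _ assms, of "{..<\<gamma>}"] by auto
      then show ?thesis
        using fundamental_sequence[of \<gamma>] True by blast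
    qed auto
  qed
  then obtain \<sigma> :: "'a ordinal \<Rightarrow> nat \<Rightarrow> 'a ordinal" where
    \<sigma>: "\<And>\<gamma> n. \<gamma> \<le> \<alpha> \<Longrightarrow> \<gamma> \<noteq> 0 \<Longrightarrow> \<sigma> \<gamma> n < \<gamma>"
      "\<And>\<gamma> b. \<gamma> \<le> \<alpha> \<Longrightarrow> \<gamma> \<noteq> 0 \<Longrightarrow> b < \<gamma> \<Longrightarrow> \<exists>n. b \<le> \<sigma> \<gamma> n"
      "\<And>\<gamma>. \<gamma> \<le> \<alpha> \<Longrightarrow> \<gamma> \<noteq> 0 \<Longrightarrow> (\<exists>\<delta>. \<forall>n. \<sigma> \<gamma> n = \<delta>) \<or> strict_mono (\<sigma> \<gamma>)"
    by metis
  define lab where "lab = foldl \<sigma> \<alpha>"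
  have lab: "lab [] = \<alpha>" "lab (s @ [n]) = \<sigma> (lab s) n" for s n
    by (auto simp: lab_def)
  define \<Lambda> where "\<Lambda> = {s. \<forall>u. strict_prefix u s \<longrightarrow> lab u \<noteq> 0}"
  have Nil: "[] \<in> \<Lambda>"
    by (auto simp: \<Lambda>_def)
  have snocI: "s @ [n] \<in> \<Lambda> \<longleftrightarrow> s \<in> \<Lambda> \<and> lab s \<noteq> 0" for s n
    unfolding \<Lambda>_def by (auto simp: strict_prefix_snoc prefix_order.le_less)
  have her: "hereditary \<Lambda>"
    unfolding hereditary_def \<Lambda>_def by (auto intro: prefix_order.less_le_trans)
  have le: "lab s \<le> \<alpha>" if "s \<in> \<Lambda>" for s
    using that
  proof (induction s rule: rev_induct)
    case (snoc n s)
    then have "s \<in> \<Lambda>" "lab s \<noteq> 0"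
      using snocI by blast+
    then show ?case
      using snoc.IH \<sigma>(1)[of "lab s" n] unfolding lab by auto
  qed (simp add: lab)
  have less1: "lab (s @ [n]) < lab s" if "s @ [n] \<in> \<Lambda>" for s n
    using that \<sigma>(1)[of "lab s" n] le[of s] unfolding lab snocI by auto
  have less: "lab (s @ r) < lab s" if "s @ r \<in> \<Lambda>" "r \<noteq> []" for s r
    using that
  proof (induction r rule: rev_induct)
    case (snoc n r)
    have "s @ r \<in> \<Lambda>"
      using snoc.prems(1) her by (auto elim: hereditary_prefix)
    then show ?case
      using snoc.IH less1[of "s @ r" n] snoc.prems(1) by (cases "r = []") auto
  qed simp
  have less: "lab t < lab s" if st: "t \<in> \<Lambda>" "strict_prefix s t" for s t
  proof -
    obtain r where "t = s @ r" "r \<noteq> []"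
      using st(2) by (auto simp: strict_prefix_def prefix_def)
    then show ?thesis
      using less st(1) by blast
  qed
  have nib: "no_infinite_branch \<Lambda>"
    unfolding no_infinite_branch_def
  proof
    assume "\<exists>f. \<forall>n. f n \<in> \<Lambda> \<and> strict_prefix (f n) (f (Suc n))"
    then obtain f where "\<And>n. f n \<in> \<Lambda>" "\<And>n. strict_prefix (f n) (f (Suc n))"
      by blast
    then have "\<forall>n. (lab (f (Suc n)), lab (f n)) \<in> {(x, y). x < y}"
      using less by auto
    then show False
      using wf_less_ordinal[where 'a = 'a] exI[of _ "\<lambda>n. lab (f n)"]
      unfolding wf_iff_no_infinite_down_chain by metis
  qed
  have leaf: "is_leaf \<Lambda> s \<longleftrightarrow> lab s = 0" if "s \<in> \<Lambda>" for s
  proof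
    show "lab s = 0" if "is_leaf \<Lambda> s"
    proof (rule ccontr)
      assume "lab s \<noteq> 0"
      then have "s @ [0] \<in> \<Lambda>"
        using snocI \<open>s \<in> \<Lambda>\<close> by blast
      then show False
        using \<open>is_leaf \<Lambda> s\<close> unfolding is_leaf_def by (auto simp: strict_prefix_snoc)
    qed
    show "is_leaf \<Lambda> s" if "lab s = 0"
      using that \<open>s \<in> \<Lambda>\<close> less not_less_zero_ordinal unfolding is_leaf_def by metis
  qed
  have rank: "tree_rank \<Lambda> s = lab s" if "s \<in> \<Lambda>" for s
    using wf_extension_rel[OF nib] that
  proof (induction s rule: wf_induct_rule)
    case (less s)
    show ?case
    proof (cases "lab s = 0")
      case True
      then show ?thesis
        using tree_rank_eq[OF nib less.prems, where 'a = 'a] leaf[OF less.prems] by simp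
    next
      case False
      have eq: "{osuc (tree_rank \<Lambda> t) |t. t \<in> \<Lambda> \<and> strict_prefix s t} = {osuc (lab t) |t. t \<in> \<Lambda> \<and> strict_prefix s t}"
        using less by (intro Collect_cong) (force simp: extension_rel_def)
      have "osup {osuc (lab t) |t. t \<in> \<Lambda> \<and> strict_prefix s t} = lab s"
        unfolding osup_def
      proof (rule Least_equality)
        show "\<forall>\<beta>\<in>{osuc (lab t) |t. t \<in> \<Lambda> \<and> strict_prefix s t}. \<beta> \<le> lab s"
          using \<open>\<And>s t. t \<in> \<Lambda> \<Longrightarrow> strict_prefix s t \<Longrightarrow> lab t < lab s\<close> by (auto simp: osuc_le_iff)
        fix b
        assume b: "\<forall>\<beta>\<in>{osuc (lab t) |t. t \<in> \<Lambda> \<and> strict_prefix s t}. \<beta> \<le> b"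
        show "lab s \<le> b"
        proof (rule ccontr)
          assume "\<not> lab s \<le> b"
          then obtain n where n: "b \<le> lab (s @ [n])"
            using \<sigma>(2)[of "lab s" b] le[OF less.prems] False by (auto simp: lab not_le)
          have "s @ [n] \<in> \<Lambda>"
            using snocI False less.prems by blast
          then have "osuc (lab (s @ [n])) \<le> b"
            using b strict_prefix_snoc[of s s n] by (intro b[rule_format]) auto
          then show False
            using n by (simp add: osuc_le_iff)
        qed
      qed
      then show ?thesis
        using tree_rank_eq[OF nib less.prems, where 'a = 'a] leaf[OF less.prems] False eq by simp
    qed
  qed
  have "is_leaf \<Lambda> s \<or> (\<forall>n. s @ [n] \<in> \<Lambda>)" if "s \<in> \<Lambda>" for s
    using that leaf snocI by blast
  moreover have "(\<exists>\<gamma> :: 'a ordinal. \<forall>n. tree_rank \<Lambda> (s @ [n]) = \<gamma>) \<or>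
      strict_mono (\<lambda>n. tree_rank \<Lambda> (s @ [n]) :: 'a ordinal)"
    if "s \<in> nonleaves \<Lambda>" for s
  proof -
    have s: "s \<in> \<Lambda>" "lab s \<noteq> 0"
      using that leaf by (auto simp: nonleaves_def)
    then have "(tree_rank \<Lambda> (s @ [n]) :: 'a ordinal) = \<sigma> (lab s) n" for n
      using rank[of "s @ [n]"] snocI lab by simp
    then show ?thesis
      using \<sigma>(3)[OF le[OF s(1)] s(2)] by simp
  qed
  ultimately have "tree_of_rank (Some (osuc \<alpha>)) \<Lambda>"
    using assms her Nil nib rank[OF Nil] lab(1) by auto
  then show ?thesis
    by blast
qed

section \<open>Tree functions\<close>

text \<open>The inverse of forming the branch sums \<open>tree_delta\<close>; the root has no parent
  to subtract.\<close>

definition tree_diff :: "nat list set \<Rightarrow> (nat list \<Rightarrow> real) \<Rightarrow> nat list \<Rightarrow> real" where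
  "tree_diff \<Lambda> G s = (if s \<in> \<Lambda> then if s = [] then G [] else G s - G (butlast s) else 0)"

lemma tree_diff_snoc: "s @ [n] \<in> \<Lambda> \<Longrightarrow> tree_diff \<Lambda> G (s @ [n]) = G (s @ [n]) - G s"
  by (simp add: tree_diff_def)

lemma finite_prefixes: "finite {s. prefix s t}"
  using List.finite_set[of "prefixes t"] by (simp add: set_prefixes_eq)

lemma tree_delta_Nil [simp]: "tree_delta [] a = a []"
  by (simp add: tree_delta_def)

lemma tree_delta_snoc [simp]: "tree_delta (t @ [n]) a = tree_delta t a + a (t @ [n])"
proof -
  have "{s. prefix s (t @ [n])} = insert (t @ [n]) {s. prefix s t}"
    by (auto simp: prefix_snoc)
  moreover have "\<not> prefix (t @ [n]) t"
    by (metis prefix_order.less_irrefl strict_prefix_snoc)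
  ultimately show ?thesis
    by (simp add: tree_delta_def finite_prefixes)
qed

lemma snoc_mem_hereditary: "hereditary \<Lambda> \<Longrightarrow> s @ [n] \<in> \<Lambda> \<Longrightarrow> s \<in> \<Lambda>"
  by (auto elim: hereditary_prefix)

lemma tree_delta_tree_diff: "hereditary \<Lambda> \<Longrightarrow> t \<in> \<Lambda> \<Longrightarrow> tree_delta t (tree_diff \<Lambda> G) = G t"
  by (induction t rule: rev_induct)
    (auto simp: tree_diff_snoc dest: snoc_mem_hereditary, simp add: tree_diff_def)

lemma tree_delta_restr_above:
  assumes "hereditary \<Lambda>" "t \<in> \<Lambda>"
  shows "tree_delta t (restr a {t \<in> \<Lambda>. prefix (s @ [n]) t}) =
    (if prefix (s @ [n]) t then tree_delta t a - tree_delta s a else 0)"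
  using assms(2)
proof (induction t rule: rev_induct)
  case (snoc m t)
  then have t: "t \<in> \<Lambda>"
    using assms(1) by (auto dest: snoc_mem_hereditary)
  have "\<not> prefix (s @ [n]) s"
    by (metis prefix_order.less_irrefl strict_prefix_snoc)
  then show ?case
    using snoc t by (auto simp: restr_def prefix_snoc)
qed (simp add: restr_def)

lemma tree_delta_restr_length:
  assumes "hereditary \<Lambda>" "t \<in> \<Lambda>"
  shows "tree_delta t (restr a {t \<in> \<Lambda>. Suc n \<le> length t}) = tree_delta t a - tree_delta (take n t) a"
  using assms(2)
proof (induction t rule: rev_induct)
  case (snoc m t)
  then have t: "t \<in> \<Lambda>"
    using assms(1) by (auto dest: snoc_mem_hereditary)
  show ?case
    using snoc t by (cases "n \<le> length t") (auto simp: restr_def)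
qed (simp add: restr_def)

lemma tree_norm_le_iff:
  assumes "\<Lambda> \<noteq> {}" "bdd_above ((\<lambda>t. \<bar>tree_delta t a\<bar>) ` \<Lambda>)"
  shows "tree_norm \<Lambda> a \<le> c \<longleftrightarrow> (\<forall>t\<in>\<Lambda>. \<bar>tree_delta t a\<bar> \<le> c)"
  unfolding tree_norm_def using assms by (simp add: cSUP_le_iff)

lemma tree_norm_nonneg:
  assumes "\<Lambda> \<noteq> {}" "bdd_above ((\<lambda>t. \<bar>tree_delta t a\<bar>) ` \<Lambda>)"
  shows "0 \<le> tree_norm \<Lambda> a"
proof -
  obtain t where "t \<in> \<Lambda>"
    using assms(1) by blast
  then have "\<bar>tree_delta t a\<bar> \<le> tree_norm \<Lambda> a"
    using tree_norm_le_iff[OF assms, of "tree_norm \<Lambda> a"] by simp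
  then show ?thesis
    by linarith
qed

text \<open>Conditions (A.1) to (A.3) in terms of the branch sums: the norm of a restriction of
  \<open>a\<close> becomes a supremum of differences of \<open>G\<close>. Weak inequalities are used
  because they pass to suprema.\<close>

definition tree_cont :: "nat list set \<Rightarrow> (nat list \<Rightarrow> real) \<Rightarrow> bool" where
  "tree_cont \<Lambda> G \<longleftrightarrow>
    bdd_above ((\<lambda>t. \<bar>G t\<bar>) ` \<Lambda>) \<and>
    (\<forall>s\<in>nonleaves \<Lambda>. \<forall>\<epsilon>>0. \<exists>N. \<forall>n\<ge>N. \<forall>t\<in>\<Lambda>. prefix (s @ [n]) t \<longrightarrow> \<bar>G t - G s\<bar> \<le> \<epsilon>) \<and>
    (\<forall>\<epsilon>>0. \<exists>N. \<forall>n\<ge>N. \<forall>t\<in>\<Lambda>. \<bar>G t - G (take n t)\<bar> \<le> \<epsilon>)"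

lemma tree_cont_bounded:
  assumes "tree_cont \<Lambda> G"
  obtains B where "\<And>t. t \<in> \<Lambda> \<Longrightarrow> \<bar>G t\<bar> \<le> B"
  using assms by (auto simp: tree_cont_def bdd_above_def)

lemma tree_cont_children:
  assumes "tree_cont \<Lambda> G" "s \<in> nonleaves \<Lambda>" "\<epsilon> > 0"
  obtains N where "\<And>n t. n \<ge> N \<Longrightarrow> t \<in> \<Lambda> \<Longrightarrow> prefix (s @ [n]) t \<Longrightarrow> \<bar>G t - G s\<bar> \<le> \<epsilon>"
proof -
  have "\<exists>N. \<forall>n\<ge>N. \<forall>t\<in>\<Lambda>. prefix (s @ [n]) t \<longrightarrow> \<bar>G t - G s\<bar> \<le> \<epsilon>"
    using assms by (simp add: tree_cont_def)
  then show ?thesis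
    using that by blast
qed

lemma tree_cont_take:
  assumes "tree_cont \<Lambda> G" "\<epsilon> > 0"
  obtains N where "\<And>n t. n \<ge> N \<Longrightarrow> t \<in> \<Lambda> \<Longrightarrow> \<bar>G t - G (take n t)\<bar> \<le> \<epsilon>"
proof -
  have "\<exists>N. \<forall>n\<ge>N. \<forall>t\<in>\<Lambda>. \<bar>G t - G (take n t)\<bar> \<le> \<epsilon>"
    using assms by (simp add: tree_cont_def)
  then show ?thesis
    using that by blast
qed

lemma lim_zero_iff:
  fixes c :: "nat \<Rightarrow> real"
  assumes "\<And>n. 0 \<le> c n"
  shows "c \<longlonglongrightarrow> 0 \<longleftrightarrow> (\<forall>\<epsilon>>0. \<exists>N. \<forall>n\<ge>N. c n \<le> \<epsilon>)"
proof
  show "\<forall>\<epsilon>>0. \<exists>N. \<forall>n\<ge>N. c n \<le> \<epsilon>" if "c \<longlonglongrightarrow> 0"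
    using that assms unfolding LIMSEQ_def by (fastforce simp: dist_real_def)
  assume *: "\<forall>\<epsilon>>0. \<exists>N. \<forall>n\<ge>N. c n \<le> \<epsilon>"
  show "c \<longlonglongrightarrow> 0"
    unfolding LIMSEQ_def
  proof (intro allI impI)
    fix r :: real
    assume "0 < r"
    then obtain N where "\<And>n. n \<ge> N \<Longrightarrow> c n \<le> r / 2"
      using *[rule_format, of "r / 2"] by auto
    then have "\<And>n. n \<ge> N \<Longrightarrow> dist (c n) 0 < r"
      using assms \<open>0 < r\<close> by (fastforce simp: dist_real_def)
    then show "\<exists>N. \<forall>n\<ge>N. dist (c n) 0 < r"
      by blast
  qed
qed

text \<open>Restricting \<open>a\<close> to the nodes above \<open>s @ [n]\<close> removes the
  common part \<open>tree_delta s a\<close> of the branch sums there and makes the others 0;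
  restricting to high levels removes the sum up to a truncation of the branch.\<close>

lemma tree_space_iff:
  assumes "hereditary \<Lambda>" "[] \<in> \<Lambda>"
  shows "a \<in> tree_space \<Lambda> \<longleftrightarrow> (\<forall>t. t \<notin> \<Lambda> \<longrightarrow> a t = 0) \<and> tree_cont \<Lambda> (\<lambda>t. tree_delta t a)"
proof -
  have "((\<lambda>n. tree_norm \<Lambda> (restr a {t \<in> \<Lambda>. prefix (s @ [n]) t})) \<longlonglongrightarrow> 0) \<longleftrightarrow>
      (\<forall>\<epsilon>>0. \<exists>N. \<forall>n\<ge>N. \<forall>t\<in>\<Lambda>. prefix (s @ [n]) t \<longrightarrow> \<bar>tree_delta t a - tree_delta s a\<bar> \<le> \<epsilon>)"
    and "((\<lambda>n. tree_norm \<Lambda> (restr a {t \<in> \<Lambda>. n \<le> length t})) \<longlonglongrightarrow> 0) \<longleftrightarrow>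
      (\<forall>\<epsilon>>0. \<exists>N. \<forall>n\<ge>N. \<forall>t\<in>\<Lambda>. \<bar>tree_delta t a - tree_delta (take n t) a\<bar> \<le> \<epsilon>)" (is "?levels \<longleftrightarrow> ?unif")
    if bdd0: "bdd_above ((\<lambda>t. \<bar>tree_delta t a\<bar>) ` \<Lambda>)" and s: "s \<in> \<Lambda>" for s
  proof -
    have ne: "\<Lambda> \<noteq> {}"
      using assms(2) by blast
    obtain B where B: "\<And>t. t \<in> \<Lambda> \<Longrightarrow> \<bar>tree_delta t a\<bar> \<le> B"
      using bdd0 by (auto simp: bdd_above_def)
    have B0: "0 \<le> B"
      using B[OF assms(2)] by linarith
    have dB: "\<bar>tree_delta t a - tree_delta u a\<bar> \<le> 2 * B" if "t \<in> \<Lambda>" "u \<in> \<Lambda>" for t u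
      using B[OF that(1)] B[OF that(2)] by linarith
    have bdd: "bdd_above ((\<lambda>t. \<bar>tree_delta t (restr a {t \<in> \<Lambda>. prefix (s @ [n]) t})\<bar>) ` \<Lambda>)" for n
      unfolding bdd_above_def using s B0 dB
      by (intro exI[of _ "2 * B"]) (auto simp: tree_delta_restr_above[OF assms(1)])
    have iff: "tree_norm \<Lambda> (restr a {t \<in> \<Lambda>. prefix (s @ [n]) t}) \<le> \<epsilon> \<longleftrightarrow>
        (\<forall>t\<in>\<Lambda>. prefix (s @ [n]) t \<longrightarrow> \<bar>tree_delta t a - tree_delta s a\<bar> \<le> \<epsilon>)" if "\<epsilon> > 0" for n \<epsilon>
      unfolding tree_norm_le_iff[OF ne bdd] using that
      by (auto simp: tree_delta_restr_above[OF assms(1)])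
    show "((\<lambda>n. tree_norm \<Lambda> (restr a {t \<in> \<Lambda>. prefix (s @ [n]) t})) \<longlonglongrightarrow> 0) \<longleftrightarrow>
      (\<forall>\<epsilon>>0. \<exists>N. \<forall>n\<ge>N. \<forall>t\<in>\<Lambda>. prefix (s @ [n]) t \<longrightarrow> \<bar>tree_delta t a - tree_delta s a\<bar> \<le> \<epsilon>)"
      unfolding lim_zero_iff[OF tree_norm_nonneg[OF ne bdd]] using iff by simp
    have tk: "take n t \<in> \<Lambda>" if "t \<in> \<Lambda>" for n t
      using assms(1) that by (rule hereditary_prefix) (rule take_is_prefix)
    have bdd': "bdd_above ((\<lambda>t. \<bar>tree_delta t (restr a {t \<in> \<Lambda>. Suc n \<le> length t})\<bar>) ` \<Lambda>)" for n
      unfolding bdd_above_def using tk dB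
      by (intro exI[of _ "2 * B"]) (auto simp: tree_delta_restr_length[OF assms(1)] simp del: Suc_le_eq)
    have iff': "tree_norm \<Lambda> (restr a {t \<in> \<Lambda>. Suc n \<le> length t}) \<le> \<epsilon> \<longleftrightarrow>
        (\<forall>t\<in>\<Lambda>. \<bar>tree_delta t a - tree_delta (take n t) a\<bar> \<le> \<epsilon>)" for n \<epsilon>
      unfolding tree_norm_le_iff[OF ne bdd'] by (simp add: tree_delta_restr_length[OF assms(1)] del: Suc_le_eq)
    \<comment> \<open>The shift by one does not affect the limit. It is there because discarding
      levels below \<open>Suc n\<close> subtracts the branch sum at \<open>take n t\<close>.\<close>
    have "?levels \<longleftrightarrow> ((\<lambda>n. tree_norm \<Lambda> (restr a {t \<in> \<Lambda>. Suc n \<le> length t})) \<longlonglongrightarrow> 0)"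
      by (rule filterlim_sequentially_Suc[symmetric])
    also have "\<dots> \<longleftrightarrow> ?unif"
      unfolding lim_zero_iff[OF tree_norm_nonneg[OF ne bdd']] iff' by simp
    finally show "?levels \<longleftrightarrow> ?unif" .
  qed
  note * = this
  have nl: "s \<in> \<Lambda>" if "s \<in> nonleaves \<Lambda>" for s
    using that by (auto simp: nonleaves_def)
  show ?thesis
    unfolding tree_space_def tree_cont_def mem_Collect_eq
    using *(1)[OF _ nl] *(2)[OF _ assms(2)] by meson
qed

lemma tree_delta_le_tree_norm:
  assumes "hereditary \<Lambda>" "[] \<in> \<Lambda>" "a \<in> tree_space \<Lambda>" "t \<in> \<Lambda>"
  shows "\<bar>tree_delta t a\<bar> \<le> tree_norm \<Lambda> a"
  unfolding tree_norm_def using assms by (intro cSUP_upper) (auto simp: tree_space_def)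

lemma tree_cont_cong:
  assumes "hereditary \<Lambda>" "tree_cont \<Lambda> G" "\<And>t. t \<in> \<Lambda> \<Longrightarrow> G t = H t"
  shows "tree_cont \<Lambda> H"
proof -
  have *: "take n t \<in> \<Lambda>" if "t \<in> \<Lambda>" for n t
    using assms(1) that by (rule hereditary_prefix) (rule take_is_prefix)
  have nl: "s \<in> \<Lambda>" if "s \<in> nonleaves \<Lambda>" for s
    using that by (auto simp: nonleaves_def)
  show ?thesis
    using assms(2) unfolding tree_cont_def by (simp add: assms(3) * nl cong: image_cong)
qed

lemma tree_diff_in_tree_space:
  assumes "hereditary \<Lambda>" "[] \<in> \<Lambda>" "tree_cont \<Lambda> G"
  shows "tree_diff \<Lambda> G \<in> tree_space \<Lambda>"
  unfolding tree_space_iff[OF assms(1,2)]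
  using tree_cont_cong[OF assms(1,3), of "\<lambda>t. tree_delta t (tree_diff \<Lambda> G)"] tree_delta_tree_diff[OF assms(1)]
  by (auto simp: tree_diff_def)

text \<open>The single combination covers sums (\<open>c = 1\<close>) and multiples
  (\<open>H = 0\<close>), so linearity is stated in this form throughout.\<close>

lemma tree_cont_combine:
  assumes "tree_cont \<Lambda> G" "tree_cont \<Lambda> H"
  shows "tree_cont \<Lambda> (\<lambda>s. c * G s + H s)"
proof -
  have *: "\<bar>c * G s + H s - (c * G t + H t)\<bar> \<le> \<epsilon>"
    if "\<bar>G s - G t\<bar> \<le> \<epsilon> / (2 * (\<bar>c\<bar> + 1))" "\<bar>H s - H t\<bar> \<le> \<epsilon> / 2" "\<epsilon> > 0" for s t and \<epsilon> :: real
  proof -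
    have "\<bar>c\<bar> * \<bar>G s - G t\<bar> \<le> (\<bar>c\<bar> + 1) * (\<epsilon> / (2 * (\<bar>c\<bar> + 1)))"
      using that by (intro mult_mono) auto
    also have "\<dots> = \<epsilon> / 2"
      by (simp add: field_simps add_pos_nonneg)
    finally have "\<bar>c * (G s - G t)\<bar> \<le> \<epsilon> / 2"
      by (simp add: abs_mult)
    then show ?thesis
      using that(2) unfolding right_diff_distrib by linarith
  qed
  have pos: "\<epsilon> / (2 * (\<bar>c\<bar> + 1)) > 0" "\<epsilon> / 2 > 0" if "\<epsilon> > 0" for \<epsilon> :: real
    using that by (auto simp: add_nonneg_pos)
  obtain B C where BC: "\<And>t. t \<in> \<Lambda> \<Longrightarrow> \<bar>G t\<bar> \<le> B" "\<And>t. t \<in> \<Lambda> \<Longrightarrow> \<bar>H t\<bar> \<le> C"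
    using assms by (auto simp: tree_cont_def bdd_above_def)
  have "\<bar>c * G t + H t\<bar> \<le> \<bar>c\<bar> * B + C" if "t \<in> \<Lambda>" for t
    using abs_triangle_ineq[of "c * G t" "H t"] mult_left_mono[OF BC(1)[OF that] abs_ge_zero[of c]] BC(2)[OF that]
    by (simp add: abs_mult)
  then have "bdd_above ((\<lambda>t. \<bar>c * G t + H t\<bar>) ` \<Lambda>)"
    by (auto simp: bdd_above_def)
  moreover have "\<exists>N. \<forall>n\<ge>N. \<forall>t\<in>\<Lambda>. prefix (s @ [n]) t \<longrightarrow> \<bar>c * G t + H t - (c * G s + H s)\<bar> \<le> \<epsilon>"
    if s: "s \<in> nonleaves \<Lambda>" and e: "\<epsilon> > 0" for s \<epsilon>
  proof -
    obtain N where N: "\<And>n t. n \<ge> N \<Longrightarrow> t \<in> \<Lambda> \<Longrightarrow> prefix (s @ [n]) t \<Longrightarrow> \<bar>G t - G s\<bar> \<le> \<epsilon> / (2 * (\<bar>c\<bar> + 1))"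
      using tree_cont_children[OF assms(1) s pos(1)[OF e]] by blast
    obtain M where M: "\<And>n t. n \<ge> M \<Longrightarrow> t \<in> \<Lambda> \<Longrightarrow> prefix (s @ [n]) t \<Longrightarrow> \<bar>H t - H s\<bar> \<le> \<epsilon> / 2"
      using tree_cont_children[OF assms(2) s pos(2)[OF e]] by blast
    show ?thesis
      using * e N M by (intro exI[of _ "max N M"]) auto
  qed
  moreover have "\<exists>N. \<forall>n\<ge>N. \<forall>t\<in>\<Lambda>. \<bar>c * G t + H t - (c * G (take n t) + H (take n t))\<bar> \<le> \<epsilon>"
    if e: "\<epsilon> > 0" for \<epsilon>
  proof -
    obtain N where N: "\<And>n t. n \<ge> N \<Longrightarrow> t \<in> \<Lambda> \<Longrightarrow> \<bar>G t - G (take n t)\<bar> \<le> \<epsilon> / (2 * (\<bar>c\<bar> + 1))"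
      using tree_cont_take[OF assms(1) pos(1)[OF e]] by blast
    obtain M where M: "\<And>n t. n \<ge> M \<Longrightarrow> t \<in> \<Lambda> \<Longrightarrow> \<bar>H t - H (take n t)\<bar> \<le> \<epsilon> / 2"
      using tree_cont_take[OF assms(2) pos(2)[OF e]] by blast
    show ?thesis
      using * e N M by (intro exI[of _ "max N M"]) auto
  qed
  ultimately show ?thesis
    by (auto simp: tree_cont_def)
qed

section \<open>Finite truncations of a tree and the retractions onto them\<close>

definition tree_cut :: "nat \<Rightarrow> nat list \<Rightarrow> nat list" where
  "tree_cut N t = takeWhile (\<lambda>k. k \<le> N) (take N t)"

definition tree_trunc :: "nat list set \<Rightarrow> nat \<Rightarrow> nat list set" where
  "tree_trunc \<Lambda> N = {s \<in> \<Lambda>. length s \<le> N \<and> set s \<subseteq> {..N}}"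

lemma prefix_tree_cut: "prefix (tree_cut N t) t"
  unfolding tree_cut_def using prefix_order.order_trans[OF takeWhile_is_prefix take_is_prefix] .

lemma prefix_tree_cutI:
  assumes "prefix s t" "length s \<le> N" "set s \<subseteq> {..N}"
  shows "prefix s (tree_cut N t)"
proof -
  obtain r where "t = s @ r"
    using assms(1) by (auto simp: prefix_def)
  then show ?thesis
    using assms(2,3) unfolding tree_cut_def by (auto simp: takeWhile_append2 subset_iff)
qed

lemma tree_cut_eq: "length s \<le> N \<Longrightarrow> set s \<subseteq> {..N} \<Longrightarrow> tree_cut N s = s"
  unfolding tree_cut_def by (auto simp: takeWhile_eq_all_conv subset_iff)

text \<open>If appending \<open>n\<close> leads to a node outside the truncation, then the length
  exceeds \<open>N\<close>, or \<open>n\<close> does, or an earlier entry does; in each case the cut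
  stops before \<open>n\<close>. Hence a function composed with the cut has zero differences outside
  the truncation.\<close>

lemma tree_cut_snoc:
  "\<not> (length (u @ [n]) \<le> N \<and> set (u @ [n]) \<subseteq> {..N}) \<Longrightarrow> tree_cut N (u @ [n]) = tree_cut N u"
proof (cases "length u < N")
  case True
  assume *: "\<not> (length (u @ [n]) \<le> N \<and> set (u @ [n]) \<subseteq> {..N})"
  have "takeWhile (\<lambda>k. k \<le> N) (u @ [n]) = takeWhile (\<lambda>k. k \<le> N) u"
  proof (cases "\<forall>k\<in>set u. k \<le> N")
    case all: True
    then have "\<not> n \<le> N"
      using * True by auto
    moreover have "takeWhile (\<lambda>k. k \<le> N) u = u"
      using all by (simp add: takeWhile_eq_all_conv)
    moreover have "takeWhile (\<lambda>k. k \<le> N) (u @ [n]) = u @ takeWhile (\<lambda>k. k \<le> N) [n]"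
      by (rule takeWhile_append2) (use all in auto)
    ultimately show ?thesis
      by (simp only: takeWhile.simps if_False append_Nil2)
  next
    case False
    then obtain k where "k \<in> set u" "\<not> k \<le> N"
      by blast
    then show ?thesis
      by (rule takeWhile_append1)
  qed
  moreover have "take N (u @ [n]) = u @ [n]" "take N u = u"
    using True by auto
  ultimately show ?thesis
    by (simp only: tree_cut_def)
qed (simp add: tree_cut_def)

lemma finite_tree_trunc: "finite (tree_trunc \<Lambda> N)"
  by (rule finite_subset[OF _ finite_lists_length_le[of "{..N}" N]]) (auto simp: tree_trunc_def)

lemma tree_trunc_snoc: "hereditary \<Lambda> \<Longrightarrow> s @ [n] \<in> tree_trunc \<Lambda> N \<Longrightarrow> s \<in> tree_trunc \<Lambda> N"
  unfolding tree_trunc_def by (auto dest: snoc_mem_hereditary)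

lemma tree_trunc_Nil: "[] \<in> \<Lambda> \<Longrightarrow> [] \<in> tree_trunc \<Lambda> N"
  unfolding tree_trunc_def by auto

text \<open>Backward induction from a level \<open>M\<close> beyond which \<open>G\<close> stays
  within \<epsilon>/2 of its values at level \<open>M\<close>. Below that level, all but finitely
  many children of a node carry values within \<epsilon>/2 of the value at the node, and the
  remaining finitely many are handled by the induction hypothesis.\<close>

lemma tree_cut_uniform:
  assumes her: "hereditary \<Lambda>" and Nil: "[] \<in> \<Lambda>" and "tree_cont \<Lambda> G" "\<epsilon> > 0"
  shows "\<exists>N0. \<forall>N\<ge>N0. \<forall>t\<in>\<Lambda>. \<bar>G t - G (tree_cut N t)\<bar> \<le> \<epsilon>"
proof -
  define good where "good s \<longleftrightarrow> (\<exists>N0. \<forall>N\<ge>N0. \<forall>t\<in>\<Lambda>. prefix s t \<longrightarrow> \<bar>G t - G (tree_cut N t)\<bar> \<le> \<epsilon>)" for s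
  have mem: "tree_cut N t \<in> \<Lambda>" if "t \<in> \<Lambda>" for N t
    using her that prefix_tree_cut by (rule hereditary_prefix)
  have "\<epsilon> / 2 > 0"
    using \<open>\<epsilon> > 0\<close> by simp
  obtain M where *: "\<And>n t. n \<ge> M \<Longrightarrow> t \<in> \<Lambda> \<Longrightarrow> \<bar>G t - G (take n t)\<bar> \<le> \<epsilon> / 2"
    using tree_cont_take[OF assms(3) \<open>\<epsilon> / 2 > 0\<close>] by blast
  note M = *[OF order_refl]
  \<comment> \<open>Here \<open>k\<close> counts the levels from \<open>s\<close> up to
    \<open>M\<close>.\<close>
  have "good s" if "s \<in> \<Lambda>" "length s + k = M" for s k
    using that
  proof (induction k arbitrary: s)
    case 0
    have "\<bar>G t - G (tree_cut N t)\<bar> \<le> \<epsilon>"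
      if N: "Max (insert M (set s)) \<le> N" and t: "t \<in> \<Lambda>" "prefix s t" for N t
    proof -
      have "prefix s (tree_cut N t)"
        using N 0 by (intro prefix_tree_cutI[OF t(2)]) auto
      then have s: "take M t = s" "take M (tree_cut N t) = s"
        using t(2) 0 by (auto simp: prefix_def)
      show ?thesis
        using M[OF t(1)] M[OF mem[OF t(1)], of N] unfolding s by linarith
    qed
    then show ?case
      unfolding good_def by blast
  next
    case (Suc k)
    show ?case
    proof (cases "s \<in> nonleaves \<Lambda>")
      case False
      have "\<bar>G t - G (tree_cut N t)\<bar> \<le> \<epsilon>"
        if N: "Max (insert M (set s)) \<le> N" and t: "t \<in> \<Lambda>" "prefix s t" for N t
      proof -
        have "t = s"
          using False Suc.prems(1) t by (auto simp: nonleaves_def is_leaf_def strict_prefix_def)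
        moreover have "tree_cut N s = s"
          using N Suc.prems(2) by (intro tree_cut_eq) auto
        ultimately show ?thesis
          using \<open>\<epsilon> > 0\<close> by simp
      qed
      then show ?thesis
        unfolding good_def by blast
    next
      case True
      then obtain n0 where n0: "\<And>n t. n \<ge> n0 \<Longrightarrow> t \<in> \<Lambda> \<Longrightarrow> prefix (s @ [n]) t \<Longrightarrow> \<bar>G t - G s\<bar> \<le> \<epsilon> / 2"
        using tree_cont_children[OF assms(3) True \<open>\<epsilon> / 2 > 0\<close>] by blast
      have "good (s @ [n])" for n
      proof (cases "s @ [n] \<in> \<Lambda>")
        case True
        then show ?thesis
          using Suc by simp
      next
        case False
        then have "\<not> prefix (s @ [n]) t" if "t \<in> \<Lambda>" for t
          using her that hereditary_prefix by blast
        then show ?thesis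
          unfolding good_def by blast
      qed
      then obtain K where K: "\<And>n N t. N \<ge> K n \<Longrightarrow> t \<in> \<Lambda> \<Longrightarrow> prefix (s @ [n]) t \<Longrightarrow> \<bar>G t - G (tree_cut N t)\<bar> \<le> \<epsilon>"
        unfolding good_def by metis
      have "\<bar>G t - G (tree_cut N t)\<bar> \<le> \<epsilon>"
        \<comment> \<open>The first two bounds let the cut keep all of \<open>s\<close>; the images
          under \<open>K\<close> serve the finitely many children before \<open>n0\<close>.\<close>
        if N: "Max (insert M (set s \<union> K ` {..<n0})) \<le> N" and t: "t \<in> \<Lambda>" "prefix s t" for N t
      proof -
        have pre: "prefix s (tree_cut N t)"
          using N Suc.prems(2) by (intro prefix_tree_cutI[OF t(2)]) auto
        show ?thesis
        proof (cases "t = s")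
          case True
          then have "tree_cut N t = t"
            using pre prefix_order.antisym[OF prefix_tree_cut] by blast
          then show ?thesis
            using \<open>\<epsilon> > 0\<close> by simp
        next
          case False
          then obtain n where n: "prefix (s @ [n]) t"
            using t(2) strict_prefix_obtains_snoc[of s t] by (auto simp: strict_prefix_def)
          show ?thesis
          proof (cases "n < n0")
            case True
            then show ?thesis
              using K[OF _ t(1) n] N by simp
          next
            case False
            then have 1: "\<bar>G t - G s\<bar> \<le> \<epsilon> / 2"
              using n0[OF _ t(1) n] by (simp add: not_less)
            \<comment> \<open>The cut stops at \<open>s\<close> or enters the same child as
              \<open>t\<close>; either way its value is within \<epsilon>/2 of
              \<open>G s\<close>.\<close>
            have "tree_cut N t = s \<or> prefix (s @ [n]) (tree_cut N t)"
              using prefix_same_cases[OF n prefix_tree_cut[of N t]] pre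
              by (auto simp: prefix_snoc intro: prefix_order.antisym)
            then have "\<bar>G (tree_cut N t) - G s\<bar> \<le> \<epsilon> / 2"
              using n0[of n "tree_cut N t"] False mem[OF t(1)] \<open>\<epsilon> > 0\<close> by auto
            then show ?thesis
              using 1 by linarith
          qed
        qed
      qed
      then show ?thesis
        unfolding good_def by blast
    qed
  qed
  then have "good []"
    using Nil by simp
  then show ?thesis
    by (simp add: good_def)
qed

section \<open>Sums over partitions indexed by a tree\<close>

text \<open>The terms with \<open>G (butlast s)\<close> are indexed by edges; regrouping the edges
  by their lower node turns them into sums over children.\<close>

lemma sum_by_parts_tree:
  fixes h :: "'a list \<Rightarrow> real"
  assumes "finite F" "\<And>s n. s @ [n] \<in> F \<Longrightarrow> s \<in> F"
  shows "(\<Sum>s\<in>F. (if s = [] then G [] else G s - G (butlast s)) * h s) =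
    (\<Sum>s\<in>F. G s * (h s - (\<Sum>n | s @ [n] \<in> F. h (s @ [n]))))"
proof -
  have fin: "finite {n. s @ [n] \<in> F}" for s
    using finite_vimageI[OF assms(1), of "\<lambda>n. s @ [n]"] by (simp add: inj_def vimage_def)
  have "(\<Sum>s\<in>F. G s * (\<Sum>n | s @ [n] \<in> F. h (s @ [n]))) =
      (\<Sum>s\<in>F. \<Sum>n | s @ [n] \<in> F. G s * h (s @ [n]))"
    by (simp add: sum_distrib_left)
  also have "\<dots> = (\<Sum>(s, n)\<in>(SIGMA s:F. {n. s @ [n] \<in> F}). G s * h (s @ [n]))"
    by (rule sum.Sigma) (use assms(1) fin in auto)
  also have "\<dots> = (\<Sum>t\<in>F - {[]}. G (butlast t) * h t)"
  proof (rule sum.reindex_bij_witness[where i = "\<lambda>t. (butlast t, last t)" and j = "\<lambda>(s, n). s @ [n]"])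
    fix t
    assume t: "t \<in> F - {[]}"
    then have "butlast t @ [last t] = t"
      by simp
    then show "(butlast t, last t) \<in> (SIGMA s:F. {n. s @ [n] \<in> F})"
      using t assms(2)[of "butlast t" "last t"] by simp
  qed auto
  also have "\<dots> = (\<Sum>t\<in>F. (if t = [] then 0 else G (butlast t) * h t))"
    by (rule sum.mono_neutral_cong_left) (use assms(1) in auto)
  finally have "(\<Sum>s\<in>F. G s * (\<Sum>n | s @ [n] \<in> F. h (s @ [n]))) =
      (\<Sum>t\<in>F. (if t = [] then 0 else G (butlast t) * h t))" .
  moreover have "(\<Sum>s\<in>F. (if s = [] then G [] else G s - G (butlast s)) * h s) =
      (\<Sum>s\<in>F. G s * h s - (if s = [] then 0 else G (butlast s) * h s))"
    by (rule sum.cong) (auto simp: algebra_simps)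
  ultimately show ?thesis
    by (simp add: sum_subtractf right_diff_distrib)
qed

definition tree_psum ::
  "nat list set \<Rightarrow> (nat list \<Rightarrow> 'x \<Rightarrow> real) \<Rightarrow> nat \<Rightarrow> (nat list \<Rightarrow> real) \<Rightarrow> 'x \<Rightarrow> real" where
  "tree_psum \<Lambda> h N G x = (\<Sum>s\<in>tree_trunc \<Lambda> N. tree_diff \<Lambda> G s * h s x)"

text \<open>With \<open>h s x\<close> read as the mass that reaches the node \<open>s\<close>, this
  is the part that is not passed on to children within the truncation.\<close>

definition tree_weight ::
  "nat list set \<Rightarrow> (nat list \<Rightarrow> 'x \<Rightarrow> real) \<Rightarrow> nat \<Rightarrow> nat list \<Rightarrow> 'x \<Rightarrow> real" where
  "tree_weight \<Lambda> h N s x = h s x - (\<Sum>n | s @ [n] \<in> tree_trunc \<Lambda> N. h (s @ [n]) x)"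

definition tree_sum ::
  "nat list set \<Rightarrow> (nat list \<Rightarrow> 'x \<Rightarrow> real) \<Rightarrow> (nat list \<Rightarrow> real) \<Rightarrow> 'x \<Rightarrow> real" where
  "tree_sum \<Lambda> h G x = lim (\<lambda>N. tree_psum \<Lambda> h N G x)"

text \<open>The weights of the truncations of such a family are nonnegative and add up to 1, so that
  all partial sums are convex combinations of values of the tree function.\<close>

locale tree_partition =
  fixes \<Lambda> :: "nat list set" and h :: "nat list \<Rightarrow> 'l::metric_space \<Rightarrow> real"
  assumes her: "hereditary \<Lambda>" and Nil: "[] \<in> \<Lambda>"
    and compact: "compact (UNIV :: 'l set)"
    and cont: "continuous_on UNIV (h s)"
    and nonneg: "0 \<le> h s x"
    and root: "h [] x = 1"
    and children: "finite I \<Longrightarrow> (\<Sum>n\<in>I. h (s @ [n]) x) \<le> h s x"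
begin

lemma finite_children: "finite {n. s @ [n] \<in> tree_trunc \<Lambda> N}"
  using finite_vimageI[OF finite_tree_trunc, of "\<lambda>n. s @ [n]" \<Lambda> N] by (simp add: inj_def vimage_def)

lemma psum_weights: "tree_psum \<Lambda> h N G x = (\<Sum>s\<in>tree_trunc \<Lambda> N. G s * tree_weight \<Lambda> h N s x)"
proof -
  have "tree_psum \<Lambda> h N G x =
      (\<Sum>s\<in>tree_trunc \<Lambda> N. (if s = [] then G [] else G s - G (butlast s)) * h s x)"
    unfolding tree_psum_def by (rule sum.cong) (auto simp: tree_diff_def tree_trunc_def)
  also have "\<dots> = (\<Sum>s\<in>tree_trunc \<Lambda> N. G s * tree_weight \<Lambda> h N s x)"
    unfolding tree_weight_def
    by (rule sum_by_parts_tree) (use finite_tree_trunc tree_trunc_snoc[OF her] in auto)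
  finally show ?thesis .
qed

lemma weight_nonneg: "0 \<le> tree_weight \<Lambda> h N s x"
  using children[OF finite_children[of s N], of s x] by (simp add: tree_weight_def)

text \<open>The constant function 1 has a nonzero difference only at the root, where
  \<open>h\<close> is 1.\<close>

lemma sum_weights: "(\<Sum>s\<in>tree_trunc \<Lambda> N. tree_weight \<Lambda> h N s x) = 1"
proof -
  have "tree_psum \<Lambda> h N (\<lambda>_. 1) x = (\<Sum>s\<in>tree_trunc \<Lambda> N. if s = [] then h s x else 0)"
    unfolding tree_psum_def by (rule sum.cong) (auto simp: tree_diff_def tree_trunc_def)
  also have "\<dots> = 1"
    using tree_trunc_Nil[OF Nil] root by (simp add: finite_tree_trunc)
  finally show ?thesis
    using psum_weights[of N "\<lambda>_. 1" x] by simp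
qed

text \<open>A convex combination is as close to \<open>c\<close> as the values that really enter it.
  The restriction to nonzero weights is what later localizes the sum at a point.\<close>

lemma psum_bound:
  assumes "\<And>s. s \<in> tree_trunc \<Lambda> N \<Longrightarrow> tree_weight \<Lambda> h N s x \<noteq> 0 \<Longrightarrow> \<bar>G s - c\<bar> \<le> \<epsilon>"
  shows "\<bar>tree_psum \<Lambda> h N G x - c\<bar> \<le> \<epsilon>"
proof -
  have "tree_psum \<Lambda> h N G x - c = (\<Sum>s\<in>tree_trunc \<Lambda> N. (G s - c) * tree_weight \<Lambda> h N s x)"
    unfolding psum_weights left_diff_distrib sum_subtractf
    by (simp add: sum_weights flip: sum_distrib_left)
  also have "\<bar>\<dots>\<bar> \<le> (\<Sum>s\<in>tree_trunc \<Lambda> N. \<bar>(G s - c) * tree_weight \<Lambda> h N s x\<bar>)"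
    by (rule sum_abs)
  also have "\<dots> \<le> (\<Sum>s\<in>tree_trunc \<Lambda> N. \<epsilon> * tree_weight \<Lambda> h N s x)"
  proof (rule sum_mono)
    fix s
    assume "s \<in> tree_trunc \<Lambda> N"
    then show "\<bar>(G s - c) * tree_weight \<Lambda> h N s x\<bar> \<le> \<epsilon> * tree_weight \<Lambda> h N s x"
      using assms[of s] weight_nonneg[of N s x]
      by (cases "tree_weight \<Lambda> h N s x = 0") (auto simp: abs_mult intro: mult_right_mono)
  qed
  also have "\<dots> = \<epsilon>"
    by (simp add: sum_weights flip: sum_distrib_left)
  finally show ?thesis .
qed

lemma psum_combine:
  "tree_psum \<Lambda> h N (\<lambda>s. c * G s + H s) x = c * tree_psum \<Lambda> h N G x + tree_psum \<Lambda> h N H x"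
  by (simp add: psum_weights sum_distrib_left sum.distrib algebra_simps)

text \<open>The nodes between the two truncations contribute nothing, because the cut does not
  distinguish them from their parents. Two partial sums thus become one partial sum for two
  functions, to which \<open>psum_bound\<close> applies.\<close>

lemma psum_cut:
  assumes "N \<le> M"
  shows "tree_psum \<Lambda> h M (\<lambda>s. G (tree_cut N s)) x = tree_psum \<Lambda> h N G x"
  unfolding tree_psum_def
proof (rule sum.mono_neutral_cong_right)
  show "finite (tree_trunc \<Lambda> M)"
    by (rule finite_tree_trunc)
  show "tree_trunc \<Lambda> N \<subseteq> tree_trunc \<Lambda> M"
    using assms by (auto simp: tree_trunc_def)
  show "\<forall>s\<in>tree_trunc \<Lambda> M - tree_trunc \<Lambda> N. tree_diff \<Lambda> (\<lambda>s. G (tree_cut N s)) s * h s x = 0"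
  proof
    fix s
    assume s: "s \<in> tree_trunc \<Lambda> M - tree_trunc \<Lambda> N"
    then have "s \<noteq> []"
      using tree_trunc_Nil[OF Nil] by blast
    then obtain u n where u: "s = u @ [n]"
      by (metis append_butlast_last_id)
    have "tree_cut N s = tree_cut N u"
      unfolding u by (rule tree_cut_snoc) (use s u in \<open>auto simp: tree_trunc_def\<close>)
    then show "tree_diff \<Lambda> (\<lambda>s. G (tree_cut N s)) s * h s x = 0"
      by (simp add: tree_diff_def u)
  qed
  show "tree_diff \<Lambda> (\<lambda>s. G (tree_cut N s)) s * h s x = tree_diff \<Lambda> G s * h s x"
    if "s \<in> tree_trunc \<Lambda> N" for s
  proof -
    have "tree_cut N u = u" if "u \<in> tree_trunc \<Lambda> N" for u
      using that tree_cut_eq by (auto simp: tree_trunc_def)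
    moreover have "butlast s \<in> tree_trunc \<Lambda> N"
      using that tree_trunc_snoc[OF her, of "butlast s" "last s" N] by (cases "s = []") auto
    ultimately show ?thesis
      using that tree_trunc_Nil[OF Nil, of N] by (simp add: tree_diff_def)
  qed
qed

lemma psum_Cauchy:
  assumes "tree_cont \<Lambda> G" "\<epsilon> > 0"
  obtains N0 where "\<And>N M x. N0 \<le> N \<Longrightarrow> N \<le> M \<Longrightarrow> \<bar>tree_psum \<Lambda> h M G x - tree_psum \<Lambda> h N G x\<bar> \<le> \<epsilon>"
proof -
  obtain N0 where N0: "\<And>N t. N \<ge> N0 \<Longrightarrow> t \<in> \<Lambda> \<Longrightarrow> \<bar>G t - G (tree_cut N t)\<bar> \<le> \<epsilon>"
    using tree_cut_uniform[OF her Nil assms] by blast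
  have "\<bar>tree_psum \<Lambda> h M G x - tree_psum \<Lambda> h N G x\<bar> \<le> \<epsilon>" if NM: "N0 \<le> N" "N \<le> M" for N M x
  proof -
    \<comment> \<open>The difference of the partial sums is the partial sum of \<open>G\<close>
      minus its composition with the cut.\<close>
    have "\<bar>tree_psum \<Lambda> h M (\<lambda>s. (- 1) * G (tree_cut N s) + G s) x - 0\<bar> \<le> \<epsilon>"
      by (rule psum_bound) (use N0[OF NM(1)] in \<open>auto simp: tree_trunc_def\<close>)
    then show ?thesis
      unfolding psum_combine psum_cut[OF NM(2)] by simp
  qed
  then show ?thesis
    by (rule that)
qed

lemma uniform_limit_tree_sum:
  assumes "tree_cont \<Lambda> G"
  shows "uniform_limit UNIV (\<lambda>N. tree_psum \<Lambda> h N G) (tree_sum \<Lambda> h G) sequentially"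
proof -
  have "uniformly_Cauchy_on UNIV (\<lambda>N. tree_psum \<Lambda> h N G)"
    unfolding uniformly_Cauchy_on_def
  proof (intro allI impI)
    fix e :: real
    assume "e > 0"
    then obtain N0 where N0: "\<And>N M x. N0 \<le> N \<Longrightarrow> N \<le> M \<Longrightarrow> \<bar>tree_psum \<Lambda> h M G x - tree_psum \<Lambda> h N G x\<bar> \<le> e / 2"
      using psum_Cauchy[OF assms, of "e / 2"] by auto
    have "dist (tree_psum \<Lambda> h m G x) (tree_psum \<Lambda> h n G x) < e" if "m \<ge> N0" "n \<ge> N0" for m n x
      using N0[of m n x] N0[of n m x] that \<open>e > 0\<close> unfolding dist_real_def by (cases "m \<le> n") linarith+
    then show "\<exists>M. \<forall>x\<in>UNIV. \<forall>m\<ge>M. \<forall>n\<ge>M. dist (tree_psum \<Lambda> h m G x) (tree_psum \<Lambda> h n G x) < e"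
      by blast
  qed
  then show ?thesis
    using Cauchy_uniformly_convergent uniformly_convergent_uniform_limit_iff
    unfolding tree_sum_def by blast
qed

lemma tree_sum_LIMSEQ:
  "tree_cont \<Lambda> G \<Longrightarrow> (\<lambda>N. tree_psum \<Lambda> h N G x) \<longlonglongrightarrow> tree_sum \<Lambda> h G x"
  using tendsto_uniform_limitI[OF uniform_limit_tree_sum] by simp

lemma continuous_tree_sum:
  assumes "tree_cont \<Lambda> G"
  shows "continuous_on UNIV (tree_sum \<Lambda> h G)"
proof (rule uniform_limit_theorem[OF _ uniform_limit_tree_sum[OF assms]])
  show "\<forall>\<^sub>F N in sequentially. continuous_on UNIV (tree_psum \<Lambda> h N G)"
    unfolding tree_psum_def by (intro always_eventually allI continuous_intros cont)
qed simp

text \<open>All mass over \<open>x\<close> eventually sits at nodes where \<open>G\<close> is close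
  to \<open>c\<close>, so the averages converge to \<open>c\<close>.\<close>

lemma tree_sum_eqI:
  assumes "tree_cont \<Lambda> G"
    and "\<And>\<epsilon>. \<epsilon> > 0 \<Longrightarrow> \<exists>N0. \<forall>N\<ge>N0. \<forall>s\<in>tree_trunc \<Lambda> N. tree_weight \<Lambda> h N s x \<noteq> 0 \<longrightarrow> \<bar>G s - c\<bar> \<le> \<epsilon>"
  shows "tree_sum \<Lambda> h G x = c"
proof (rule LIMSEQ_unique[OF tree_sum_LIMSEQ[OF assms(1)]])
  show "(\<lambda>N. tree_psum \<Lambda> h N G x) \<longlonglongrightarrow> c"
  proof (rule LIMSEQ_I)
    fix r :: real
    assume "0 < r"
    then obtain N0 where "\<And>N s. N \<ge> N0 \<Longrightarrow> s \<in> tree_trunc \<Lambda> N \<Longrightarrow> tree_weight \<Lambda> h N s x \<noteq> 0 \<Longrightarrow> \<bar>G s - c\<bar> \<le> r / 2"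
      using assms(2)[of "r / 2"] by (auto simp del: le_divide_eq_numeral1)
    then have "\<bar>tree_psum \<Lambda> h N G x - c\<bar> \<le> r / 2" if "N \<ge> N0" for N
      using that by (intro psum_bound) auto
    then show "\<exists>no. \<forall>n\<ge>no. norm (tree_psum \<Lambda> h n G x - c) < r"
      using \<open>0 < r\<close> by (intro exI[of _ N0]) (fastforce simp: real_norm_def)
  qed
qed

lemma tree_sum_bound:
  assumes "tree_cont \<Lambda> G" "\<And>s. s \<in> \<Lambda> \<Longrightarrow> \<bar>G s\<bar> \<le> B"
  shows "\<bar>tree_sum \<Lambda> h G x\<bar> \<le> B"
proof (rule LIMSEQ_le_const2[OF tendsto_rabs[OF tree_sum_LIMSEQ[OF assms(1)]]])
  have "\<bar>tree_psum \<Lambda> h N G x - 0\<bar> \<le> B" for N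
    by (rule psum_bound) (use assms(2) in \<open>auto simp: tree_trunc_def\<close>)
  then show "\<exists>N. \<forall>n\<ge>N. \<bar>tree_psum \<Lambda> h n G x\<bar> \<le> B"
    by simp
qed

lemma tree_sum_combine:
  assumes "tree_cont \<Lambda> G" "tree_cont \<Lambda> H"
  shows "tree_sum \<Lambda> h (\<lambda>s. c * G s + H s) x = c * tree_sum \<Lambda> h G x + tree_sum \<Lambda> h H x"
proof (rule LIMSEQ_unique)
  show "(\<lambda>N. tree_psum \<Lambda> h N (\<lambda>s. c * G s + H s) x) \<longlonglongrightarrow> tree_sum \<Lambda> h (\<lambda>s. c * G s + H s) x"
    by (rule tree_sum_LIMSEQ[OF tree_cont_combine[OF assms]])
  show "(\<lambda>N. tree_psum \<Lambda> h N (\<lambda>s. c * G s + H s) x) \<longlonglongrightarrow> c * tree_sum \<Lambda> h G x + tree_sum \<Lambda> h H x"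
    unfolding psum_combine by (intro tendsto_intros tree_sum_LIMSEQ assms)
qed

definition tree_fun :: "(nat list \<Rightarrow> real) \<Rightarrow> 'l \<Rightarrow>\<^sub>C real" where
  "tree_fun G = Bcontfun (tree_sum \<Lambda> h G)"

lemma apply_tree_fun:
  assumes "tree_cont \<Lambda> G"
  shows "apply_bcontfun (tree_fun G) = tree_sum \<Lambda> h G"
proof -
  obtain B where "\<And>s. s \<in> \<Lambda> \<Longrightarrow> \<bar>G s\<bar> \<le> B"
    using tree_cont_bounded[OF assms] by blast
  then have "tree_sum \<Lambda> h G \<in> bcontfun"
    using tree_sum_bound[OF assms, of B] by (intro bcontfun_normI[OF continuous_tree_sum[OF assms]]) auto
  then show ?thesis
    unfolding tree_fun_def by (rule Bcontfun_inverse)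
qed

lemma tree_fun_combine:
  assumes "tree_cont \<Lambda> G" "tree_cont \<Lambda> H"
  shows "tree_fun (\<lambda>s. c * G s + H s) = c *\<^sub>R tree_fun G + tree_fun H"
  by (rule bcontfun_eqI)
    (simp add: apply_tree_fun assms tree_cont_combine tree_sum_combine plus_bcontfun.rep_eq scaleR_bcontfun.rep_eq)

lemma norm_tree_fun:
  assumes "tree_cont \<Lambda> G" "\<And>s. s \<in> \<Lambda> \<Longrightarrow> \<bar>G s\<bar> \<le> B"
  shows "norm (tree_fun G) \<le> B"
  using assms by (intro norm_bound) (simp add: apply_tree_fun tree_sum_bound)

end

section \<open>Complemented subspaces and projectional trees\<close>

definition code_word :: "nat list \<Rightarrow> bool list" where
  "code_word s = concat (map (\<lambda>m. replicate m True @ [False]) s)"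

lemma code_word_simps [simp]:
  "code_word [] = []" "code_word (m # s) = replicate m True @ False # code_word s"
  "code_word (s @ t) = code_word s @ code_word t"
  by (auto simp: code_word_def)

lemma cantor_code_eq: "cantor_code s k = (if k < length (code_word s) then code_word s ! k else True)"
  by (simp add: cantor_code_def code_word_def Let_def)

text \<open>After the word of \<open>s\<close>, the code of \<open>s\<close> has only ones, while
  that of an extension by \<open>n\<close> has \<open>n\<close> ones and then a zero. The first
  difference is therefore at the index \<open>length (code_word s) + n\<close>.\<close>

lemma cantor_code_append_eq:
  "k < length (code_word s) + n \<Longrightarrow> cantor_code (s @ n # u) k = cantor_code s k"
  by (auto simp: cantor_code_eq nth_append)

lemma cantor_code_append_False: "\<not> cantor_code (s @ n # u) (length (code_word s) + n)"
  by (auto simp: cantor_code_eq nth_append)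

lemma length_le_code_word: "length s \<le> length (code_word s)"
  by (induction s) auto

lemma cantor_dist_le:
  assumes "\<And>k. k < m \<Longrightarrow> x k = y k"
  shows "cantor_dist x y \<le> (1 / 2) ^ m"
proof (cases "x = y")
  case False
  then have "\<exists>k. x k \<noteq> y k"
    by auto
  then have "x (LEAST k. x k \<noteq> y k) \<noteq> y (LEAST k. x k \<noteq> y k)"
    by (rule LeastI_ex)
  then have "m \<le> (LEAST k. x k \<noteq> y k)"
    using assms not_le by blast
  then show ?thesis
    using False by (auto simp: cantor_dist_def intro: power_decreasing)
qed (simp add: cantor_dist_def)

text \<open>The strict inequality gives agreement at the index \<open>m\<close> itself, too.\<close>

lemma cantor_dist_less:
  assumes "cantor_dist x y < (1 / 2) ^ m" "k \<le> m"
  shows "x k = y k"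
proof (rule ccontr)
  assume *: "x k \<noteq> y k"
  then have "(LEAST k. x k \<noteq> y k) \<le> k"
    by (rule Least_le)
  then have "(1 / 2 :: real) ^ m \<le> (1 / 2) ^ (LEAST k. x k \<noteq> y k)"
    using assms(2) by (intro power_decreasing) auto
  then show False
    using * assms(1) by (auto simp: cantor_dist_def split: if_splits)
qed

lemma tree_dist_nonneg: "0 \<le> tree_dist s t"
  by (simp add: tree_dist_def cantor_dist_def)

lemma tree_dist_append: "tree_dist (s @ n # u) s \<le> (1 / 2) ^ (length (code_word s) + n)"
  unfolding tree_dist_def by (rule cantor_dist_le) (rule cantor_code_append_eq)

lemma tree_dist_above:
  assumes "prefix (s @ [n]) t"
  shows "tree_dist t s \<le> (1 / 2) ^ n"
proof -
  obtain u where u: "t = s @ n # u"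
    using assms by (auto simp: prefix_def)
  have "(1 / 2 :: real) ^ (length (code_word s) + n) \<le> (1 / 2) ^ n"
    by (rule power_decreasing) auto
  then show ?thesis
    using order_trans[OF tree_dist_append[of s n u]] unfolding u by blast
qed

lemma tree_dist_take: "tree_dist t (take n t) \<le> (1 / 2) ^ n"
proof (cases "n < length t")
  case True
  have t: "t = take n t @ t ! n # drop (Suc n) t"
    using True by (rule id_take_nth_drop)
  have "(1 / 2 :: real) ^ (length (code_word (take n t)) + t ! n) \<le> (1 / 2) ^ n"
    using length_le_code_word[of "take n t"] True by (intro power_decreasing) auto
  then show ?thesis
    using order_trans[OF tree_dist_append[of "take n t" "t ! n" "drop (Suc n) t"]] unfolding t[symmetric] by blast
qed (simp add: tree_dist_def cantor_dist_def)

text \<open>Sequential uniform continuity yields a modulus in powers of 1/2, by contradiction. In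
  the tree metric, a node above \<open>s @ [n]\<close> is within (1/2)^n of \<open>s\<close>, and
  any node is within (1/2)^n of its truncation to length \<open>n\<close>.\<close>

lemma tree_cont_if_uniform:
  assumes her: "hereditary \<Lambda>" and bdd: "\<And>s. s \<in> \<Lambda> \<Longrightarrow> \<bar>G s\<bar> \<le> B"
    and unif: "\<And>x y. (\<And>n :: nat. x n \<in> \<Lambda> \<and> y n \<in> \<Lambda>) \<Longrightarrow> (\<lambda>n. tree_dist (x n) (y n)) \<longlonglongrightarrow> 0 \<Longrightarrow>
      (\<lambda>n. G (x n) - G (y n)) \<longlonglongrightarrow> 0"
  shows "tree_cont \<Lambda> G"
proof -
  have *: "\<exists>n. \<forall>s\<in>\<Lambda>. \<forall>t\<in>\<Lambda>. tree_dist s t \<le> (1 / 2) ^ n \<longrightarrow> \<bar>G s - G t\<bar> \<le> \<epsilon>" if "\<epsilon> > 0" for \<epsilon>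
  proof (rule ccontr)
    assume "\<not> ?thesis"
    then have "\<forall>n. \<exists>s t. s \<in> \<Lambda> \<and> t \<in> \<Lambda> \<and> tree_dist s t \<le> (1 / 2) ^ n \<and> \<bar>G s - G t\<bar> > \<epsilon>"
      by (meson not_le)
    then obtain x y where xy: "\<And>n. x n \<in> \<Lambda> \<and> y n \<in> \<Lambda>" "\<And>n. tree_dist (x n) (y n) \<le> (1 / 2) ^ n"
      "\<And>n. \<bar>G (x n) - G (y n)\<bar> > \<epsilon>"
      by metis
    have "(\<lambda>n. tree_dist (x n) (y n)) \<longlonglongrightarrow> 0"
    proof (rule tendsto_sandwich[of "\<lambda>_. 0" _ _ "\<lambda>n. (1 / 2) ^ n"])
      show "(\<lambda>n. (1 / 2 :: real) ^ n) \<longlonglongrightarrow> 0"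
        by (rule LIMSEQ_power_zero) simp
    qed (use xy(2) tree_dist_nonneg in auto)
    then have "(\<lambda>n. G (x n) - G (y n)) \<longlonglongrightarrow> 0"
      by (rule unif[OF xy(1)])
    then have "\<exists>n. \<bar>G (x n) - G (y n)\<bar> < \<epsilon>"
      using LIMSEQ_D[of _ 0 \<epsilon>] that by fastforce
    then show False
      using xy(3) by (auto dest: less_asym)
  qed
  have mem: "take n t \<in> \<Lambda>" if "t \<in> \<Lambda>" for n t
    using her that by (rule hereditary_prefix) (rule take_is_prefix)
  have mono: "(1 / 2 :: real) ^ n \<le> (1 / 2) ^ m" if "m \<le> n" for m n
    using that by (intro power_decreasing) auto
  have "bdd_above ((\<lambda>t. \<bar>G t\<bar>) ` \<Lambda>)"
    using bdd by (auto simp: bdd_above_def)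
  moreover have "\<exists>N. \<forall>n\<ge>N. \<forall>t\<in>\<Lambda>. prefix (s @ [n]) t \<longrightarrow> \<bar>G t - G s\<bar> \<le> \<epsilon>"
    if "s \<in> nonleaves \<Lambda>" and e: "\<epsilon> > 0" for s \<epsilon>
  proof -
    have s: "s \<in> \<Lambda>"
      using that(1) by (simp add: nonleaves_def)
    obtain N where N: "\<And>s t. s \<in> \<Lambda> \<Longrightarrow> t \<in> \<Lambda> \<Longrightarrow> tree_dist s t \<le> (1 / 2) ^ N \<Longrightarrow> \<bar>G s - G t\<bar> \<le> \<epsilon>"
      using *[OF e] by blast
    have "\<bar>G t - G s\<bar> \<le> \<epsilon>" if "N \<le> n" "t \<in> \<Lambda>" "prefix (s @ [n]) t" for n t
      using N[OF that(2) s] tree_dist_above[OF that(3)] mono[OF that(1)] by simp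
    then show ?thesis
      by blast
  qed
  moreover have "\<exists>N. \<forall>n\<ge>N. \<forall>t\<in>\<Lambda>. \<bar>G t - G (take n t)\<bar> \<le> \<epsilon>" if e: "\<epsilon> > 0" for \<epsilon>
  proof -
    obtain N where N: "\<And>s t. s \<in> \<Lambda> \<Longrightarrow> t \<in> \<Lambda> \<Longrightarrow> tree_dist s t \<le> (1 / 2) ^ N \<Longrightarrow> \<bar>G s - G t\<bar> \<le> \<epsilon>"
      using *[OF e] by blast
    have "\<bar>G t - G (take n t)\<bar> \<le> \<epsilon>" if "N \<le> n" "t \<in> \<Lambda>" for n t
      by (rule N[OF that(2) mem[OF that(2)] order_trans[OF tree_dist_take mono[OF that(1)]]])
    then show ?thesis
      by blast
  qed
  ultimately show ?thesis
    by (auto simp: tree_cont_def)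
qed

lemma tree_cont_weak_star:
  fixes \<rho> :: "nat list \<Rightarrow> 'e::real_normed_vector \<Rightarrow>\<^sub>L real"
  assumes "hereditary \<Lambda>" "uniformly_weak_star_continuous \<Lambda> tree_dist \<rho>" "bounded (\<rho> ` \<Lambda>)"
  shows "tree_cont \<Lambda> (\<lambda>s. blinfun_apply (\<rho> s) e)"
proof -
  obtain C where C: "\<And>s. s \<in> \<Lambda> \<Longrightarrow> norm (\<rho> s) \<le> C"
    using assms(3) by (auto simp: bounded_iff)
  have "\<bar>blinfun_apply (\<rho> s) e\<bar> \<le> C * norm e" if "s \<in> \<Lambda>" for s
    using norm_blinfun[of "\<rho> s" e] mult_right_mono[OF C[OF that], of "norm e"] by simp
  then show ?thesis
    using assms(2) unfolding uniformly_weak_star_continuous_def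
    by (intro tree_cont_if_uniform[OF assms(1)]) (auto simp: blinfun.diff_left)
qed

text \<open>The composition of \<open>Q\<close> followed by \<open>J\<close> is the projection, and
  the range of \<open>J\<close> is its set of fixed points, hence closed.\<close>

lemma complemented_range:
  fixes J :: "'v::real_normed_vector \<Rightarrow> 'e::real_normed_vector"
  assumes J: "bounded_linear J" and Q: "bounded_linear Q" and QJ: "\<And>v. Q (J v) = v"
  shows "complemented (range J) \<and> isomorphism_onto J (range J)"
proof
  have lin: "linear J"
    by (rule bounded_linear.linear[OF J])
  have P: "bounded_linear (\<lambda>e. J (Q e))"
    by (rule bounded_linear_compose[OF J Q])
  have "range J = {e. J (Q e) = e}"
    using QJ by (auto simp: image_iff) metis
  then have "closed (range J)"
    using P by (auto intro!: closed_Collect_eq linear_continuous_on continuous_intros)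
  moreover have "subspace (range J)"
    using lin by (simp add: linear_subspace_image)
  moreover have "range (\<lambda>e. J (Q e)) = range J"
    using QJ by (auto simp: image_iff) metis
  ultimately show "complemented (range J)"
    unfolding complemented_def using P QJ by (auto intro!: exI[of _ "\<lambda>e. J (Q e)"] simp: fun_eq_iff)
  obtain K where K: "K > 0" "\<And>e. norm (Q e) \<le> norm e * K"
    using bounded_linear.pos_bounded[OF Q] by blast
  have "1 / K * norm v \<le> norm (J v)" for v
    using K(1) K(2)[of "J v"] QJ[of v] by (simp add: field_simps)
  then show "isomorphism_onto J (range J)"
    unfolding isomorphism_onto_def using J K(1) by (intro conjI exI[of _ "1 / K"]) auto
qed

text \<open>\<open>K\<close> applies the projection and then inverts \<open>J\<close>, which is
  injective because it is bounded below.\<close>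

lemma complemented_left_inverse:
  fixes J :: "'v::real_normed_vector \<Rightarrow> 'e::real_normed_vector"
  assumes "complemented F" "isomorphism_onto J F"
  obtains K where "bounded_linear K" "\<And>v. K (J v) = v"
proof -
  obtain P where P: "bounded_linear P" "P \<circ> P = P" "range P = F"
    using assms(1) by (auto simp: complemented_def)
  obtain c where J: "bounded_linear J" "range J = F" and c: "c > 0" "\<And>v. c * norm v \<le> norm (J v)"
    using assms(2) by (auto simp: isomorphism_onto_def)
  interpret J: bounded_linear J
    by (rule J(1))
  interpret P: bounded_linear P
    by (rule P(1))
  have inj: "v = w" if "J v = J w" for v w
    using c(2)[of "v - w"] c(1) that by (simp add: J.diff mult_le_0_iff)
  have "\<forall>e. \<exists>v. J v = P e"
    using J(2) P(3) by (metis rangeE rangeI)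
  then obtain K where K: "\<And>e. J (K e) = P e"
    by metis
  obtain B where B: "B > 0" "\<And>e. norm (P e) \<le> norm e * B"
    using P.pos_bounded by blast
  have "bounded_linear K"
  proof (rule bounded_linear_intro)
    show "K (x + y) = K x + K y" for x y
      by (rule inj) (simp add: K J.add P.add)
    show "K (r *\<^sub>R x) = r *\<^sub>R K x" for r x
      by (rule inj) (simp add: K J.scaleR P.scaleR)
    show "norm (K x) \<le> norm x * (B / c)" for x
      using c(2)[of "K x"] B(2)[of x] c(1) unfolding K by (simp add: field_simps)
  qed
  moreover have "K (J v) = v" for v
  proof (rule inj)
    obtain e where "J v = P e"
      using J(2) P(3) by (metis rangeE rangeI)
    then show "J (K (J v)) = J v"
      using P(2) by (simp add: K fun_eq_iff)
  qed
  ultimately show ?thesis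
    by (rule that)
qed

lemma tree_norm_tree_diff_le:
  assumes "hereditary \<Lambda>" "[] \<in> \<Lambda>" "tree_cont \<Lambda> G" "\<And>s. s \<in> \<Lambda> \<Longrightarrow> \<bar>G s\<bar> \<le> B"
  shows "tree_norm \<Lambda> (tree_diff \<Lambda> G) \<le> B"
  unfolding tree_norm_def using assms by (intro cSUP_least) (auto simp: tree_delta_tree_diff)

lemma tree_diff_combine:
  "tree_diff \<Lambda> (\<lambda>s. c * G s + H s) = (\<lambda>s. c * tree_diff \<Lambda> G s + tree_diff \<Lambda> H s)"
  by (auto simp: tree_diff_def fun_eq_iff algebra_simps)

lemma tree_diff_scale: "tree_diff \<Lambda> (\<lambda>s. c * G s) = (\<lambda>s. c * tree_diff \<Lambda> G s)"
  by (auto simp: tree_diff_def fun_eq_iff algebra_simps)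

lemma tree_cont_zero: "tree_cont \<Lambda> (\<lambda>_. 0)"
  by (auto simp: tree_cont_def)

lemma tree_cont_scale: "tree_cont \<Lambda> G \<Longrightarrow> tree_cont \<Lambda> (\<lambda>s. c * G s)"
  using tree_cont_combine[OF _ tree_cont_zero] by simp

text \<open>\<open>U\<close> followed by \<open>V\<close> factors the identity through tree
  functions. Embedding \<open>U f\<close> by \<open>T\<close>, and reading an element
  \<open>e\<close> back through the tree function \<open>\<lambda>s. \<rho> s e\<close>, transfers
  this to the Banach space: on the range of \<open>T\<close> the functionals return exactly the
  branch sums. They do so on \<Lambda> only, so \<open>V\<close> must ignore values off the
  tree.\<close>

lemma complemented_if_projectional_tree:
  fixes U :: "'v::real_normed_vector \<Rightarrow> nat list \<Rightarrow> real" and T :: "(nat list \<Rightarrow> real) \<Rightarrow> 'e::banach"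
  assumes tree: "projectional_tree \<beta> \<Lambda> T \<rho>" and her: "hereditary \<Lambda>" and Nil: "[] \<in> \<Lambda>"
    and U: "\<And>f. tree_cont \<Lambda> (U f)" "\<And>c f g s. U (c *\<^sub>R f + g) s = c * U f s + U g s"
      "\<And>f s. s \<in> \<Lambda> \<Longrightarrow> \<bar>U f s\<bar> \<le> C * norm f"
    and V: "\<And>c G H. tree_cont \<Lambda> G \<Longrightarrow> tree_cont \<Lambda> H \<Longrightarrow> V (\<lambda>s. c * G s + H s) = c *\<^sub>R V G + V H"
      "\<And>G B. tree_cont \<Lambda> G \<Longrightarrow> (\<And>s. s \<in> \<Lambda> \<Longrightarrow> \<bar>G s\<bar> \<le> B) \<Longrightarrow> norm (V G) \<le> D * B"
      "\<And>G H. (\<And>s. s \<in> \<Lambda> \<Longrightarrow> G s = H s) \<Longrightarrow> V G = V H"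
    and VU: "\<And>f. V (U f) = f"
  shows "\<exists>F (J :: 'v \<Rightarrow> 'e). complemented F \<and> isomorphism_onto J F"
proof -
  have T: "\<And>a b. a \<in> tree_space \<Lambda> \<Longrightarrow> b \<in> tree_space \<Lambda> \<Longrightarrow> T (\<lambda>s. a s + b s) = T a + T b"
    "\<And>c a. a \<in> tree_space \<Lambda> \<Longrightarrow> T (\<lambda>s. c * a s) = c *\<^sub>R T a"
    and "\<exists>K. \<forall>a\<in>tree_space \<Lambda>. norm (T a) \<le> K * tree_norm \<Lambda> a"
    and \<rho>: "uniformly_weak_star_continuous \<Lambda> tree_dist \<rho>" "bounded (\<rho> ` \<Lambda>)"
      "\<And>s a. s \<in> \<Lambda> \<Longrightarrow> a \<in> tree_space \<Lambda> \<Longrightarrow> blinfun_apply (\<rho> s) (T a) = tree_delta s a"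
    using tree by (auto simp: projectional_tree_def tree_embedding_def)
  then obtain K where K: "\<And>a. a \<in> tree_space \<Lambda> \<Longrightarrow> norm (T a) \<le> K * tree_norm \<Lambda> a"
    by blast
  define J where "J f = T (tree_diff \<Lambda> (U f))" for f
  define Q where "Q e = V (\<lambda>s. blinfun_apply (\<rho> s) e)" for e
  have mem: "tree_diff \<Lambda> (U f) \<in> tree_space \<Lambda>" for f
    by (rule tree_diff_in_tree_space[OF her Nil U(1)])
  have cmem: "(\<lambda>s. c * tree_diff \<Lambda> (U f) s) \<in> tree_space \<Lambda>" for c f
    using tree_diff_in_tree_space[OF her Nil tree_cont_scale[OF U(1)]] by (simp add: tree_diff_scale)
  have comb: "J (c *\<^sub>R f + g) = c *\<^sub>R J f + J g" for c f g
  proof -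
    have "U (c *\<^sub>R f + g) = (\<lambda>s. c * U f s + U g s)"
      using U(2) by auto
    then show ?thesis
      using T(1)[OF cmem mem, of c f g] T(2)[OF mem] by (simp add: J_def tree_diff_combine)
  qed
  have J: "bounded_linear J"
  proof (rule bounded_linear_intro)
    show "J (f + g) = J f + J g" for f g
      using comb[of 1 f g] by simp
    then have "J 0 = 0"
      by (metis add_cancel_right_right)
    then show "J (c *\<^sub>R f) = c *\<^sub>R J f" for c f
      using comb[of c f 0] by simp
    show "norm (J f) \<le> norm f * (\<bar>K\<bar> * C)" for f
    proof -
      have "tree_norm \<Lambda> (tree_diff \<Lambda> (U f)) \<le> C * norm f"
        by (rule tree_norm_tree_diff_le[OF her Nil U(1,3)])
      moreover have "0 \<le> tree_norm \<Lambda> (tree_diff \<Lambda> (U f))"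
        using tree_delta_le_tree_norm[OF her Nil mem Nil, of f] by linarith
      ultimately have "K * tree_norm \<Lambda> (tree_diff \<Lambda> (U f)) \<le> \<bar>K\<bar> * (C * norm f)"
        by (intro mult_mono) auto
      then show ?thesis
        using K[OF mem, of f] by (simp add: J_def mult_ac)
    qed
  qed
  have cont: "tree_cont \<Lambda> (\<lambda>s. blinfun_apply (\<rho> s) e)" for e
    by (rule tree_cont_weak_star[OF her \<rho>(1,2)])
  obtain M where M: "\<And>s. s \<in> \<Lambda> \<Longrightarrow> norm (\<rho> s) \<le> M"
    using \<rho>(2) by (auto simp: bounded_iff)
  have combQ: "Q (c *\<^sub>R x + y) = c *\<^sub>R Q x + Q y" for c x y
    using V(1)[OF cont cont, of c x y] by (simp add: Q_def blinfun.add_right blinfun.scaleR_right)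
  have Q: "bounded_linear Q"
  proof (rule bounded_linear_intro)
    show "Q (f + g) = Q f + Q g" for f g
      using combQ[of 1 f g] by simp
    then have "Q 0 = 0"
      by (metis add_cancel_right_right)
    then show "Q (c *\<^sub>R f) = c *\<^sub>R Q f" for c f
      using combQ[of c f 0] by simp
    show "norm (Q e) \<le> norm e * (D * M)" for e
    proof -
      have "\<bar>blinfun_apply (\<rho> s) e\<bar> \<le> M * norm e" if "s \<in> \<Lambda>" for s
        using norm_blinfun[of "\<rho> s" e] mult_right_mono[OF M[OF that], of "norm e"] by simp
      then show ?thesis
        using V(2)[OF cont, of e "M * norm e"] by (simp add: Q_def mult_ac)
    qed
  qed
  have "Q (J f) = f" for f
  proof -
    have "Q (J f) = V (U f)"
      unfolding Q_def J_def by (rule V(3)) (simp add: \<rho>(3) mem tree_delta_tree_diff[OF her])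
    then show ?thesis
      by (simp add: VU)
  qed
  then show ?thesis
    using complemented_range[OF J Q] by blast
qed

section \<open>Evaluating tree sums at points and embedding them into the Banach space\<close>

context tree_partition
begin

lemma weight_le: "tree_weight \<Lambda> h N s x \<le> h s x"
  unfolding tree_weight_def using nonneg by (simp add: sum_nonneg)

lemma weight_eq_0:
  assumes "s @ [n] \<in> tree_trunc \<Lambda> N" "h (s @ [n]) x = h s x"
  shows "tree_weight \<Lambda> h N s x = 0"
proof -
  have "h (s @ [n]) x \<le> (\<Sum>n | s @ [n] \<in> tree_trunc \<Lambda> N. h (s @ [n]) x)"
    using assms(1) nonneg finite_children by (intro member_le_sum) auto
  then show ?thesis
    using assms(2) weight_nonneg[of N s x] by (simp add: tree_weight_def)
qed

text \<open>The mass over \<open>x\<close> travels undivided from the root to \<open>s\<close> and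
  stays there. As soon as \<open>N\<close> bounds the length and the entries of \<open>s\<close>,
  every prefix of \<open>s\<close> is in the truncation and \<open>s\<close> alone has nonzero
  weight.\<close>

lemma tree_sum_point:
  assumes "tree_cont \<Lambda> G" "s \<in> \<Lambda>" and h: "\<And>u. u \<in> \<Lambda> \<Longrightarrow> h u x = (if prefix u s then 1 else 0)"
  shows "tree_sum \<Lambda> h G x = G s"
proof (rule tree_sum_eqI[OF assms(1)])
  fix \<epsilon> :: real
  assume "\<epsilon> > 0"
  have "u = s" if N: "Max (insert (length s) (set s)) \<le> N" and u: "u \<in> tree_trunc \<Lambda> N" "tree_weight \<Lambda> h N u x \<noteq> 0" for N u
  proof (rule ccontr)
    assume "u \<noteq> s"
    have "u \<in> \<Lambda>"
      using u(1) by (simp add: tree_trunc_def)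
    have "0 < tree_weight \<Lambda> h N u x"
      using u(2) weight_nonneg[of N u x] by simp
    then have "prefix u s"
      using weight_le[of N u x] h[OF \<open>u \<in> \<Lambda>\<close>] by (auto split: if_splits)
    then obtain n where n: "prefix (u @ [n]) s"
      using \<open>u \<noteq> s\<close> strict_prefix_obtains_snoc[of u s] by (auto simp: strict_prefix_def)
    then have "u @ [n] \<in> \<Lambda>"
      using her assms(2) hereditary_prefix by blast
    moreover have "u @ [n] \<in> tree_trunc \<Lambda> N"
      using N calculation n by (auto simp: tree_trunc_def prefix_def)
    ultimately show False
      using weight_eq_0[of u n N x] u(2) h[of "u @ [n]"] h[OF \<open>u \<in> \<Lambda>\<close>] n \<open>prefix u s\<close> by simp
  qed
  then show "\<exists>N0. \<forall>N\<ge>N0. \<forall>u\<in>tree_trunc \<Lambda> N. tree_weight \<Lambda> h N u x \<noteq> 0 \<longrightarrow> \<bar>G u - G s\<bar> \<le> \<epsilon>"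
    using \<open>\<epsilon> > 0\<close> by (intro exI[of _ "Max (insert (length s) (set s))"]) fastforce
qed

lemma tree_fun_cong:
  assumes "\<And>s. s \<in> \<Lambda> \<Longrightarrow> G s = H s"
  shows "tree_fun G = tree_fun H"
proof -
  have "tree_diff \<Lambda> G s = tree_diff \<Lambda> H s" for s
    using assms[of s] assms[of "butlast s"] assms[OF Nil] snoc_mem_hereditary[OF her, of "butlast s" "last s"]
    by (auto simp: tree_diff_def)
  then have "tree_sum \<Lambda> h G = tree_sum \<Lambda> h H"
    by (simp add: tree_sum_def tree_psum_def fun_eq_iff)
  then show ?thesis
    by (simp add: tree_fun_def)
qed

text \<open>\<open>T\<close> turns an element into its tree sum on the space and embeds that by
  \<open>J\<close>; \<open>\<rho> s\<close> is evaluation at \<open>x s\<close> after the left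
  inverse \<open>K\<close> of \<open>J\<close>. Weak* continuity comes from uniform continuity of
  functions on a compact space.\<close>

lemma projectional_tree_if_complemented:
  fixes J :: "('l \<Rightarrow>\<^sub>C real) \<Rightarrow> 'e::banach"
  assumes F: "complemented F" "isomorphism_onto J F" and rank: "tree_of_rank \<beta> \<Lambda>"
    and x: "\<And>s u. s \<in> \<Lambda> \<Longrightarrow> u \<in> \<Lambda> \<Longrightarrow> h u (x s) = (if prefix u s then 1 else 0)"
    and unif: "\<And>s t. (\<And>n :: nat. s n \<in> \<Lambda> \<and> t n \<in> \<Lambda>) \<Longrightarrow> (\<lambda>n. tree_dist (s n) (t n)) \<longlonglongrightarrow> 0 \<Longrightarrow>
      (\<lambda>n. dist (x (s n)) (x (t n))) \<longlonglongrightarrow> 0"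
  shows "\<exists>T (\<rho> :: nat list \<Rightarrow> 'e \<Rightarrow>\<^sub>L real). projectional_tree \<beta> \<Lambda> T \<rho>"
proof -
  obtain K where K: "bounded_linear K" "\<And>f. K (J f) = f"
    using complemented_left_inverse[OF F] by blast
  interpret K: bounded_linear K
    by (rule K(1))
  have J: "bounded_linear J"
    using F(2) by (simp add: isomorphism_onto_def)
  interpret J: bounded_linear J
    by (rule J)
  define \<rho> where "\<rho> s = Blinfun (\<lambda>e. apply_bcontfun (K e) (x s))" for s
  obtain M where M: "M > 0" "\<And>e. norm (K e) \<le> norm e * M"
    using K.pos_bounded by blast
  have Kx: "\<bar>apply_bcontfun (K e) y\<bar> \<le> norm e * M" for e y
    using norm_bounded[of "K e" y] M(2)[of e] by simp
  have \<rho>: "blinfun_apply (\<rho> s) e = apply_bcontfun (K e) (x s)" for s e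
  proof -
    have "bounded_linear (\<lambda>e. apply_bcontfun (K e) (x s))"
      by (rule bounded_linear_intro[where K = M])
        (use Kx in \<open>auto simp: K.add K.scaleR plus_bcontfun.rep_eq scaleR_bcontfun.rep_eq\<close>)
    then show ?thesis
      unfolding \<rho>_def by (simp add: bounded_linear_Blinfun_apply)
  qed
  have wk: "uniformly_weak_star_continuous \<Lambda> tree_dist \<rho>"
    unfolding uniformly_weak_star_continuous_def
  proof (intro allI impI, elim conjE)
    fix e and s t :: "nat \<Rightarrow> nat list"
    assume "\<forall>n. s n \<in> \<Lambda> \<and> t n \<in> \<Lambda>" "(\<lambda>n. tree_dist (s n) (t n)) \<longlonglongrightarrow> 0"
    then have "(\<lambda>n. dist (x (s n)) (x (t n))) \<longlonglongrightarrow> 0"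
      using unif by blast
    moreover have "uniformly_continuous_on UNIV (apply_bcontfun (K e))"
      using compact by (intro compact_uniformly_continuous) auto
    ultimately have "(\<lambda>n. dist (apply_bcontfun (K e) (x (s n))) (apply_bcontfun (K e) (x (t n)))) \<longlonglongrightarrow> 0"
      unfolding uniformly_continuous_on_sequentially by auto
    then show "(\<lambda>n. blinfun_apply (\<rho> (s n) - \<rho> (t n)) e) \<longlonglongrightarrow> 0"
      unfolding blinfun.diff_left \<rho> dist_real_def by (simp add: tendsto_rabs_zero_iff)
  qed
  have "norm (\<rho> s) \<le> M" for s
    using Kx M(1) by (intro norm_blinfun_bound) (auto simp: \<rho> mult.commute)
  then have bdd: "bounded (\<rho> ` \<Lambda>)"
    by (auto simp: bounded_iff)
  define T where "T a = J (tree_fun (\<lambda>t. tree_delta t a))" for a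
  have tc: "tree_cont \<Lambda> (\<lambda>t. tree_delta t a)" if "a \<in> tree_space \<Lambda>" for a
    using that tree_space_iff[OF her Nil] by simp
  have \<rho>T: "blinfun_apply (\<rho> s) (T a) = tree_delta s a" if "s \<in> \<Lambda>" "a \<in> tree_space \<Lambda>" for s a
    using tree_sum_point[OF tc[OF that(2)] that(1), of "x s"] x[OF that(1)]
    by (simp add: \<rho> T_def K(2) apply_tree_fun[OF tc[OF that(2)]])
  have Tlin: "T (\<lambda>s. c * a s + b s) = c *\<^sub>R T a + T b" if "a \<in> tree_space \<Lambda>" "b \<in> tree_space \<Lambda>" for a b c
  proof -
    have "(\<lambda>t. tree_delta t (\<lambda>s. c * a s + b s)) = (\<lambda>t. c * tree_delta t a + tree_delta t b)"
      by (simp add: tree_delta_def sum.distrib sum_distrib_left)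
    then show ?thesis
      unfolding T_def by (simp add: tree_fun_combine tc that J.add J.scaleR)
  qed
  have zero: "(\<lambda>_. 0) \<in> tree_space \<Lambda>"
    unfolding tree_space_iff[OF her Nil] by (simp add: tree_delta_def tree_cont_zero)
  have T0: "T (\<lambda>_. 0) = 0"
    using Tlin[OF zero zero, of 1] by simp
  have cont: "tree_cont \<Lambda> (\<lambda>s. blinfun_apply (\<rho> s) e)" for e
    by (rule tree_cont_weak_star[OF her wk bdd])
  \<comment> \<open>This operator is the identity on the range of \<open>T\<close> and has all its
    values there; being bounded, it shows that the range is closed.\<close>
  define R where "R e = J (tree_fun (\<lambda>s. blinfun_apply (\<rho> s) e))" for e
  have R: "R e = T (tree_diff \<Lambda> (\<lambda>s. blinfun_apply (\<rho> s) e))" for e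
    unfolding R_def T_def by (rule arg_cong[of _ _ J], rule tree_fun_cong) (simp add: tree_delta_tree_diff[OF her])
  obtain B where B: "B > 0" "\<And>f. norm (J f) \<le> norm f * B"
    using J.pos_bounded by blast
  have combR: "R (c *\<^sub>R e + f) = c *\<^sub>R R e + R f" for c e f
    unfolding R_def blinfun.add_right blinfun.scaleR_right
    by (simp add: tree_fun_combine[OF cont cont] J.add J.scaleR)
  have "bounded_linear R"
  proof (rule bounded_linear_intro)
    show "R (f + g) = R f + R g" for f g
      using combR[of 1 f g] by simp
    then have "R 0 = 0"
      by (metis add_cancel_right_right)
    then show "R (c *\<^sub>R f) = c *\<^sub>R R f" for c f
      using combR[of c f 0] by simp
    show "norm (R e) \<le> norm e * (M * B)" for e
    proof -
      have "norm (tree_fun (\<lambda>s. blinfun_apply (\<rho> s) e)) \<le> norm e * M"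
        by (rule norm_tree_fun[OF cont]) (simp add: \<rho> Kx)
      then show ?thesis
        unfolding R_def mult.assoc[symmetric] using B(1)
        by (intro order_trans[OF B(2)] mult_right_mono) auto
    qed
  qed
  moreover have "T ` tree_space \<Lambda> = {e. R e = e}"
  proof (intro set_eqI iffI)
    fix e
    assume "e \<in> T ` tree_space \<Lambda>"
    then obtain a where a: "a \<in> tree_space \<Lambda>" "e = T a"
      by blast
    have "R e = T a"
      unfolding R_def T_def a(2) using \<rho>T a(1) by (intro arg_cong[of _ _ J] tree_fun_cong) (simp add: T_def)
    then show "e \<in> {e. R e = e}"
      by (simp add: a(2))
  next
    fix e
    assume "e \<in> {e. R e = e}"
    then have "e = T (tree_diff \<Lambda> (\<lambda>s. blinfun_apply (\<rho> s) e))"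
      by (simp add: R)
    then show "e \<in> T ` tree_space \<Lambda>"
      using tree_diff_in_tree_space[OF her Nil cont] by blast
  qed
  ultimately have closed: "closed (T ` tree_space \<Lambda>)"
    by (auto intro!: closed_Collect_eq linear_continuous_on continuous_intros)
  have upper: "norm (T a) \<le> B * tree_norm \<Lambda> a" if "a \<in> tree_space \<Lambda>" for a
  proof -
    have "norm (tree_fun (\<lambda>t. tree_delta t a)) \<le> tree_norm \<Lambda> a"
      by (rule norm_tree_fun[OF tc[OF that]]) (rule tree_delta_le_tree_norm[OF her Nil that])
    then have "norm (tree_fun (\<lambda>t. tree_delta t a)) * B \<le> tree_norm \<Lambda> a * B"
      using B(1) by (intro mult_right_mono) auto
    then show ?thesis
      unfolding T_def using B(2)[of "tree_fun (\<lambda>t. tree_delta t a)"] by (simp add: mult.commute)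
  qed
  have lower: "1 / M * tree_norm \<Lambda> a \<le> norm (T a)" if "a \<in> tree_space \<Lambda>" for a
  proof -
    have "tree_norm \<Lambda> a \<le> norm (T a) * M"
      unfolding tree_norm_def
    proof (rule cSUP_least)
      show "\<bar>tree_delta t a\<bar> \<le> norm (T a) * M" if "t \<in> \<Lambda>" for t
        using \<rho>T[OF that \<open>a \<in> tree_space \<Lambda>\<close>] Kx[of "T a" "x t"] by (simp add: \<rho>)
    qed (use Nil in auto)
    then show ?thesis
      using M(1) by (simp add: field_simps)
  qed
  have "tree_embedding \<Lambda> T"
    unfolding tree_embedding_def
  proof (intro conjI)
    show "\<forall>a\<in>tree_space \<Lambda>. \<forall>b\<in>tree_space \<Lambda>. T (\<lambda>s. a s + b s) = T a + T b"
      using Tlin[of _ _ 1] by simp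
    show "\<forall>c. \<forall>a\<in>tree_space \<Lambda>. T (\<lambda>s. c * a s) = c *\<^sub>R T a"
      using Tlin[OF _ zero] T0 by simp
    show "\<exists>C. \<forall>a\<in>tree_space \<Lambda>. norm (T a) \<le> C * tree_norm \<Lambda> a"
      using upper by blast
    show "\<exists>c>0. \<forall>a\<in>tree_space \<Lambda>. c * tree_norm \<Lambda> a \<le> norm (T a)"
      using lower M(1) by (intro exI[of _ "1 / M"]) auto
  qed (rule closed)
  then show ?thesis
    using rank wk bdd \<rho>T unfolding projectional_tree_def by blast
qed

end

section \<open>From complemented copies to projectional trees\<close>

text \<open>The centres approach \<open>x\<close> with distances that more than halve at each step,
  so the balls lie in disjoint annuli around \<open>x\<close>.\<close>

lemma disjoint_balls_at_limit_point:
  fixes x :: "'l::metric_space"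
  assumes "\<And>n :: nat. x islimpt A n" "\<And>n. b n > 0"
  obtains y \<rho> where "\<And>n. y n \<in> A n" "\<And>n. \<rho> n > 0" "\<And>n. cball (y n) (2 * \<rho> n) \<subseteq> ball x (b n)"
    "\<And>n. x \<notin> cball (y n) (2 * \<rho> n)"
    "\<And>m n. m \<noteq> n \<Longrightarrow> cball (y m) (2 * \<rho> m) \<inter> cball (y n) (2 * \<rho> n) = {}"
proof -
  have "\<exists>y. \<forall>n. (y n \<in> A n \<and> y n \<noteq> x \<and> dist (y n) x < b n / 2) \<and> dist (y (Suc n)) x < dist (y n) x / 2"
  proof (rule dependent_nat_choice)
    have "b 0 / 2 > 0"
      using assms(2) by simp
    then show "\<exists>y. y \<in> A 0 \<and> y \<noteq> x \<and> dist y x < b 0 / 2"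
      using assms(1)[of 0] unfolding islimpt_approachable by blast
    fix z n
    assume "z \<in> A n \<and> z \<noteq> x \<and> dist z x < b n / 2"
    then have "min (b (Suc n) / 2) (dist z x / 2) > 0"
      using assms(2) by simp
    then obtain y where "y \<in> A (Suc n)" "y \<noteq> x" "dist y x < min (b (Suc n) / 2) (dist z x / 2)"
      using assms(1)[of "Suc n"] unfolding islimpt_approachable by meson
    then show "\<exists>y. (y \<in> A (Suc n) \<and> y \<noteq> x \<and> dist y x < b (Suc n) / 2) \<and> dist y x < dist z x / 2"
      by auto
  qed
  then obtain y where y: "\<And>n. y n \<in> A n" "\<And>n. y n \<noteq> x" "\<And>n. dist (y n) x < b n / 2"
    "\<And>n. dist (y (Suc n)) x < dist (y n) x / 2"
    by metis
  define d where "d n = dist (y n) x" for n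
  have d: "d n > 0" "d n < b n / 2" "d (Suc n) < d n / 2" for n
    using y by (auto simp: d_def)
  have dec: "d n \<le> d m" if "m \<le> n" for m n
  proof (rule lift_Suc_antimono_le[OF _ that])
    show "d (Suc n) \<le> d n" for n
      using d(1)[of n] d(3)[of n] by simp
  qed
  have half: "d n < d m / 2" if "m < n" for m n
    using dec[of "Suc m" n] d(3)[of m] that by simp
  \<comment> \<open>With \<open>\<rho> n = d n / 8\<close> the balls have radius
    \<open>d n / 4\<close>. Disjointness then follows from 5/4 * 1/2 < 3/4, and containment in
    \<open>ball x (b n)\<close> from \<open>d n < b n / 2\<close>.\<close>
  have range: "3 / 4 * d n \<le> dist x z \<and> dist x z \<le> 5 / 4 * d n" if "z \<in> cball (y n) (2 * (d n / 8))" for z n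
    using that dist_triangle[of "y n" x z] dist_triangle[of x z "y n"] unfolding d_def
    by (auto simp: dist_commute)
  have disj: "cball (y m) (2 * (d m / 8)) \<inter> cball (y n) (2 * (d n / 8)) = {}" if "m < n" for m n
  proof (rule ccontr)
    assume "\<not> ?thesis"
    then obtain z where "z \<in> cball (y m) (2 * (d m / 8))" "z \<in> cball (y n) (2 * (d n / 8))"
      by blast
    then show False
      using range[of z m] range[of z n] half[OF that] d(1)[of m] by linarith
  qed
  show ?thesis
  proof (rule that[of y "\<lambda>n. d n / 8"])
    show "y n \<in> A n" "d n / 8 > 0" for n
      using y d by auto
    show "cball (y n) (2 * (d n / 8)) \<subseteq> ball x (b n)" for n
    proof
      fix z
      assume "z \<in> cball (y n) (2 * (d n / 8))"
      then show "z \<in> ball x (b n)"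
        using range[of z n] d[of n] by (simp add: mem_ball)
    qed
    show "x \<notin> cball (y n) (2 * (d n / 8))" for n
      using range[of x n] d(1)[of n] by auto
    show "cball (y m) (2 * (d m / 8)) \<inter> cball (y n) (2 * (d n / 8)) = {}" if "m \<noteq> n" for m n
      using disj[of m n] disj[of n m] that by (metis Int_commute linorder_neqE_nat)
  qed
qed

lemma half_power_mono: "m \<le> n \<Longrightarrow> (1 / 2 :: real) ^ n \<le> (1 / 2) ^ m"
  by (intro power_decreasing) auto

text \<open>The codes of two nodes first differ at the zero that ends the smaller of the two entries
  following their common prefix. Agreement up to \<open>m\<close> pushes that index beyond
  \<open>m\<close>, so both points are within (1/2)^m of the point of the common prefix; hence the
  factor 2.\<close>

lemma tree_dist_imp_close:
  fixes x :: "nat list \<Rightarrow> 'l::metric_space"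
  assumes near: "\<And>s n u. s @ n # u \<in> \<Lambda> \<Longrightarrow> dist (x (s @ n # u)) (x s) \<le> (1 / 2) ^ (length (code_word s) + n)"
    and "s \<in> \<Lambda>" "t \<in> \<Lambda>" "tree_dist s t < (1 / 2) ^ m"
  shows "dist (x s) (x t) \<le> 2 * (1 / 2) ^ m"
proof -
  have eq: "cantor_code s k = cantor_code t k" if "k \<le> m" for k
    using cantor_dist_less assms(4) that unfolding tree_dist_def by blast
  have *: "dist (x (w @ n # u)) (x w) \<le> (1 / 2) ^ m"
    if "w @ n # u \<in> \<Lambda>" "m \<le> length (code_word w) + n" for w n u
    using near[OF that(1)] half_power_mono[OF that(2)] by linarith
  have twice: "a \<le> 2 * (1 / 2) ^ m" if "a \<le> (1 / 2) ^ m" for a :: real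
    using that zero_le_power[of "1 / 2 :: real" m] by linarith
  have beyond: "cantor_code w (length (code_word w) + n)" for w n
    by (simp add: cantor_code_eq)
  consider "s = t" | n u where "t = s @ n # u" | n u where "s = t @ n # u"
    | w n n' u v where "s = w @ n # u" "t = w @ n' # v" "n \<noteq> n'"
  proof (cases "prefix s t \<or> prefix t s")
    case True
    then show thesis
      using that(1-3) by (auto simp: prefix_def) (metis append_Nil2 list.exhaust)+
  next
    case False
    then have "s \<parallel> t"
      by auto
    then show thesis
      using parallel_decomp that(4) by metis
  qed
  then show ?thesis
  proof cases
    case (2 n u)
    then have "m < length (code_word s) + n"
      using eq[of "length (code_word s) + n"] cantor_code_append_False[of s n u] beyond[of s n] not_le by blast
    then show ?thesis
      using *[of s n u] assms(3) 2 twice by (fastforce simp: dist_commute)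
  next
    case (3 n u)
    then have "m < length (code_word t) + n"
      using eq[of "length (code_word t) + n"] cantor_code_append_False[of t n u] beyond[of t n] not_le by blast
    then show ?thesis
      using *[of t n u] assms(2) 3 twice by fastforce
  next
    case (4 w n n' u v)
    have "m < length (code_word w) + min n n'"
    proof (cases "n < n'")
      case True
      then have "cantor_code t (length (code_word w) + n)"
        using cantor_code_append_eq[of "length (code_word w) + n" w n' v] beyond[of w n] 4 by simp
      then show ?thesis
        using True eq[of "length (code_word w) + n"] cantor_code_append_False[of w n u] 4(1)
        by (metis min.absorb3 not_le)
    next
      case False
      then have "n' < n"
        using 4(3) by simp
      then have "cantor_code s (length (code_word w) + n')"
        using cantor_code_append_eq[of "length (code_word w) + n'" w n u] beyond[of w n'] 4 by simp
      then show ?thesis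
        using \<open>n' < n\<close> eq[of "length (code_word w) + n'"] cantor_code_append_False[of w n' v] 4(2)
        by (metis min.absorb4 not_le)
    qed
    then have "dist (x s) (x w) \<le> (1 / 2) ^ m" "dist (x t) (x w) \<le> (1 / 2) ^ m"
      using *[of w n u] *[of w n' v] 4 assms(2,3) by auto
    then show ?thesis
      using dist_triangle2[of "x s" "x t" "x w"] by linarith
  qed auto
qed

text \<open>The plateau of radius \<open>r\<close> leaves room for the supports of the children,
  which have to lie where the function of the parent is 1.\<close>

definition tent :: "'l::metric_space \<Rightarrow> real \<Rightarrow> 'l \<Rightarrow> real" where
  "tent y r z = max 0 (min 1 (2 - dist z y / r))"

lemma continuous_tent: "continuous_on UNIV (tent y r)"
  unfolding tent_def divide_inverse by (intro continuous_intros)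

lemma tent_eq_1: "r > 0 \<Longrightarrow> dist z y \<le> r \<Longrightarrow> tent y r z = 1"
  by (auto simp: tent_def min_def max_def divide_le_eq_1)

lemma tent_eq_0: "r > 0 \<Longrightarrow> 2 * r \<le> dist z y \<Longrightarrow> tent y r z = 0"
  by (auto simp: tent_def field_simps)

lemma tent_bounds: "0 \<le> tent y r z" "tent y r z \<le> 1"
  by (auto simp: tent_def)

text \<open>The points of the children are chosen near that of the parent, with disjoint supports
  inside the plateau of the parent and away from its point. At any place at most one child is then
  nonzero, and where it is, the parent has the value 1.\<close>

lemma tree_partition_at_points:
  fixes D :: "nat list \<Rightarrow> 'l::metric_space set"
  assumes compact: "compact (UNIV :: 'l set)" and her: "hereditary \<Lambda>" and Nil: "[] \<in> \<Lambda>"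
    and full: "\<And>s n. s \<in> nonleaves \<Lambda> \<Longrightarrow> s @ [n] \<in> \<Lambda>"
    and D: "D [] \<noteq> {}" "\<And>s n y. s @ [n] \<in> \<Lambda> \<Longrightarrow> y \<in> D s \<Longrightarrow> y islimpt D (s @ [n])"
  obtains h x where "tree_partition \<Lambda> h"
    "\<And>s u. s \<in> \<Lambda> \<Longrightarrow> u \<in> \<Lambda> \<Longrightarrow> h u (x s :: 'l) = (if prefix u s then 1 else 0)"
    "\<And>s n u. s @ n # u \<in> \<Lambda> \<Longrightarrow> dist (x (s @ n # u)) (x s) \<le> (1 / 2) ^ (length (code_word s) + n)"
proof -
  \<comment> \<open>The first bound keeps the supports of children inside the plateau; the second
    matches the Cantor distance of the nodes and gives uniform continuity of the choice of
    points.\<close>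
  define b where "b s n r = min r ((1 / 2) ^ (length (code_word s) + n))" for s :: "nat list" and n and r :: real
  define P where "P s p \<longleftrightarrow> (s \<in> \<Lambda> \<longrightarrow> fst p \<in> D s \<and> snd p > 0)" for s and p :: "'l \<times> real"
  define Q where "Q s p q \<longleftrightarrow> (s \<in> nonleaves \<Lambda> \<longrightarrow>
     (\<forall>n. cball (fst (q n)) (2 * snd (q n)) \<subseteq> ball (fst p) (b s n (snd p)) \<and>
        fst p \<notin> cball (fst (q n)) (2 * snd (q n))) \<and>
     (\<forall>m n. m \<noteq> n \<longrightarrow> cball (fst (q m)) (2 * snd (q m)) \<inter> cball (fst (q n)) (2 * snd (q n)) = {}))"
    for s and p :: "'l \<times> real" and q :: "nat \<Rightarrow> 'l \<times> real"
  obtain z where "z \<in> D []"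
    using D(1) by blast
  then have "P [] (z, 1)"
    by (simp add: P_def)
  moreover have "\<exists>q. (\<forall>n. P (s @ [n]) (q n)) \<and> Q s p q" if "P s p" for s p
  proof (cases "s \<in> nonleaves \<Lambda>")
    case True
    then have "fst p \<in> D s" "snd p > 0"
      using \<open>P s p\<close> by (auto simp: P_def nonleaves_def)
    then have "\<And>n. fst p islimpt D (s @ [n])" "\<And>n. b s n (snd p) > 0"
      using D(2) full[OF True] by (auto simp: b_def)
    then obtain y \<rho> where "\<And>n. y n \<in> D (s @ [n])" "\<And>n. \<rho> n > 0" "\<And>n. cball (y n) (2 * \<rho> n) \<subseteq> ball (fst p) (b s n (snd p))"
      "\<And>n. fst p \<notin> cball (y n) (2 * \<rho> n)"
      "\<And>m n. m \<noteq> n \<Longrightarrow> cball (y m) (2 * \<rho> m) \<inter> cball (y n) (2 * \<rho> n) = {}"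
      using disjoint_balls_at_limit_point[of "fst p" "\<lambda>n. D (s @ [n])" "\<lambda>n. b s n (snd p)"] by blast
    then show ?thesis
      by (intro exI[of _ "\<lambda>n. (y n, \<rho> n)"]) (auto simp: P_def Q_def)
  next
    case False
    then have "s @ [n] \<notin> \<Lambda>" for n
      using nonleaves_iff[OF her] snoc_mem_hereditary[OF her] by blast
    then show ?thesis
      using False by (auto simp: P_def Q_def)
  qed
  ultimately obtain F where F: "\<And>s. P s (F s)" "\<And>s. Q s (F s) (\<lambda>n. F (s @ [n]))"
    using tree_choice[of P "(z, 1)" Q] by blast
  define x where "x s = fst (F s)" for s
  define r where "r s = snd (F s)" for s
  have r: "r s > 0" if "s \<in> \<Lambda>" for s
    using F(1)[of s] that by (simp add: P_def r_def)
  have nl: "s \<in> nonleaves \<Lambda>" if "s @ [n] \<in> \<Lambda>" for s n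
    using that nonleaves_iff[OF her] snoc_mem_hereditary[OF her] by blast
  have sub: "cball (x (s @ [n])) (2 * r (s @ [n])) \<subseteq> ball (x s) (b s n (r s))"
    and notin: "x s \<notin> cball (x (s @ [n])) (2 * r (s @ [n]))" if "s @ [n] \<in> \<Lambda>" for s n
    using F(2)[of s] nl[OF that] by (auto simp: Q_def x_def r_def)
  have disj: "cball (x (s @ [m])) (2 * r (s @ [m])) \<inter> cball (x (s @ [n])) (2 * r (s @ [n])) = {}"
    if "s @ [n] \<in> \<Lambda>" "m \<noteq> n" for s m n
    using F(2)[of s] nl[OF that(1)] that(2) by (auto simp: Q_def x_def r_def)
  have nested: "cball (x (s @ u)) (2 * r (s @ u)) \<subseteq> cball (x s) (2 * r s)" if "s @ u \<in> \<Lambda>" for s u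
    using that
  proof (induction u rule: rev_induct)
    case (snoc n u)
    have su: "s @ u \<in> \<Lambda>"
      using snoc_mem_hereditary[OF her, of "s @ u" n] snoc.prems by simp
    have "cball (x (s @ u @ [n])) (2 * r (s @ u @ [n])) \<subseteq> ball (x (s @ u)) (b (s @ u) n (r (s @ u)))"
      using sub[of "s @ u" n] snoc.prems by simp
    also have "\<dots> \<subseteq> cball (x (s @ u)) (2 * r (s @ u))"
      using r[OF su] by (auto simp: b_def)
    finally show ?case
      using snoc.IH[OF su] by blast
  qed simp
  have nested1: "cball (x (s @ n # u)) (2 * r (s @ n # u)) \<subseteq> cball (x (s @ [n])) (2 * r (s @ [n]))"
    if "s @ n # u \<in> \<Lambda>" for s n u
    using nested[of "s @ [n]" u] that by simp
  have mem: "x s \<in> cball (x s) (2 * r s)" if "s \<in> \<Lambda>" for s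
    using r[OF that] by simp
  have pre: "s @ [n] \<in> \<Lambda>" if "s @ n # u \<in> \<Lambda>" for s n u
    using hereditary_prefix[OF her that, of "s @ [n]"] by simp
  have ext: "x (s @ n # u) \<in> ball (x s) (b s n (r s))" if "s @ n # u \<in> \<Lambda>" for s n u
    using nested1[OF that] mem[OF that] sub[OF pre[OF that]] by blast
  \<comment> \<open>The root carries the constant 1 instead of a bump, and nodes outside the tree
    get 0, because a tree partition assigns functions to all sequences.\<close>
  define h where "h s y = (if s = [] then 1 else if s \<in> \<Lambda> then tent (x s) (r s) y else 0)" for s y
  have "tree_partition \<Lambda> h"
  proof
    show "continuous_on UNIV (h s)" for s
      unfolding h_def by (cases "s = []"; cases "s \<in> \<Lambda>") (auto simp: continuous_tent)
    show "0 \<le> h s y" for s y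
      by (simp add: h_def tent_bounds)
    show "h [] y = 1" for y
      by (simp add: h_def)
    show "(\<Sum>n\<in>I. h (s @ [n]) y) \<le> h s y" if "finite I" for I s y
    proof (cases "\<exists>n\<in>I. h (s @ [n]) y \<noteq> 0")
      case False
      then show ?thesis
        by (simp add: h_def tent_bounds)
    next
      case True
      then obtain n where n: "n \<in> I" "h (s @ [n]) y \<noteq> 0"
        by blast
      have in_ball: "s @ [k] \<in> \<Lambda> \<and> y \<in> cball (x (s @ [k])) (2 * r (s @ [k]))" if "h (s @ [k]) y \<noteq> 0" for k
        using that r[of "s @ [k]"] tent_eq_0[of "r (s @ [k])" y "x (s @ [k])"]
        by (fastforce simp: h_def dist_commute split: if_splits)
      then have "h (s @ [k]) y = 0" if "k \<noteq> n" for k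
        using disj[of s n k] n(2) that by blast
      then have "(\<Sum>n\<in>I. h (s @ [n]) y) = (\<Sum>n\<in>{n}. h (s @ [n]) y)"
        using n \<open>finite I\<close> by (intro sum.mono_neutral_right) auto
      also have "\<dots> \<le> 1"
        by (simp add: h_def tent_bounds)
      also have "1 = h s y"
      proof -
        have "y \<in> ball (x s) (b s n (r s))"
          using in_ball[OF n(2)] sub[of s n] by blast
        then have "tent (x s) (r s) y = 1"
          using in_ball[OF n(2)] r[OF snoc_mem_hereditary[OF her, of s n]]
          by (intro tent_eq_1) (auto simp: b_def dist_commute)
        then show ?thesis
          using in_ball[OF n(2)] snoc_mem_hereditary[OF her, of s n] by (simp add: h_def)
      qed
      finally show ?thesis .
    qed
  qed (use compact her Nil in auto)
  moreover have "h u (x s) = (if prefix u s then 1 else 0)" if su: "s \<in> \<Lambda>" "u \<in> \<Lambda>" for s u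
  proof -
    consider "u = []" | "u \<noteq> []" "s = u" | n v where "u \<noteq> []" "s = u @ n # v" | n v where "u = s @ n # v"
      | w n n' v v' where "s = w @ n # v" "u = w @ n' # v'" "n \<noteq> n'"
    proof (cases "prefix s u \<or> prefix u s")
      case True
      then show thesis
        using that(1-4) by (auto simp: prefix_def) (metis append_Nil2 list.exhaust)+
    next
      case False
      then have "s \<parallel> u"
        by auto
      then show thesis
        using parallel_decomp that(5) by metis
    qed
    then show ?thesis
    proof cases
      case 2
      then show ?thesis
        using tent_eq_1[OF r[OF su(2)], of "x s" "x u"] su r[OF su(2)] by (simp add: h_def)
    next
      case (3 n v)
      then have "dist (x s) (x u) \<le> r u"
        using ext[of u n v] su by (simp add: b_def dist_commute)
      then show ?thesis
        using tent_eq_1[OF r[OF su(2)], of "x s" "x u"] su 3 by (simp add: h_def)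
    next
      case (4 n v)
      have "x s \<notin> cball (x u) (2 * r u)"
        using nested1[of s n v] notin[of s n] pre[of s n v] su(2) unfolding 4 by blast
      then show ?thesis
        using tent_eq_0[OF r[OF su(2)], of "x s"] su 4 by (auto simp: h_def dist_commute)
    next
      case (5 w n n' v v')
      have "x s \<in> cball (x (w @ [n])) (2 * r (w @ [n]))"
        using nested1[of w n v] mem[OF su(1)] su(1) unfolding 5(1) by blast
      then have "x s \<notin> cball (x u) (2 * r u)"
        using nested1[of w n' v'] disj[of w n' n] pre[of w n' v'] su(2) 5(3) unfolding 5(2) by blast
      then show ?thesis
        using tent_eq_0[OF r[OF su(2)], of "x s"] su 5 by (auto simp: h_def dist_commute)
    qed (simp add: h_def)
  qed
  moreover have "dist (x (s @ n # u)) (x s) \<le> (1 / 2) ^ (length (code_word s) + n)" if "s @ n # u \<in> \<Lambda>" for s n u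
    using ext[OF that] by (simp add: b_def dist_commute)
  ultimately show ?thesis
    by (rule that)
qed

lemma projectional_tree_exists:
  fixes J :: "('l::metric_space \<Rightarrow>\<^sub>C real) \<Rightarrow> 'e::banach" and \<beta> :: "'a ordinal option"
  assumes "complemented F" "isomorphism_onto J F" "tree_of_rank \<beta> \<Lambda>"
    and compact: "compact (UNIV :: 'l set)" and her: "hereditary \<Lambda>" and Nil: "[] \<in> \<Lambda>"
    and full: "\<And>s n. s \<in> nonleaves \<Lambda> \<Longrightarrow> s @ [n] \<in> \<Lambda>"
    and D: "D [] \<noteq> {}" "\<And>s n y :: 'l. s @ [n] \<in> \<Lambda> \<Longrightarrow> y \<in> D s \<Longrightarrow> y islimpt D (s @ [n])"
  shows "\<exists>T (\<rho> :: nat list \<Rightarrow> 'e \<Rightarrow>\<^sub>L real). projectional_tree \<beta> \<Lambda> T \<rho>"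
proof -
  obtain h x where hx: "tree_partition \<Lambda> h"
    "\<And>s u. s \<in> \<Lambda> \<Longrightarrow> u \<in> \<Lambda> \<Longrightarrow> h u (x s :: 'l) = (if prefix u s then 1 else 0)"
    "\<And>s n u. s @ n # u \<in> \<Lambda> \<Longrightarrow> dist (x (s @ n # u)) (x s) \<le> (1 / 2) ^ (length (code_word s) + n)"
    using tree_partition_at_points[OF compact her Nil full D] by metis
  interpret tree_partition \<Lambda> h
    by (rule hx(1))
  show ?thesis
  proof (rule projectional_tree_if_complemented[OF assms(1-3) hx(2)])
    fix s t :: "nat \<Rightarrow> nat list"
    assume st: "\<And>n. s n \<in> \<Lambda> \<and> t n \<in> \<Lambda>" and lim: "(\<lambda>n. tree_dist (s n) (t n)) \<longlonglongrightarrow> 0"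
    show "(\<lambda>n. dist (x (s n)) (x (t n))) \<longlonglongrightarrow> 0"
    proof (rule LIMSEQ_I)
      fix \<epsilon> :: real
      assume "\<epsilon> > 0"
      then obtain m where m: "(1 / 2 :: real) ^ m < \<epsilon> / 2"
        using real_arch_pow_inv[of "\<epsilon> / 2" "1 / 2"] by auto
      obtain n0 where "\<And>n. n \<ge> n0 \<Longrightarrow> norm (tree_dist (s n) (t n) - 0) < (1 / 2) ^ m"
        using LIMSEQ_D[OF lim, of "(1 / 2) ^ m"] by auto
      then have "dist (x (s n)) (x (t n)) \<le> 2 * (1 / 2) ^ m" if "n \<ge> n0" for n
        using that st by (intro tree_dist_imp_close[OF hx(3)]) (auto simp: abs_less_iff)
      then show "\<exists>no. \<forall>n\<ge>no. norm (dist (x (s n)) (x (t n)) - 0) < \<epsilon>"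
        using m by (intro exI[of _ n0]) fastforce
    qed
  qed
qed

lemma full_tree:
  "tree_of_rank \<beta> \<Lambda> \<Longrightarrow> hereditary \<Lambda> \<and> [] \<in> \<Lambda> \<and> (\<forall>s\<in>nonleaves \<Lambda>. \<forall>n. s @ [n] \<in> \<Lambda>)"
  by (cases \<beta>) (auto simp: nonleaves_def hereditary_def)

theorem projectional_tree_if_complemented_C:
  fixes J :: "('l::metric_space \<Rightarrow>\<^sub>C real) \<Rightarrow> 'e::banach"
  assumes compact: "compact (UNIV :: 'l set)" and F: "complemented F" "isomorphism_onto J F"
  shows "\<exists>\<Lambda> T (\<rho> :: nat list \<Rightarrow> 'e \<Rightarrow>\<^sub>L real). projectional_tree (ht (UNIV :: 'l set)) \<Lambda> T \<rho>"
proof (cases "ht (UNIV :: 'l set)")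
  case None
  obtain K :: "'l set" where K: "K \<noteq> {}" "\<And>x. x \<in> K \<Longrightarrow> x islimpt K"
    using ht_None_perfect[OF None] by blast
  have "tree_of_rank (None :: 'l ordinal option) UNIV"
    by simp
  then show ?thesis
    unfolding None using K
    by (intro exI[of _ UNIV] projectional_tree_exists[OF F _ compact, where D = "\<lambda>_. K"]) (auto simp: hereditary_def)
next
  case (Some \<beta>)
  obtain \<alpha> where \<alpha>: "\<beta> = osuc \<alpha>" "derived (UNIV :: 'l set) \<alpha> \<noteq> {}" "derived (UNIV :: 'l set) \<beta> = {}"
    using ht_Some_compact[OF compact Some] by blast
  \<comment> \<open>Countability is needed twice: the tree of this rank exists, and its ranks
    decrease strictly along branches.\<close>
  have ctb: "countable (UNIV :: 'l set)"
    using countable_if_derived_empty[OF compact] \<alpha> by blast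
  obtain \<Lambda> where \<Lambda>: "tree_of_rank (Some \<beta>) \<Lambda>"
    using tree_of_rank_exists[OF countable_lessThan_ordinal[OF ctb, of \<alpha>]] \<alpha>(1) by blast
  have rank: "tree_rank \<Lambda> [] = \<alpha>" and nib: "no_infinite_branch \<Lambda>"
    using \<Lambda> \<alpha>(1) by (auto simp: osuc_inject)
  have "\<exists>T (\<rho> :: nat list \<Rightarrow> 'e \<Rightarrow>\<^sub>L real). projectional_tree (Some \<beta>) \<Lambda> T \<rho>"
  proof (rule projectional_tree_exists[OF F \<Lambda> compact, where D = "\<lambda>s. derived UNIV (tree_rank \<Lambda> s)"])
    fix s n and y :: 'l
    assume s: "s @ [n] \<in> \<Lambda>" and y: "y \<in> derived UNIV (tree_rank \<Lambda> s)"
    have "tree_rank \<Lambda> (s @ [n]) < (tree_rank \<Lambda> s :: 'l ordinal)"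
      using s full_tree[OF \<Lambda>] snoc_mem_hereditary by (intro tree_rank_less[OF ctb nib]) (auto simp: strict_prefix_snoc)
    then show "y islimpt derived UNIV (tree_rank \<Lambda> (s @ [n]))"
      using islimpt_derived[OF y] by blast
  qed (use full_tree[OF \<Lambda>] \<alpha> rank in auto)
  then show ?thesis
    unfolding Some by blast
qed

section \<open>Uncountable spaces\<close>

lemma bcontfun_uniform:
  fixes f :: "'l::metric_space \<Rightarrow>\<^sub>C real"
  assumes "compact (UNIV :: 'l set)" "\<epsilon> > 0"
  shows "\<exists>d>0. \<forall>y z. dist y z < d \<longrightarrow> \<bar>apply_bcontfun f y - apply_bcontfun f z\<bar> \<le> \<epsilon>"
proof -
  have "uniformly_continuous_on UNIV (apply_bcontfun f)"
    using assms(1) by (intro compact_uniformly_continuous) auto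
  then have "\<exists>d>0. \<forall>z. \<forall>y. dist y z < d \<longrightarrow> dist (apply_bcontfun f y) (apply_bcontfun f z) < \<epsilon>"
    using assms(2) unfolding uniformly_continuous_on_def by simp
  then show ?thesis
    unfolding dist_real_def by (meson less_imp_le)
qed

text \<open>Indices from \<open>k\<close> on are padded with zero functions, since every node of the
  full tree has infinitely many children.\<close>

definition fine_partition :: "real \<Rightarrow> nat \<Rightarrow> (nat \<Rightarrow> 'l::metric_space \<Rightarrow> real) \<Rightarrow> bool" where
  "fine_partition \<delta> k p \<longleftrightarrow>
    (\<forall>n. continuous_on UNIV (p n)) \<and> (\<forall>n x. 0 \<le> p n x) \<and> (\<forall>n x. k \<le> n \<longrightarrow> p n x = 0) \<and>
    (\<forall>x. (\<Sum>n<k. p n x) = 1) \<and> (\<forall>n x y. p n x \<noteq> 0 \<longrightarrow> p n y \<noteq> 0 \<longrightarrow> dist x y \<le> \<delta>)"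

lemma fine_partition_exists:
  assumes "compact (UNIV :: 'l::metric_space set)" "\<delta> > 0"
  shows "\<exists>k (p :: nat \<Rightarrow> 'l \<Rightarrow> real). fine_partition \<delta> k p"
proof -
  have "\<delta> / 2 > 0"
    using assms(2) by simp
  then obtain A :: "'l set" where A: "finite A" "UNIV \<subseteq> (\<Union>c\<in>A. ball c (\<delta> / 2))"
    using assms(1) unfolding compact_eq_totally_bounded by meson
  obtain c where c: "bij_betw c {..<card A} A"
    using ex_bij_betw_nat_finite[OF A(1)] by (auto simp: lessThan_atLeast0)
  define \<phi> where "\<phi> n z = (if n < card A then max 0 (\<delta> / 2 - dist z (c n)) else 0)" for n z
  define \<sigma> where "\<sigma> z = (\<Sum>n<card A. \<phi> n z)" for z
  have \<phi>: "0 \<le> \<phi> n z" for n z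
    by (simp add: \<phi>_def)
  have cont: "continuous_on UNIV (\<phi> n)" for n
    unfolding \<phi>_def by (cases "n < card A") (auto intro!: continuous_intros)
  have pos: "\<sigma> z > 0" for z
  proof -
    obtain a where a: "a \<in> A" "dist a z < \<delta> / 2"
      using A(2) UNIV_I[of z] unfolding subset_iff UN_iff mem_ball by blast
    moreover have "c ` {..<card A} = A"
      using c by (simp add: bij_betw_def)
    ultimately obtain n where n: "n < card A" "c n = a"
      by (metis imageE lessThan_iff)
    have "0 < \<phi> n z"
      using a(2) n by (simp add: \<phi>_def dist_commute)
    also have "\<phi> n z \<le> \<sigma> z"
      unfolding \<sigma>_def using n(1) \<phi> by (intro member_le_sum) auto
    finally show ?thesis .
  qed
  have "fine_partition \<delta> (card A) (\<lambda>n z. \<phi> n z / \<sigma> z)"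
    unfolding fine_partition_def
  proof (intro conjI allI impI)
    have "continuous_on UNIV \<sigma>"
      unfolding \<sigma>_def by (intro continuous_intros cont)
    then show "continuous_on UNIV (\<lambda>z. \<phi> n z / \<sigma> z)" for n
      using pos by (intro continuous_intros cont) (auto simp: less_le)
    show "0 \<le> \<phi> n z / \<sigma> z" for n z
      using \<phi> pos by (simp add: less_imp_le)
    show "\<phi> n z / \<sigma> z = 0" if "card A \<le> n" for n z
      using that by (simp add: \<phi>_def)
    show "(\<Sum>n<card A. \<phi> n z / \<sigma> z) = 1" for z
      using pos[of z] unfolding sum_divide_distrib[symmetric] \<sigma>_def[symmetric] by simp
    show "dist y z \<le> \<delta>" if "\<phi> n y / \<sigma> y \<noteq> 0" "\<phi> n z / \<sigma> z \<noteq> 0" for n y z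
      using that dist_triangle2[of y z "c n"] by (auto simp: \<phi>_def split: if_splits)
  qed
  then show ?thesis
    by blast
qed

text \<open>The measures with the cylinder masses \<open>h s x\<close> below average continuous functions on the
  Cantor set over the fibres of a surjection onto the space; the existence of such an averaging
  operator is Milutin's lemma.\<close>

lemma complemented_if_projectional_tree_UNIV:
  fixes T :: "(nat list \<Rightarrow> real) \<Rightarrow> 'e::banach"
  assumes compact: "compact (UNIV :: 'l::metric_space set)"
    and tree: "projectional_tree \<beta> UNIV T \<rho>"
  shows "\<exists>F (J :: ('l \<Rightarrow>\<^sub>C real) \<Rightarrow> 'e). complemented F \<and> isomorphism_onto J F"
proof -
  have "\<exists>k (p :: nat \<Rightarrow> 'l \<Rightarrow> real). fine_partition ((1 / 2) ^ i) k p" for i :: nat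
    by (rule fine_partition_exists[OF compact]) simp
  then obtain k p where fp: "\<And>i. fine_partition ((1 / 2) ^ i) (k i) (p i :: nat \<Rightarrow> 'l \<Rightarrow> real)"
    by metis
  have p: "continuous_on UNIV (p i n)" "0 \<le> p i n x" "k i \<le> n \<Longrightarrow> p i n x = 0"
    "(\<Sum>n<k i. p i n x) = 1" "p i n x \<noteq> 0 \<Longrightarrow> p i n y \<noteq> 0 \<Longrightarrow> dist x y \<le> (1 / 2) ^ i" for i n x y
    using fp[of i] unfolding fine_partition_def by blast+
  define h where "h s x = (\<Prod>i<length s. p i (s ! i) x)" for s x
  have h_Nil: "h [] x = 1" for x
    by (simp add: h_def)
  have h_snoc: "h (s @ [n]) x = h s x * p (length s) n x" for s n x
    by (simp add: h_def nth_append)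
  have h_nonneg: "0 \<le> h s x" for s x
    by (simp add: h_def p(2) prod_nonneg)
  have h_close: "dist x y \<le> (1 / 2) ^ i" if "h s x \<noteq> 0" "h s y \<noteq> 0" "i < length s" for s x y i
    by (rule p(5)[of i "s ! i"]) (use that in \<open>auto simp: h_def prod_zero_iff\<close>)
  have h_take: "h (take n s) x \<noteq> 0" if "h s x \<noteq> 0" for n s x
    using that by (auto simp: h_def prod_zero_iff)
  have sum_le: "(\<Sum>n\<in>I. p i n x) \<le> 1" if "finite I" for I i x
  proof -
    have "(\<Sum>n\<in>I. p i n x) \<le> (\<Sum>n\<in>I \<union> {..<k i}. p i n x)"
      using that p(2) by (intro sum_mono2) auto
    also have "\<dots> = (\<Sum>n<k i. p i n x)"
      using that p(3) by (intro sum.mono_neutral_right) (auto simp: not_less)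
    finally show ?thesis
      by (simp add: p(4))
  qed
  interpret tree_partition UNIV h
  proof
    show "hereditary UNIV"
      by (simp add: hereditary_def)
    show "continuous_on UNIV (h s)" for s
      unfolding h_def by (intro continuous_intros p(1))
    show "(\<Sum>n\<in>I. h (s @ [n]) x) \<le> h s x" if "finite I" for I s x
      using mult_left_mono[OF sum_le[OF that, of "length s" x] h_nonneg[of s x]]
      by (simp add: h_snoc sum_distrib_left)
  qed (use compact h_nonneg h_Nil in auto)
  \<comment> \<open>Once the truncation contains all active children of a node, they take over its
    whole mass. So for large \<open>N\<close> no weight remains at low levels.\<close>
  have weight_0: "tree_weight UNIV h N s x = 0" if "length s < N" "s \<in> tree_trunc UNIV N" "k (length s) \<le> N" for N s x
  proof -
    have "{n. s @ [n] \<in> tree_trunc UNIV N} = {..N}"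
      using that(1,2) by (auto simp: tree_trunc_def)
    moreover have "(\<Sum>n\<le>N. p (length s) n x) = (\<Sum>n<k (length s). p (length s) n x)"
      using that(3) p(3) by (intro sum.mono_neutral_right) (auto simp: not_less)
    ultimately show ?thesis
      using p(4) by (simp add: tree_weight_def h_snoc flip: sum_distrib_left)
  qed
  \<comment> \<open>The point of a node lies in the support of \<open>h s\<close> if that is not
    empty; an empty node inherits the point of its parent. At the root, where \<open>h\<close> is 1,
    any point will do.\<close>
  define P where "P s z \<longleftrightarrow> ((\<exists>y. h s y \<noteq> 0) \<longrightarrow> h s z \<noteq> 0)" for s z
  define Q where "Q s z q \<longleftrightarrow> (\<forall>n. (\<forall>y. h (s @ [n]) y = 0) \<longrightarrow> q n = z)" for s and z :: 'l and q
  have "P [] undefined"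
    by (simp add: P_def h_Nil)
  moreover have "\<exists>q. (\<forall>n. P (s @ [n]) (q n)) \<and> Q s z q" if "P s z" for s z
  proof -
    have "\<forall>n. \<exists>w. P (s @ [n]) w \<and> ((\<forall>y. h (s @ [n]) y = 0) \<longrightarrow> w = z)"
      unfolding P_def by metis
    then show ?thesis
      unfolding Q_def by metis
  qed
  ultimately obtain x where x: "\<And>s. P s (x s)" "\<And>s. Q s (x s) (\<lambda>n. x (s @ [n]))"
    using tree_choice[of P undefined Q] by blast
  have x_ne: "h s (x s) \<noteq> 0" if "h s y \<noteq> 0" for s y
    using x(1)[of s] that by (auto simp: P_def)
  have x_eq: "x (s @ [n]) = x s" if "\<And>y. h (s @ [n]) y = 0" for s n
    using x(2)[of s] that by (simp add: Q_def)
  \<comment> \<open>Along nodes with empty support the point does not move. Otherwise both points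
    lie in the support of the prefix of length \<open>Suc n\<close>, which is cut down by the
    partition of mesh (1/2)^n.\<close>
  have x_take: "dist (x t) (x (take (Suc n) t)) \<le> (1 / 2) ^ n" for t n
  proof (induction t rule: rev_induct)
    case (snoc m t)
    show ?case
    proof (cases "length t \<le> n")
      case False
      show ?thesis
      proof (cases "\<forall>y. h (t @ [m]) y = 0")
        case True
        then show ?thesis
          using snoc x_eq[of t m] False by simp
      next
        case h: False
        then have "h (t @ [m]) (x (t @ [m])) \<noteq> 0"
          using x_ne by blast
        then have "h (take (Suc n) (t @ [m])) (x (t @ [m])) \<noteq> 0"
          by (rule h_take)
        then show ?thesis
          using x_ne False by (intro h_close[of "take (Suc n) (t @ [m])"]) auto
      qed
    qed simp
  qed simp
  have x_above: "x (s @ n # u) = x s" if "k (length s) \<le> n" for s n u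
  proof -
    have "h (s @ n # u) y = 0" for y u
      using h_take[of "s @ n # u" y "Suc (length s)"] p(3)[OF that] h_snoc[of s n] by auto
    then show ?thesis
    proof (induction u rule: rev_induct)
      case Nil
      then show ?case
        using x_eq[of s n] by simp
    next
      case (snoc m u)
      then show ?case
        using x_eq[of "s @ n # u" m] by simp
    qed
  qed
  define U where "U f s = apply_bcontfun f (x s)" for f :: "'l \<Rightarrow>\<^sub>C real" and s
  have close: "\<exists>m. \<forall>y z. dist y z \<le> (1 / 2) ^ m \<longrightarrow> \<bar>apply_bcontfun f y - apply_bcontfun f z\<bar> \<le> \<epsilon>"
    if "\<epsilon> > 0" for f :: "'l \<Rightarrow>\<^sub>C real" and \<epsilon>
  proof -
    obtain d where d: "d > 0" "\<And>y z. dist y z < d \<Longrightarrow> \<bar>apply_bcontfun f y - apply_bcontfun f z\<bar> \<le> \<epsilon>"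
      using bcontfun_uniform[OF compact \<open>\<epsilon> > 0\<close>, of f] by blast
    obtain m where "(1 / 2 :: real) ^ m < d"
      using real_arch_pow_inv[OF d(1), of "1 / 2"] by auto
    then show ?thesis
      using d(2) by (intro exI[of _ m]) auto
  qed
  have U_cont: "tree_cont UNIV (U f)" for f
    unfolding tree_cont_def
  proof (intro conjI ballI allI impI)
    show "bdd_above (range (\<lambda>t. \<bar>U f t\<bar>))"
      using norm_bounded[of f] by (auto simp: U_def bdd_above_def)
    show "\<exists>N. \<forall>n\<ge>N. \<forall>t\<in>UNIV. prefix (s @ [n]) t \<longrightarrow> \<bar>U f t - U f s\<bar> \<le> \<epsilon>" if "\<epsilon> > 0" for s \<epsilon>
      using that x_above by (intro exI[of _ "k (length s)"]) (auto simp: U_def prefix_def)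
    show "\<exists>N. \<forall>n\<ge>N. \<forall>t\<in>UNIV. \<bar>U f t - U f (take n t)\<bar> \<le> \<epsilon>" if e: "\<epsilon> > 0" for \<epsilon>
    proof -
      obtain m where m: "\<And>y z. dist y z \<le> (1 / 2) ^ m \<Longrightarrow> \<bar>apply_bcontfun f y - apply_bcontfun f z\<bar> \<le> \<epsilon>"
        using close[OF e] by blast
      have "\<bar>U f t - U f (take n t)\<bar> \<le> \<epsilon>" if n: "Suc m \<le> n" for n t
      proof -
        obtain n' where n': "n = Suc n'" "m \<le> n'"
          using n by (cases n) auto
        show ?thesis
          unfolding U_def n'(1) using x_take half_power_mono[OF n'(2)] by (intro m) (rule order_trans)
      qed
      then show ?thesis
        by blast
    qed
  qed
  have VU: "tree_fun (U f) = f" for f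
  proof (rule bcontfun_eqI)
    fix y
    have "tree_sum UNIV h (U f) y = apply_bcontfun f y"
    proof (rule tree_sum_eqI[OF U_cont])
      fix \<epsilon> :: real
      assume "\<epsilon> > 0"
      then obtain m where m: "\<And>y z. dist y z \<le> (1 / 2) ^ m \<Longrightarrow> \<bar>apply_bcontfun f y - apply_bcontfun f z\<bar> \<le> \<epsilon>"
        using close by blast
      \<comment> \<open>A node with weight at \<open>y\<close> is longer than \<open>m\<close>, and
        its support contains both \<open>y\<close> and \<open>x s\<close>.\<close>
      have "\<bar>U f s - apply_bcontfun f y\<bar> \<le> \<epsilon>"
        if N: "Max (insert (Suc m) (k ` {..m})) \<le> N" and s: "s \<in> tree_trunc UNIV N" "tree_weight UNIV h N s y \<noteq> 0" for N s
      proof -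
        have "m < length s"
        proof (rule ccontr)
          assume "\<not> m < length s"
          then have "length s < N" "k (length s) \<le> N"
            using N by auto
          then show False
            using weight_0[of s N y] s by blast
        qed
        moreover have "h s y \<noteq> 0"
          using s(2) weight_le[of N s y] weight_nonneg[of N s y] by auto
        ultimately show ?thesis
          unfolding U_def by (intro m h_close[of s] x_ne)
      qed
      then show "\<exists>N0. \<forall>N\<ge>N0. \<forall>s\<in>tree_trunc UNIV N. tree_weight UNIV h N s y \<noteq> 0 \<longrightarrow> \<bar>U f s - apply_bcontfun f y\<bar> \<le> \<epsilon>"
        by blast
    qed
    then show "apply_bcontfun (tree_fun (U f)) y = apply_bcontfun f y"
      by (simp add: apply_tree_fun[OF U_cont])
  qed
  show ?thesis
  proof (rule complemented_if_projectional_tree[OF tree her Nil U_cont _ _ _ _ _ VU])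
    show "U (c *\<^sub>R f + g) s = c * U f s + U g s" for c f g s
      by (simp add: U_def plus_bcontfun.rep_eq scaleR_bcontfun.rep_eq)
    show "\<bar>U f s\<bar> \<le> 1 * norm f" for f s
      using norm_bounded[of f "x s"] by (simp add: U_def)
    show "norm (tree_fun G) \<le> 1 * B" if "tree_cont UNIV G" "\<And>s. s \<in> UNIV \<Longrightarrow> \<bar>G s\<bar> \<le> B" for G B
      using norm_tree_fun[OF that] by simp
  qed (use tree_fun_combine tree_fun_cong in blast)+
qed

section \<open>Scattered spaces\<close>

text \<open>Only countably many distances from \<open>x\<close> occur; for a radius that is not
  among them the open and the closed ball coincide.\<close>

lemma clopen_ball:
  fixes x :: "'l::metric_space"
  assumes "countable (UNIV :: 'l set)" "e > 0"
  obtains r where "0 < r" "r < e" "closed (ball x r)"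
proof -
  have "uncountable ({0<..<e} - range (dist x))"
    using assms by (intro uncountable_minus_countable) (auto simp: uncountable_open_interval)
  then obtain r where r: "0 < r" "r < e" "r \<notin> range (dist x)"
    by (metis DiffE countable_empty ex_in_conv greaterThanLessThan_iff)
  have "ball x r = cball x r"
    using r(3) by (auto simp: less_le)
  then show ?thesis
    using that r(1,2) by (metis closed_cball)
qed

text \<open>The pieces are chosen greedily along an enumeration: a point that is not yet covered
  becomes the point of largest rank of a new piece.\<close>

lemma clopen_splitting:
  fixes rk :: "'l::metric_space \<Rightarrow> 'b::linorder" and C P :: "'l set"
  assumes compact: "compact (UNIV :: 'l set)" and ctb: "countable (UNIV :: 'l set)"
    and C: "open C" "closed C" and P: "closed P"
    and rk: "\<And>y. \<exists>e>0. \<forall>z. dist y z < e \<longrightarrow> z \<noteq> y \<longrightarrow> rk z < rk y"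
    and "\<delta> > 0" and freq: "\<forall>y\<in>C - P. \<forall>m. \<exists>n\<ge>m. rk y \<le> R n"
  shows "\<exists>y D. (\<forall>n. open (D n) \<and> closed (D n)) \<and> (\<forall>m n. m \<noteq> n \<longrightarrow> D m \<inter> D n = {}) \<and> (\<Union>n. D n) = C - P \<and>
    (\<forall>n<n0. D n = {}) \<and> (\<forall>n. D n = {} \<longrightarrow> y n = x) \<and>
    (\<forall>n. D n \<noteq> {} \<longrightarrow> y n \<in> D n \<and> rk (y n) \<le> R n \<and> (\<forall>z\<in>D n. z \<noteq> y n \<longrightarrow> rk z < rk (y n)) \<and>
      (\<forall>z\<in>D n. \<forall>z'\<in>D n. dist z z' \<le> \<delta>)) \<and>
    (\<forall>W. open W \<longrightarrow> P \<subseteq> W \<longrightarrow> finite {n :: nat. \<not> D n \<subseteq> W})"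
proof -
  define good where "good y N \<longleftrightarrow> open N \<and> closed N \<and> y \<in> N \<and> N \<subseteq> C - P \<and> (\<forall>z\<in>N. z \<noteq> y \<longrightarrow> rk z < rk y) \<and>
      (\<forall>z\<in>N. \<forall>z'\<in>N. dist z z' \<le> \<delta>)" for y N
  have "\<exists>N. good y N" if y: "y \<in> C - P" for y
  proof -
    have "open (C - P)"
      using C(1) P by (rule open_Diff)
    then obtain e1 where e1: "e1 > 0" "ball y e1 \<subseteq> C - P"
      using y open_contains_ball by blast
    obtain e2 where e2: "e2 > 0" "\<And>z. dist y z < e2 \<Longrightarrow> z \<noteq> y \<Longrightarrow> rk z < rk y"
      using rk by blast
    have "min (min e1 e2) (\<delta> / 2) > 0"
      using e1 e2 \<open>\<delta> > 0\<close> by simp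
    then obtain r where r: "0 < r" "r < min (min e1 e2) (\<delta> / 2)" "closed (ball y r)"
      by (rule clopen_ball[OF ctb])
    have "dist z z' \<le> \<delta>" if "z \<in> ball y r" "z' \<in> ball y r" for z z'
      using dist_triangle3[of z z' y] that r(2) by simp
    moreover have "ball y r \<subseteq> C - P"
      using e1(2) r(2) subset_ball[of r e1 y] by auto
    ultimately show ?thesis
      unfolding good_def using r e2(2) by (intro exI[of _ "ball y r"]) auto
  qed
  then obtain N where "\<And>y. y \<in> C - P \<Longrightarrow> good y (N y)"
    by metis
  then have N: "\<And>y. y \<in> C - P \<Longrightarrow> open (N y) \<and> closed (N y) \<and> y \<in> N y \<and> N y \<subseteq> C - P"
    "\<And>y z. y \<in> C - P \<Longrightarrow> z \<in> N y \<Longrightarrow> z \<noteq> y \<Longrightarrow> rk z < rk y"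
    "\<And>y z z'. y \<in> C - P \<Longrightarrow> z \<in> N y \<Longrightarrow> z' \<in> N y \<Longrightarrow> dist z z' \<le> \<delta>"
    unfolding good_def by blast+
  define e where "e = from_nat_into (UNIV :: 'l set)"
  have e: "\<exists>k. e k = y" for y
    using from_nat_into_surj[OF ctb, of y] by (simp add: e_def)
  \<comment> \<open>The union of the pieces made before step \<open>k\<close>; it stays clopen and
    inside \<open>C - P\<close>.\<close>
  define cov where "cov = rec_nat {} (\<lambda>k A. if e k \<in> C - P - A then A \<union> N (e k) else A)"
  have cov: "cov 0 = {}" "cov (Suc k) = (if e k \<in> C - P - cov k then cov k \<union> N (e k) else cov k)" for k
    by (auto simp: cov_def)
  have cov_clopen: "open (cov k) \<and> closed (cov k) \<and> cov k \<subseteq> C - P" for k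
    using N(1) by (induction k) (auto simp: cov)
  have cov_mono: "cov j \<subseteq> cov k" if "j \<le> k" for j k
    using that by (rule lift_Suc_mono_le[rotated]) (auto simp: cov)
  define D' where "D' k = cov (Suc k) - cov k" for k
  have D': "D' k \<noteq> {} \<Longrightarrow> e k \<in> C - P \<and> e k \<in> D' k \<and> D' k \<subseteq> N (e k)" for k
    using N(1)[of "e k"] by (auto simp: D'_def cov split: if_splits)
  have D'_disj: "D' j \<inter> D' k = {}" if "j < k" for j k
    using cov_mono[of "Suc j" k] that by (auto simp: D'_def)
  have D'_clopen: "open (D' k) \<and> closed (D' k)" for k
    unfolding D'_def using cov_clopen by (auto intro: open_Diff closed_Diff)
  have cov_D': "\<exists>j<k. y \<in> D' j" if "y \<in> cov k" for y k
    using that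
  proof (induction k)
    case (Suc k)
    then show ?case
      by (cases "y \<in> cov k") (auto simp: D'_def less_Suc_eq)
  qed (simp add: cov)
  have cov_all: "\<exists>k. y \<in> cov k" if y: "y \<in> C - P" for y
  proof -
    obtain k where "e k = y"
      using e by blast
    then have "y \<in> cov (Suc k)"
      using y N(1)[OF y] by (auto simp: cov)
    then show ?thesis
      by blast
  qed
  \<comment> \<open>The piece made at step \<open>k\<close> receives the index \<open>g k\<close>,
    late enough for \<open>R\<close> to dominate its rank. The indices start at \<open>n0\<close>
    and strictly increase, so no two pieces collide.\<close>
  have "\<exists>g. \<forall>k. (n0 \<le> g k \<and> (e k \<in> C - P \<longrightarrow> rk (e k) \<le> R (g k))) \<and> g k < g (Suc k)"
  proof (rule dependent_nat_choice)
    show "\<exists>n. n0 \<le> n \<and> (e 0 \<in> C - P \<longrightarrow> rk (e 0) \<le> R n)"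
      using freq by blast
    show "\<exists>n. (n0 \<le> n \<and> (e (Suc k) \<in> C - P \<longrightarrow> rk (e (Suc k)) \<le> R n)) \<and> j < n"
      if "n0 \<le> j \<and> (e k \<in> C - P \<longrightarrow> rk (e k) \<le> R j)" for j k
    proof (cases "e (Suc k) \<in> C - P")
      case True
      then obtain n where "n \<ge> Suc j" "rk (e (Suc k)) \<le> R n"
        using bspec[OF freq True] by blast
      then show ?thesis
        using that by (intro exI[of _ n]) auto
    next
      case False
      then show ?thesis
        using that by (intro exI[of _ "Suc j"]) auto
    qed
  qed
  then obtain g where g: "\<And>k. n0 \<le> g k" "\<And>k. e k \<in> C - P \<Longrightarrow> rk (e k) \<le> R (g k)" "\<And>k. g k < g (Suc k)"
    by blast
  have "strict_mono g"
    using g(3) by (rule strict_monoI_Suc)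
  then have inj: "g j = g k \<longleftrightarrow> j = k" for j k
    by (rule strict_mono_eq)
  define D where "D n = (if n \<in> range g then D' (inv g n) else {})" for n
  define y where "y n = (if D n = {} then x else e (inv g n))" for n
  have inv: "inv g (g k) = k" for k
    using inj by (intro inv_f_f) (auto simp: inj_def)
  have Dg: "D (g k) = D' k" for k
    by (simp add: D_def inv)
  have Dn: "\<exists>k. n = g k \<and> z \<in> D' k" if "z \<in> D n" for n z
    using that by (auto simp: D_def inv split: if_splits)
  show ?thesis
  proof (intro exI conjI allI impI ballI)
    show "open (D n)" "closed (D n)" for n
      using D'_clopen by (auto simp: D_def)
    show "D m \<inter> D n = {}" if "m \<noteq> n" for m n
    proof (rule ccontr)
      assume "D m \<inter> D n \<noteq> {}"
      then obtain z where "z \<in> D m" "z \<in> D n"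
        by blast
      then obtain j k where "m = g j" "z \<in> D' j" "n = g k" "z \<in> D' k"
        using Dn by meson
      then show False
        using D'_disj[of j k] D'_disj[of k j] \<open>m \<noteq> n\<close> by (metis IntI empty_iff linorder_neqE_nat)
    qed
    show "(\<Union>n. D n) = C - P"
    proof (intro set_eqI iffI)
      fix z
      assume "z \<in> (\<Union>n. D n)"
      then obtain k where "z \<in> D' k"
        using Dn by blast
      then show "z \<in> C - P"
        using cov_clopen[of "Suc k"] by (auto simp: D'_def)
    next
      fix z
      assume "z \<in> C - P"
      then obtain j where "z \<in> D' j"
        using cov_all cov_D' by meson
      then show "z \<in> (\<Union>n. D n)"
        using Dg[of j] by blast
    qed
    show "D n = {}" if "n < n0" for n
      using that g(1) by (auto simp: D_def not_le[symmetric])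
    show "y n = x" if "D n = {}" for n
      using that by (simp add: y_def)
    fix n
    assume ne: "D n \<noteq> {}"
    then obtain k where k: "n = g k"
      using Dn by blast
    then have yk: "y n = e k" "D n = D' k" "D' k \<noteq> {}"
      using ne by (auto simp: y_def inv Dg)
    show "y n \<in> D n" "rk (y n) \<le> R n"
      using D'[OF yk(3)] g(2) k yk by auto
    show "rk z < rk (y n)" if "z \<in> D n" "z \<noteq> y n" for z
      using D'[OF yk(3)] N(2)[of "e k" z] that yk by auto
    show "dist z z' \<le> \<delta>" if "z \<in> D n" "z' \<in> D n" for z z'
      using D'[OF yk(3)] N(3)[of "e k" z z'] that yk by auto
  next
    fix W :: "'l set"
    assume W: "open W" "P \<subseteq> W"
    \<comment> \<open>This compact set is covered by the increasing open sets \<open>cov k\<close>,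
      hence by one of them; later pieces are disjoint from it and so lie in
      \<open>W\<close>.\<close>
    have "compact (C - W)"
      using compact_Int_closed[OF compact, of "C - W"] C(2) W(1) by (simp add: closed_Diff)
    moreover have "C - W \<subseteq> (\<Union>k. cov k)"
      using W(2) cov_all by blast
    ultimately obtain K where K: "finite K" "C - W \<subseteq> (\<Union>k\<in>K. cov k)"
      using cov_clopen by (elim compactE_image[where f = cov and C = UNIV]) auto
    have sub: "C - W \<subseteq> cov (Max (insert 0 K))"
    proof
      fix z
      assume "z \<in> C - W"
      then obtain k where "k \<in> K" "z \<in> cov k"
        using K(2) by blast
      then show "z \<in> cov (Max (insert 0 K))"
        using cov_mono[of k "Max (insert 0 K)"] K(1) by auto
    qed
    have "{n. \<not> D n \<subseteq> W} \<subseteq> g ` {..<Max (insert 0 K)}"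
    proof
      fix n
      assume "n \<in> {n. \<not> D n \<subseteq> W}"
      then obtain z k where z: "z \<notin> W" "n = g k" "z \<in> D' k"
        using Dn by blast
      then have "z \<in> cov (Max (insert 0 K))" "z \<notin> cov k"
        using sub cov_clopen[of "Suc k"] by (auto simp: D'_def)
      then have "\<not> Max (insert 0 K) \<le> k"
        using cov_mono by blast
      then show "n \<in> g ` {..<Max (insert 0 K)}"
        using z(2) by auto
    qed
    then show "finite {n. \<not> D n \<subseteq> W}"
      by (rule finite_subset) simp
  qed
qed

lemma continuous_on_indicator_clopen:
  assumes "open C" "closed C"
  shows "continuous_on UNIV (indicator C :: 'a::topological_space \<Rightarrow> real)"
proof -
  have "continuous_on (C \<union> - C) (\<lambda>x. if x \<in> C then 1 else 0 :: real)"
    using assms by (intro continuous_on_cases) auto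
  then show ?thesis
    by (simp add: indicator_def of_bool_def)
qed

lemma finite_if_no_limit_point:
  assumes "compact (UNIV :: 'l::metric_space set)" "\<And>x :: 'l. \<not> x islimpt S"
  shows "finite S"
  using Heine_Borel_imp_Bolzano_Weierstrass[OF assms(1), of S] assms(2) by blast

text \<open>The points of largest rank all sit at the root, so that the tree function only encodes the
  functions vanishing there; the finitely many values at these points are stored at the first
  children of the root.\<close>

lemma complemented_if_projectional_tree_scattered:
  fixes T :: "(nat list \<Rightarrow> real) \<Rightarrow> 'e::banach"
  assumes compact: "compact (UNIV :: 'l::metric_space set)" and inf: "infinite (UNIV :: 'l set)"
    and empty: "derived (UNIV :: 'l set) (osuc \<alpha>) = {}" and ne: "derived (UNIV :: 'l set) \<alpha> \<noteq> {}"
    and tree: "projectional_tree (Some (osuc \<alpha>) :: 'l ordinal option) \<Lambda> T \<rho>"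
  shows "\<exists>F (J :: ('l \<Rightarrow>\<^sub>C real) \<Rightarrow> 'e). complemented F \<and> isomorphism_onto J F"
proof -
  have ctb: "countable (UNIV :: 'l set)"
    by (rule countable_if_derived_empty[OF compact empty])
  have tor: "tree_of_rank (Some (osuc \<alpha>) :: 'l ordinal option) \<Lambda>"
    using tree by (simp add: projectional_tree_def)
  then have her: "hereditary \<Lambda>" and Nil: "[] \<in> \<Lambda>" and full: "\<And>s n. s \<in> nonleaves \<Lambda> \<Longrightarrow> s @ [n] \<in> \<Lambda>"
    using full_tree[OF tor] by auto
  have nib: "no_infinite_branch \<Lambda>" and rank: "tree_rank \<Lambda> [] = \<alpha>"
    using tor by (auto simp: osuc_inject)
  define P where "P = derived (UNIV :: 'l set) \<alpha>"
  have P_iff: "y \<in> P \<longleftrightarrow> \<not> cb_rank y < \<alpha>" for y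
    unfolding P_def mem_derived_iff_cb_rank[OF empty] by (simp add: not_less)
  have closed_P: "closed P"
    unfolding P_def by (rule closed_derived) simp
  have fin_P: "finite P"
  proof (rule finite_if_no_limit_point[OF compact])
    fix x
    show "\<not> x islimpt P"
      using empty closed_P closed_limpt[of P] nonisolated_iff[of x P] unfolding derived_osuc P_def[symmetric] by blast
  qed
  have "\<alpha> \<noteq> 0"
  proof
    assume "\<alpha> = 0"
    then show False
      using fin_P inf by (simp add: P_def derived_zero)
  qed
  then have root_nl: "[] \<in> nonleaves \<Lambda>"
    using tree_rank_eq[OF nib Nil, where 'a = 'l] rank Nil by (auto simp: nonleaves_def split: if_splits)
  define m where "m = card P"
  obtain pt where pt: "bij_betw pt {..<m} P"
    using ex_bij_betw_nat_finite[OF fin_P] by (auto simp: m_def lessThan_atLeast0)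
  have m: "m > 0"
    using fin_P ne by (auto simp: m_def P_def card_gt_0_iff)
  have pt_P: "pt i \<in> P" if "i < m" for i
    using pt that by (auto simp: bij_betw_def)
  have P_pt: "\<exists>i<m. y = pt i" if "y \<in> P" for y
    using pt that by (auto simp: bij_betw_def)
  have pt_inj: "pt i = pt j \<longleftrightarrow> i = j" if "i < m" "j < m" for i j
    using pt that by (auto simp: bij_betw_def inj_on_def)
  \<comment> \<open>A bump around a point of largest rank vanishes at the finitely many others,
    since nearby points have smaller rank.\<close>
  have "\<exists>\<eta>. \<forall>y\<in>P. apply_bcontfun \<eta> y = (if y = pt i then 1 else 0 :: real)" if i: "i < m" for i
  proof -
    obtain e where e: "e > 0" "\<And>y. dist (pt i) y < e \<Longrightarrow> y \<noteq> pt i \<Longrightarrow> cb_rank y < cb_rank (pt i)"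
      using cb_rank_neighbourhood[OF empty, of "pt i"] by blast
    have far: "e \<le> dist y (pt i)" if "y \<in> P" "y \<noteq> pt i" for y
    proof (rule ccontr)
      assume "\<not> ?thesis"
      then have "cb_rank y < cb_rank (pt i)"
        using e(2) that by (simp add: dist_commute)
      then show False
        using cb_rank_le[OF empty, of "pt i"] P_iff[of y] that by (simp add: order.strict_trans2)
    qed
    have "tent (pt i) (e / 2) \<in> bcontfun"
      by (intro bcontfun_normI[OF continuous_tent, of _ _ 1]) (simp add: tent_bounds)
    then have "apply_bcontfun (Bcontfun (tent (pt i) (e / 2))) = tent (pt i) (e / 2)"
      by (rule Bcontfun_inverse)
    then show ?thesis
      using far e(1) tent_eq_1[of "e / 2" "pt i" "pt i"] tent_eq_0[of "e / 2" _ "pt i"]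
      by (intro exI[of _ "Bcontfun (tent (pt i) (e / 2))"]) auto
  qed
  then obtain \<eta> :: "nat \<Rightarrow> 'l \<Rightarrow>\<^sub>C real" where
    \<eta>: "\<And>i y. i < m \<Longrightarrow> y \<in> P \<Longrightarrow> apply_bcontfun (\<eta> i) y = (if y = pt i then 1 else 0)"
    by metis
  \<comment> \<open>The points of a piece that stay at its node: one point of largest rank, except
    that the root keeps all of \<open>P\<close>.\<close>
  define tops where "tops s p = (if s = [] then P else {fst p})" for s :: "nat list" and p :: "'l \<times> 'l set"
  \<comment> \<open>A node may receive the empty piece; its point is then the one inherited from its
    parent, and nothing else is required of it.\<close>
  define A where "A s p \<longleftrightarrow> open (snd p) \<and> closed (snd p) \<and> (snd p \<noteq> {} \<longrightarrow> s \<in> \<Lambda> \<and> fst p \<in> snd p \<and>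
      (s \<noteq> [] \<longrightarrow> cb_rank (fst p) \<le> tree_rank \<Lambda> s \<and> (\<forall>z\<in>snd p. z \<noteq> fst p \<longrightarrow> cb_rank z < cb_rank (fst p)) \<and>
        (\<forall>z\<in>snd p. \<forall>z'\<in>snd p. dist z z' \<le> (1 / 2) ^ length s))) \<and> (s = [] \<longrightarrow> snd p = UNIV)"
    for s :: "nat list" and p :: "'l \<times> 'l set"
  define Q where "Q s p q \<longleftrightarrow> (\<forall>i j. i \<noteq> j \<longrightarrow> snd (q i) \<inter> snd (q j) = {}) \<and> (\<Union>n. snd (q n)) = snd p - tops s p \<and>
      (s = [] \<longrightarrow> (\<forall>n<m. snd (q n) = {})) \<and> (\<forall>n. snd (q n) = {} \<longrightarrow> fst (q n) = fst p) \<and>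
      (\<forall>W. open W \<longrightarrow> tops s p \<subseteq> W \<longrightarrow> finite {n :: nat. \<not> snd (q n) \<subseteq> W})"
    for s p and q :: "nat \<Rightarrow> 'l \<times> 'l set"
  have "A [] (pt 0, UNIV)"
    using Nil by (simp add: A_def)
  moreover have "\<exists>q. (\<forall>n. A (s @ [n]) (q n)) \<and> Q s p q" if Asp: "A s p" for s p
  proof (cases "snd p = {}")
    case True
    then show ?thesis
      using Asp by (intro exI[of _ "\<lambda>_. p"]) (auto simp: A_def Q_def)
  next
    case False
    have p: "open (snd p)" "closed (snd p)" "s \<in> \<Lambda>" "fst p \<in> snd p"
      using Asp False by (auto simp: A_def)
    \<comment> \<open>The points to be handed down have rank below that of the node, so infinitely
      many children have rank large enough to receive them.\<close>
    have lt: "cb_rank y < (tree_rank \<Lambda> s :: 'l ordinal)" if y: "y \<in> snd p - tops s p" for y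
    proof (cases "s = []")
      case True
      then show ?thesis
        using y by (simp add: tops_def rank P_iff)
    next
      case s: False
      then have "cb_rank y < cb_rank (fst p)" "cb_rank (fst p) \<le> (tree_rank \<Lambda> s :: 'l ordinal)"
        using y Asp False by (auto simp: A_def tops_def)
      then show ?thesis
        by simp
    qed
    have nl: "s \<in> nonleaves \<Lambda>" if "y \<in> snd p - tops s p" for y
      using lt[OF that] tree_rank_eq[OF nib p(3), where 'a = 'l] p(3) not_less_zero_ordinal
      by (auto simp: nonleaves_def split: if_splits)
    have freq: "\<forall>y\<in>snd p - tops s p. \<forall>k. \<exists>n\<ge>k. cb_rank y \<le> (tree_rank \<Lambda> (s @ [n]) :: 'l ordinal)"
      using tree_rank_frequently[OF ctb tor nl lt] by blast
    have rk: "\<exists>e>0. \<forall>z. dist y z < e \<longrightarrow> z \<noteq> y \<longrightarrow> cb_rank z < cb_rank y" for y :: 'l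
      using cb_rank_neighbourhood[OF empty, of y] by metis
    have ct: "closed (tops s p)"
      using closed_P by (simp add: tops_def)
    have \<delta>: "(1 / 2 :: real) ^ Suc (length s) > 0"
      by simp
    \<comment> \<open>At the root, the first \<open>m\<close> children are left empty to store the
      values on \<open>P\<close>.\<close>
    obtain y D where yD: "\<forall>n. open (D n) \<and> closed (D n)" "\<forall>i j. i \<noteq> j \<longrightarrow> D i \<inter> D j = {}"
      "(\<Union>n. D n) = snd p - tops s p" "\<forall>n<if s = [] then m else 0. D n = {}" "\<forall>n. D n = {} \<longrightarrow> y n = fst p"
      "\<forall>n. D n \<noteq> {} \<longrightarrow> y n \<in> D n \<and> cb_rank (y n) \<le> (tree_rank \<Lambda> (s @ [n]) :: 'l ordinal) \<and>
         (\<forall>z\<in>D n. z \<noteq> y n \<longrightarrow> cb_rank z < cb_rank (y n)) \<and> (\<forall>z\<in>D n. \<forall>z'\<in>D n. dist z z' \<le> (1 / 2) ^ Suc (length s))"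
      "\<forall>W. open W \<longrightarrow> tops s p \<subseteq> W \<longrightarrow> finite {n :: nat. \<not> D n \<subseteq> W}"
      using clopen_splitting[OF compact ctb p(1,2) ct rk \<delta> freq, of "if s = [] then m else 0" "fst p"]
      by (elim exE conjE) (rule that, assumption+)
    have "s @ [n] \<in> \<Lambda>" if "D n \<noteq> {}" for n
      using yD(3) that nl full by blast
    then have "\<forall>n. A (s @ [n]) (y n, D n)"
      unfolding A_def using yD(1,6) by simp
    moreover have "Q s p (\<lambda>n. (y n, D n))"
      unfolding Q_def using yD(2,3,4,5,7) by (simp split: if_splits)
    ultimately show ?thesis
      by (intro exI[of _ "\<lambda>n. (y n, D n)"]) blast
  qed
  ultimately obtain F where F: "F [] = (pt 0, UNIV)" "\<And>s. A s (F s)" "\<And>s. Q s (F s) (\<lambda>n. F (s @ [n]))"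
    using tree_choice[of A "(pt 0, UNIV)" Q] by blast
  define x where "x s = fst (F s)" for s
  define C where "C s = snd (F s)" for s
  have C_clopen: "open (C s)" "closed (C s)" and C_\<Lambda>: "C s \<noteq> {} \<Longrightarrow> s \<in> \<Lambda>" and x_C: "C s \<noteq> {} \<Longrightarrow> x s \<in> C s"
    and C_diam: "s \<noteq> [] \<Longrightarrow> y \<in> C s \<Longrightarrow> z \<in> C s \<Longrightarrow> dist y z \<le> (1 / 2) ^ length s" for s y z
    using F(2)[of s] unfolding A_def x_def C_def by blast+
  have C_Nil: "C [] = UNIV" and x_Nil: "x [] \<in> P"
    using F(1) pt_P[OF m] by (auto simp: C_def x_def)
  define tp where "tp s = (if s = [] then P else {x s})" for s
  have C_disj: "i \<noteq> j \<Longrightarrow> C (s @ [i]) \<inter> C (s @ [j]) = {}" and C_un: "(\<Union>n. C (s @ [n])) = C s - tp s"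
    and C_first: "n < m \<Longrightarrow> C [n] = {}" and x_eq: "C (s @ [n]) = {} \<Longrightarrow> x (s @ [n]) = x s"
    and C_lim: "open W \<Longrightarrow> tp s \<subseteq> W \<Longrightarrow> finite {n. \<not> C (s @ [n]) \<subseteq> W}" for s i j n W
    using F(3)[of s] F(3)[of "[]"] unfolding Q_def tops_def tp_def[abs_def] x_def C_def by auto
  have C_sub: "C (s @ u) \<subseteq> C s" for s u
  proof (induction u rule: rev_induct)
    case (snoc n u)
    then show ?case
      using C_un[of "s @ u"] by auto
  qed simp
  have C_sub1: "C (s @ n # u) \<subseteq> C (s @ [n])" for s n u
    using C_sub[of "s @ [n]" u] by simp
  have x_ext: "x (s @ u) \<in> C s \<or> x (s @ u) = x s" for s u
  proof (induction u rule: rev_induct)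
    case (snoc n u)
    then show ?case
      using x_eq[of "s @ u" n] x_C[of "s @ u @ [n]"] C_sub[of s "u @ [n]"] by (cases "C (s @ u @ [n]) = {}") auto
  qed simp
  have x_child: "x (s @ n # u) \<in> C (s @ [n]) \<or> x (s @ n # u) = x s" for s n u
    using x_ext[of "s @ [n]" u] x_C[of "s @ [n]"] x_eq[of s n] by (cases "C (s @ [n]) = {}") auto
  define h where "h s = (indicator (C s) :: 'l \<Rightarrow> real)" for s
  interpret tree_partition \<Lambda> h
  proof
    show "continuous_on UNIV (h s)" for s
      unfolding h_def by (rule continuous_on_indicator_clopen[OF C_clopen])
    show "(\<Sum>n\<in>I. h (s @ [n]) y) \<le> h s y" if "finite I" for I s y
    proof (cases "\<exists>n\<in>I. y \<in> C (s @ [n])")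
      case True
      then obtain n where n: "n \<in> I" "y \<in> C (s @ [n])"
        by blast
      then have "(\<Sum>n\<in>I. h (s @ [n]) y) = (\<Sum>k\<in>I. if k = n then 1 else 0)"
        using C_disj[of _ n s] by (intro sum.cong) (auto simp: h_def indicator_def)
      then show ?thesis
        using n C_sub[of s "[n]"] \<open>finite I\<close> by (auto simp: h_def indicator_def)
    next
      case False
      then have "(\<Sum>n\<in>I. h (s @ [n]) y) = 0"
        by (intro sum.neutral) (auto simp: h_def)
      then show ?thesis
        by (simp add: h_def)
    qed
  qed (use her Nil compact C_Nil in \<open>auto simp: h_def\<close>)
  \<comment> \<open>Following a point through the pieces that contain it ends at a node where it is
    the top, because the tree has no infinite branch.\<close>
  have locate: "\<exists>t\<in>\<Lambda>. y \<in> C t \<and> x t = y \<and> prefix s t" if "s \<in> \<Lambda>" "s \<noteq> []" "y \<in> C s" for y s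
    using wf_extension_rel[OF nib] that
  proof (induction s rule: wf_induct_rule)
    case (less s)
    show ?case
    proof (cases "x s = y")
      case True
      then show ?thesis
        using less.prems by (intro bexI[of _ s]) auto
    next
      case False
      then have "y \<in> C s - tp s"
        using less.prems by (auto simp: tp_def)
      then obtain n where n: "y \<in> C (s @ [n])"
        unfolding C_un[symmetric] by blast
      then have "s @ [n] \<in> \<Lambda>"
        using C_\<Lambda> by blast
      then obtain t where "t \<in> \<Lambda>" "y \<in> C t" "x t = y" "prefix (s @ [n]) t"
        using less.IH[of "s @ [n]"] less.prems(1) n by (auto simp: extension_rel_def strict_prefix_snoc)
      then show ?thesis
        using append_prefixD by blast
    qed
  qed
  have h_node: "h u y = (if prefix u t then 1 else 0)" if y: "y \<in> C t" "y \<in> tp t" for u t y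
  proof -
    consider v where "t = u @ v" | n v where "u = t @ n # v" | w n n' v v' where "t = w @ n # v" "u = w @ n' # v'" "n \<noteq> n'"
    proof (cases "prefix t u \<or> prefix u t")
      case True
      then show thesis
        using that(1,2) by (auto simp: prefix_def) (metis append_Nil2 list.exhaust)+
    next
      case False
      then have "t \<parallel> u"
        by auto
      then show thesis
        using parallel_decomp that(3) by metis
    qed
    then show ?thesis
    proof cases
      case (1 v)
      then show ?thesis
        using y(1) C_sub[of u v] by (auto simp: h_def)
    next
      case (2 n v)
      then have "y \<notin> C u"
        using C_sub1[of t n v] C_un[of t] y(2) by auto
      then show ?thesis
        using 2 by (simp add: h_def)
    next
      case (3 w n n' v v')
      then have "y \<notin> C u"
        using C_sub1[of w n v] C_sub1[of w n' v'] C_disj[of n n' w] y(1) by auto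
      then show ?thesis
        using 3 by (simp add: h_def)
    qed
  qed
  \<comment> \<open>The pieces below the root may accumulate at any point of \<open>P\<close>, while
    a tree function has a single value at the root. For a function vanishing on \<open>P\<close>
    these requirements agree.\<close>
  define g where "g f = f - (\<Sum>i<m. apply_bcontfun f (pt i) *\<^sub>R \<eta> i)" for f :: "'l \<Rightarrow>\<^sub>C real"
  have apply_sum: "apply_bcontfun (\<Sum>i<m. c i *\<^sub>R \<eta> i) y = (\<Sum>i<m. c i * apply_bcontfun (\<eta> i) y)" for c y
  proof (induction m)
    case 0
    then show ?case
      by (simp add: zero_bcontfun.rep_eq)
  next
    case (Suc m)
    then show ?case
      by (simp add: plus_bcontfun.rep_eq scaleR_bcontfun.rep_eq)
  qed
  have g_P: "apply_bcontfun (g f) y = 0" if y: "y \<in> P" for f y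
  proof -
    obtain j where j: "j < m" "y = pt j"
      using P_pt[OF y] by blast
    have "(\<Sum>i<m. apply_bcontfun f (pt i) * apply_bcontfun (\<eta> i) y) = (\<Sum>i<m. if i = j then apply_bcontfun f (pt i) else 0)"
      using \<eta>[OF _ y] j pt_inj by (intro sum.cong) auto
    then show ?thesis
      using j by (simp add: g_def minus_bcontfun.rep_eq apply_sum)
  qed
  \<comment> \<open>The value of \<open>f\<close> at \<open>pt i\<close> is added on the whole
    subtree of \<open>[i]\<close>. The pieces there are empty, so the tree sum does not see
    it.\<close>
  define U where "U f s = apply_bcontfun (g f) (x s) + (if s \<noteq> [] \<and> hd s < m then apply_bcontfun f (pt (hd s)) else 0)"
    for f :: "'l \<Rightarrow>\<^sub>C real" and s
  \<comment> \<open>The norm of \<open>g f\<close> accounts for 1 plus the sum, the stored value for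
    another 1.\<close>
  define B where "B = 2 + (\<Sum>i<m. norm (\<eta> i))"
  have U_bound: "\<bar>U f s\<bar> \<le> B * norm f" for f s
  proof -
    have f: "\<bar>apply_bcontfun f y\<bar> \<le> norm f" for y
      using norm_bounded[of f y] by simp
    have "norm (\<Sum>i<m. apply_bcontfun f (pt i) *\<^sub>R \<eta> i) \<le> (\<Sum>i<m. norm f * norm (\<eta> i))"
      using f by (intro sum_norm_le) (simp add: mult_right_mono)
    then have "norm (g f) \<le> norm f + norm f * (\<Sum>i<m. norm (\<eta> i))"
      unfolding g_def sum_distrib_left by (intro order_trans[OF norm_triangle_ineq4]) simp
    moreover have "\<bar>apply_bcontfun (g f) (x s)\<bar> \<le> norm (g f)"
      using norm_bounded[of "g f" "x s"] by simp
    moreover have "\<bar>if s \<noteq> [] \<and> hd s < m then apply_bcontfun f (pt (hd s)) else 0\<bar> \<le> norm f"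
      using f by auto
    ultimately show ?thesis
      unfolding U_def B_def by (simp add: algebra_simps)
  qed
  have U_cont: "tree_cont \<Lambda> (U f)" for f
    unfolding tree_cont_def
  proof (intro conjI ballI allI impI)
    show "bdd_above ((\<lambda>t. \<bar>U f t\<bar>) ` \<Lambda>)"
      using U_bound by (auto simp: bdd_above_def)
    show "\<exists>N. \<forall>n\<ge>N. \<forall>t\<in>\<Lambda>. prefix (s @ [n]) t \<longrightarrow> \<bar>U f t - U f s\<bar> \<le> \<epsilon>" if "\<epsilon> > 0" for s \<epsilon>
    proof -
      define W where "W = {y. dist (apply_bcontfun (g f) y) (apply_bcontfun (g f) (x s)) < \<epsilon>}"
      have "open W"
        unfolding W_def by (intro open_Collect_less continuous_intros) auto
      moreover have "tp s \<subseteq> W"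
        using g_P x_Nil \<open>\<epsilon> > 0\<close> by (auto simp: tp_def W_def)
      ultimately have fin: "finite {n. \<not> C (s @ [n]) \<subseteq> W}"
        by (rule C_lim)
      \<comment> \<open>Requiring \<open>n\<close> to be at least \<open>m\<close> matters at the
        root: such children carry no stored value.\<close>
      define N where "N = Max (insert m (Suc ` {n. \<not> C (s @ [n]) \<subseteq> W}))"
      have "\<bar>U f t - U f s\<bar> \<le> \<epsilon>" if n: "N \<le> n" "prefix (s @ [n]) t" for n t
      proof -
        obtain v where t: "t = s @ n # v"
          using n(2) by (auto simp: prefix_def)
        have "m \<le> n" "C (s @ [n]) \<subseteq> W"
          using n(1) fin unfolding N_def by (auto simp: Suc_le_eq)
        then have "x t \<in> W"
          using x_child[of s n v] \<open>\<epsilon> > 0\<close> unfolding t by (auto simp: W_def)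
        then show ?thesis
          using \<open>m \<le> n\<close> by (cases s) (auto simp: U_def W_def t dist_real_def)
      qed
      then show ?thesis
        by blast
    qed
    show "\<exists>N. \<forall>n\<ge>N. \<forall>t\<in>\<Lambda>. \<bar>U f t - U f (take n t)\<bar> \<le> \<epsilon>" if e: "\<epsilon> > 0" for \<epsilon>
    proof -
      obtain d where d: "d > 0" "\<And>y z. dist y z < d \<Longrightarrow> \<bar>apply_bcontfun (g f) y - apply_bcontfun (g f) z\<bar> \<le> \<epsilon>"
        using bcontfun_uniform[OF compact e, of "g f"] by blast
      obtain N where N: "(1 / 2 :: real) ^ N < d"
        using real_arch_pow_inv[OF d(1), of "1 / 2"] by auto
      have "\<bar>U f t - U f (take n t)\<bar> \<le> \<epsilon>" if n: "Suc N \<le> n" for n t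
      proof (cases "n < length t")
        case True
        have ne: "take n t \<noteq> []"
          using n True by auto
        have "x t \<in> C (take n t) \<or> x t = x (take n t)"
          using x_ext[of "take n t" "drop n t"] by simp
        then have "dist (x t) (x (take n t)) \<le> (1 / 2) ^ n"
          using C_diam[OF ne _ x_C, of "x t"] True by auto
        also have "(1 / 2 :: real) ^ n \<le> (1 / 2) ^ N"
          using n by (intro half_power_mono) simp
        finally have "\<bar>apply_bcontfun (g f) (x t) - apply_bcontfun (g f) (x (take n t))\<bar> \<le> \<epsilon>"
          using N d(2) by simp
        moreover have "hd (take n t) = hd t" "t \<noteq> []"
          using ne by (auto simp: hd_take)
        ultimately show ?thesis
          using ne by (simp add: U_def)
      next
        case False
        then show ?thesis
          using e by simp
      qed
      then show ?thesis
        by blast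
    qed
  qed
  have tf: "tree_fun (U f) = g f" for f
  proof (rule bcontfun_eqI)
    fix y
    have "tree_sum \<Lambda> h (U f) y = apply_bcontfun (g f) y"
    proof (cases "y \<in> P")
      case True
      then have "tree_sum \<Lambda> h (U f) y = U f []"
        using h_node[of y "[]"] C_Nil by (intro tree_sum_point U_cont Nil) (simp add: tp_def)
      then show ?thesis
        using g_P True x_Nil by (simp add: U_def)
    next
      case False
      then have "y \<in> C [] - tp []"
        by (simp add: C_Nil tp_def)
      then obtain n where n: "y \<in> C [n]"
        unfolding C_un[symmetric] by auto
      then obtain t where t: "t \<in> \<Lambda>" "y \<in> C t" "x t = y" "prefix [n] t"
        using locate[of "[n]" y] C_\<Lambda> by blast
      then have "t \<noteq> []" "hd t = n"
        by (auto simp: prefix_def)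
      have "tree_sum \<Lambda> h (U f) y = U f t"
        using h_node[of y t] t \<open>t \<noteq> []\<close> by (intro tree_sum_point U_cont) (simp_all add: tp_def)
      moreover have "\<not> n < m"
        using C_first n by blast
      ultimately show ?thesis
        using t(3) \<open>hd t = n\<close> by (simp add: U_def)
    qed
    then show "apply_bcontfun (tree_fun (U f)) y = apply_bcontfun (g f) y"
      by (simp add: apply_tree_fun[OF U_cont])
  qed
  \<comment> \<open>The stored values are read off at the nodes \<open>[i]\<close> and put back with
    the functions \<open>\<eta> i\<close>, undoing the subtraction in \<open>g\<close>.\<close>
  define V where "V G = tree_fun G + (\<Sum>i<m. G [i] *\<^sub>R \<eta> i)" for G
  have mem: "[i] \<in> \<Lambda>" for i
    using full[OF root_nl, of i] by simp
  have x_first: "x [i] = x []" if "i < m" for i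
    using x_eq[of "[]" i] C_first[OF that] by simp
  show ?thesis
  proof (rule complemented_if_projectional_tree[OF tree her Nil U_cont _ U_bound])
    show "U (c *\<^sub>R f + f') s = c * U f s + U f' s" for c f f' s
    proof -
      have "g (c *\<^sub>R f + f') = c *\<^sub>R g f + g f'"
        by (simp add: g_def plus_bcontfun.rep_eq scaleR_bcontfun.rep_eq scaleR_add_left sum.distrib
            scaleR_diff_right scaleR_sum_right)
      then show ?thesis
        by (simp add: U_def plus_bcontfun.rep_eq scaleR_bcontfun.rep_eq algebra_simps)
    qed
    show "V (\<lambda>s. c * G s + H s) = c *\<^sub>R V G + V H" if "tree_cont \<Lambda> G" "tree_cont \<Lambda> H" for c G H
      using that by (simp add: V_def tree_fun_combine scaleR_add_left scaleR_add_right sum.distrib scaleR_sum_right)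
    show "norm (V G) \<le> (1 + (\<Sum>i<m. norm (\<eta> i))) * b" if "tree_cont \<Lambda> G" "\<And>s. s \<in> \<Lambda> \<Longrightarrow> \<bar>G s\<bar> \<le> b" for G b
    proof -
      have "norm (\<Sum>i<m. G [i] *\<^sub>R \<eta> i) \<le> (\<Sum>i<m. b * norm (\<eta> i))"
        using that(2)[OF mem] by (intro sum_norm_le) (simp add: mult_right_mono)
      then have "norm (V G) \<le> b + b * (\<Sum>i<m. norm (\<eta> i))"
        unfolding V_def sum_distrib_left using norm_tree_fun[OF that] by (intro norm_triangle_le add_mono)
      then show ?thesis
        by (simp add: algebra_simps)
    qed
    show "V G = V H" if "\<And>s. s \<in> \<Lambda> \<Longrightarrow> G s = H s" for G H
      unfolding V_def using tree_fun_cong[OF that] that[OF mem] by simp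
    show "V (U f) = f" for f
    proof -
      have "U f [i] = apply_bcontfun f (pt i)" if "i < m" for i
        using that g_P[OF x_Nil] x_first by (simp add: U_def)
      then show ?thesis
        by (simp add: V_def tf g_def)
    qed
  qed
qed

section \<open>Finite spaces\<close>

text \<open>Functionals are represented by their graphs, which turns the extension step into adjoining
  one vector to a subspace of the product with the reals.\<close>

lemma norming_functional:
  fixes w :: "'e::real_normed_vector"
  shows "\<exists>\<phi>. bounded_linear \<phi> \<and> \<phi> w = norm w \<and> (\<forall>x. \<bar>\<phi> x\<bar> \<le> norm x)"
proof -
  define \<A> where "\<A> = {S :: ('e \<times> real) set. subspace S \<and> (w, norm w) \<in> S \<and> (\<forall>(x, a)\<in>S. a \<le> norm x)}"
  define S0 where "S0 = range (\<lambda>t. t *\<^sub>R (w, norm w))"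
  have "t * norm w \<le> norm (t *\<^sub>R w)" for t
    by (simp add: mult_right_mono)
  then have "S0 \<in> \<A>"
    unfolding \<A>_def S0_def using span_singleton[of "(w, norm w)"] subspace_span[of "{(w, norm w)}"]
    by (auto intro: range_eqI[of _ _ 1])
  moreover have "\<Union>\<C> \<in> \<A>" if C: "\<C> \<noteq> {}" "subset.chain \<A> \<C>" for \<C>
  proof -
    have sub: "S \<in> \<A>" if "S \<in> \<C>" for S
      using C(2) that by (auto simp: subset_chain_def)
    have "subspace (\<Union>\<C>)"
      unfolding subspace_def
    proof (intro conjI ballI allI)
      show "0 \<in> \<Union>\<C>"
        using C(1) sub by (auto simp: \<A>_def subspace_def)
      show "x + y \<in> \<Union>\<C>" if xy: "x \<in> \<Union>\<C>" "y \<in> \<Union>\<C>" for x y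
      proof -
        obtain S T where ST: "S \<in> \<C>" "x \<in> S" "T \<in> \<C>" "y \<in> T"
          using xy by blast
        then have "S \<subseteq> T \<or> T \<subseteq> S"
          using C(2) by (auto simp: subset_chain_def)
        then obtain R where "R \<in> \<C>" "x \<in> R" "y \<in> R"
          using ST by blast
        then show ?thesis
          using sub[of R] by (auto simp: \<A>_def subspace_def)
      qed
      show "c *\<^sub>R x \<in> \<Union>\<C>" if x: "x \<in> \<Union>\<C>" for c x
      proof -
        obtain R where "R \<in> \<C>" "x \<in> R"
          using x by blast
        moreover have "c *\<^sub>R x \<in> R"
          using sub[of R] calculation by (auto simp: \<A>_def subspace_def)
        ultimately show ?thesis
          by blast
      qed
    qed
    moreover have "(w, norm w) \<in> \<Union>\<C>"
      using C(1) sub by (auto simp: \<A>_def)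
    moreover have "\<forall>(x, a)\<in>\<Union>\<C>. a \<le> norm x"
      using sub by (fastforce simp: \<A>_def)
    ultimately show ?thesis
      by (simp add: \<A>_def)
  qed
  ultimately obtain S where S: "S \<in> \<A>" "\<And>T. T \<in> \<A> \<Longrightarrow> S \<subseteq> T \<Longrightarrow> T = S"
    using subset_Zorn_nonempty[of \<A>] by blast
  have le: "a \<le> norm x" if "(x, a) \<in> S" for x a
    using S(1) that by (auto simp: \<A>_def)
  have sS: "subspace S" and wS: "(w, norm w) \<in> S"
    using S(1) by (auto simp: \<A>_def)
  have total: "\<exists>a. (v, a) \<in> S" for v
  proof -
    \<comment> \<open>An admissible value at \<open>v\<close> must lie between the lower bounds
      \<open>snd q - norm (fst q - v)\<close> and the upper bounds
      \<open>norm (fst p + v) - snd p\<close>; the triangle inequality for \<open>p + q\<close> in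
      \<open>S\<close> leaves such a gap. Scaling reduces all multiples of \<open>v\<close> to these
      two cases.\<close>
    define c where "c = (INF p\<in>S. norm (fst p + v) - snd p)"
    have gap: "snd q - norm (fst q - v) \<le> norm (fst p + v) - snd p" if "p \<in> S" "q \<in> S" for p q
    proof -
      have "p + q \<in> S"
        using sS that by (simp add: subspace_add)
      then have "snd p + snd q \<le> norm (fst p + fst q)"
        using le[of "fst p + fst q" "snd p + snd q"] by (simp add: plus_prod_def)
      also have "\<dots> \<le> norm (fst p + v) + norm (fst q - v)"
        using norm_triangle_ineq[of "fst p + v" "fst q - v"] by simp
      finally show ?thesis
        by simp
    qed
    have ne: "S \<noteq> {}"
      using wS by blast
    have upper: "snd q - norm (fst q - v) \<le> c" if "q \<in> S" for q
      unfolding c_def using gap that ne by (intro cINF_greatest) auto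
    have lower: "c \<le> norm (fst p + v) - snd p" if "p \<in> S" for p
      unfolding c_def
    proof (rule cINF_lower[OF _ that])
      show "bdd_below ((\<lambda>p. norm (fst p + v) - snd p) ` S)"
        using gap[OF _ wS] by (intro bdd_belowI2[of _ "norm w - norm (w - v)"]) auto
    qed
    define T where "T = {p + t *\<^sub>R (v, c) |p t. p \<in> S}"
    have "T \<in> \<A>"
    proof -
      have "subspace T"
        unfolding subspace_def
      proof (intro conjI ballI allI)
        have "0 + 0 *\<^sub>R (v, c) \<in> T"
          unfolding T_def using subspace_0[OF sS] by blast
        then show "0 \<in> T"
          by (simp add: zero_prod_def)
        show "p + q \<in> T" if pq: "p \<in> T" "q \<in> T" for p q
        proof -
          obtain p' t q' u where "p = p' + t *\<^sub>R (v, c)" "q = q' + u *\<^sub>R (v, c)" "p' \<in> S" "q' \<in> S"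
            using pq by (auto simp only: T_def mem_Collect_eq)
          then have "p + q = (p' + q') + (t + u) *\<^sub>R (v, c)" "p' + q' \<in> S"
            using subspace_add[OF sS] by (auto simp only: scaleR_add_left add_ac)
          then show ?thesis
            unfolding T_def by blast
        qed
        show "r *\<^sub>R p \<in> T" if p: "p \<in> T" for r p
        proof -
          obtain p' t where "p = p' + t *\<^sub>R (v, c)" "p' \<in> S"
            using p by (auto simp only: T_def mem_Collect_eq)
          then have "r *\<^sub>R p = r *\<^sub>R p' + (r * t) *\<^sub>R (v, c)" "r *\<^sub>R p' \<in> S"
            using subspace_scale[OF sS] by (auto simp only: scaleR_add_right scaleR_scaleR)
          then show ?thesis
            unfolding T_def by blast
        qed
      qed
      moreover have "(w, norm w) \<in> T"
        proof -
        have "(w, norm w) + 0 *\<^sub>R (v, c) \<in> T"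
          unfolding T_def using wS by blast
        then show ?thesis
          by simp
      qed
      moreover have "a \<le> norm x" if "(x, a) \<in> T" for x a
      proof -
        obtain y b t where p: "(y, b) \<in> S" "x = y + t *\<^sub>R v" "a = b + t * c"
          using \<open>(x, a) \<in> T\<close> by (auto simp: T_def)
        have scale: "(inverse r *\<^sub>R y, inverse r * b) \<in> S" for r
          using subspace_scale[OF sS p(1), of "inverse r"] by simp
        consider "t = 0" | "t > 0" | "t < 0"
          by linarith
        then show ?thesis
        proof cases
          case 1
          then show ?thesis
            using le p by simp
        next
          case 2
          have "t * c \<le> t * (norm (inverse t *\<^sub>R y + v) - inverse t * b)"
            using lower[OF scale, of t] 2 by (intro mult_left_mono) auto
          also have "\<dots> = norm (t *\<^sub>R (inverse t *\<^sub>R y + v)) - b"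
            using 2 by (simp add: right_diff_distrib)
          also have "t *\<^sub>R (inverse t *\<^sub>R y + v) = x"
            using 2 p(2) by (simp add: scaleR_add_right)
          finally show ?thesis
            using p(3) by simp
        next
          case 3
          define r where "r = - t"
          have r: "r > 0"
            using 3 by (simp add: r_def)
          have "r * (inverse r * b - norm (inverse r *\<^sub>R y - v)) \<le> r * c"
            using upper[OF scale, of r] r by (intro mult_left_mono) auto
          moreover have "r * (inverse r * b - norm (inverse r *\<^sub>R y - v)) = b - norm (r *\<^sub>R (inverse r *\<^sub>R y - v))"
            using r by (simp add: right_diff_distrib)
          moreover have "r *\<^sub>R (inverse r *\<^sub>R y - v) = x"
            using r p(2) by (simp add: scaleR_diff_right r_def)
          ultimately have "b - norm x \<le> r * c"
            by (simp only:)
          then show ?thesis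
            using p(3) by (simp add: r_def)
        qed
      qed
      ultimately show ?thesis
        by (auto simp: \<A>_def)
    qed
    moreover have "S \<subseteq> T"
    proof
      fix p
      assume "p \<in> S"
      then have "p + 0 *\<^sub>R (v, c) \<in> T"
        unfolding T_def by blast
      then show "p \<in> T"
        by (simp flip: zero_prod_def)
    qed
    ultimately have "T = S"
      by (rule S(2))
    moreover have "0 \<in> S"
      using sS by (simp add: subspace_0)
    then have "0 + 1 *\<^sub>R (v, c) \<in> T"
      unfolding T_def by blast
    ultimately show ?thesis
      by auto
  qed
  then obtain \<phi> where \<phi>: "\<And>v. (v, \<phi> v) \<in> S"
    by metis
  \<comment> \<open>Domination by the norm, applied over 0 to a difference and its negative, makes
    the subspace single-valued.\<close>
  have unique: "a = b" if "(v, a) \<in> S" "(v, b) \<in> S" for v a b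
    using subspace_diff[OF sS that] subspace_diff[OF sS that(2,1)] le[of 0 "a - b"] le[of 0 "b - a"]
    by (simp add: zero_prod_def)
  have bound: "\<bar>\<phi> x\<bar> \<le> norm x" for x
    using le[OF \<phi>, of x] le[of "- x" "- \<phi> x"] subspace_neg[OF sS \<phi>, of x] by auto
  have "bounded_linear \<phi>"
  proof (rule bounded_linear_intro)
    show "\<phi> (x + y) = \<phi> x + \<phi> y" for x y
      using unique[OF \<phi>] subspace_add[OF sS \<phi> \<phi>, of x y] by simp
    show "\<phi> (r *\<^sub>R x) = r *\<^sub>R \<phi> x" for r x
      using unique[OF \<phi>] subspace_scale[OF sS \<phi>, of r x] by simp
    show "norm (\<phi> x) \<le> norm x * 1" for x
      using bound by simp
  qed
  moreover have "\<phi> w = norm w"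
    using unique[OF \<phi> wS] .
  ultimately show ?thesis
    using bound by blast
qed

text \<open>As in Gram-Schmidt, a vector not fixed by the projection onto the span so far is
  replaced by its residue \<open>w\<close>, which the earlier functionals annihilate. A norming
  functional of \<open>w\<close>, composed with the complementary projection, annihilates the
  earlier vectors. In a nonzero space, \<open>dim\<close> being 0 means infinite dimension.\<close>

lemma biorthogonal_system:
  assumes "\<exists>x :: 'e::real_normed_vector. x \<noteq> 0"
    and "dim (UNIV :: 'e set) = 0 \<or> n \<le> dim (UNIV :: 'e set)"
  shows "\<exists>(e :: nat \<Rightarrow> 'e) \<phi>. (\<forall>i<n. bounded_linear (\<phi> i)) \<and> (\<forall>i<n. \<forall>j<n. \<phi> i (e j) = (if i = j then 1 else 0 :: real))"
  using assms(2)
proof (induction n)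
  case (Suc n)
  then obtain e :: "nat \<Rightarrow> 'e" and \<phi> where \<phi>: "\<And>i. i < n \<Longrightarrow> bounded_linear (\<phi> i)"
    "\<And>i j. i < n \<Longrightarrow> j < n \<Longrightarrow> \<phi> i (e j) = (if i = j then 1 else 0 :: real)"
    by (metis Suc_leD)
  define P where "P x = (\<Sum>i<n. \<phi> i x *\<^sub>R e i)" for x
  have P: "bounded_linear P"
    unfolding P_def using \<phi>(1) by (intro bounded_linear_sum bounded_linear_scaleR_const) auto
  have \<phi>P: "\<phi> j (P x) = \<phi> j x" if "j < n" for j x
  proof -
    interpret bounded_linear "\<phi> j"
      by (rule \<phi>(1)[OF that])
    have "\<phi> j (P x) = (\<Sum>i<n. \<phi> i x * \<phi> j (e i))"
      by (simp add: P_def sum scaleR)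
    also have "\<dots> = (\<Sum>i<n. if i = j then \<phi> i x else 0)"
      using \<phi>(2) that by (intro sum.cong) auto
    finally show ?thesis
      using that by simp
  qed
  have Pe: "P (e j) = e j" if "j < n" for j
  proof -
    have "P (e j) = (\<Sum>i<n. if i = j then e i else 0)"
      unfolding P_def using \<phi>(2) that by (intro sum.cong) auto
    then show ?thesis
      using that by simp
  qed
  \<comment> \<open>Otherwise the \<open>n\<close> vectors span the space and its dimension is at
    most \<open>n\<close>, so the hypothesis leaves only dimension 0. With a finite spanning set
    that is the zero space, which is excluded.\<close>
  have "\<exists>v. P v \<noteq> v"
  proof (rule ccontr)
    assume "\<not> ?thesis"
    then have "\<And>v. v = (\<Sum>i<n. \<phi> i v *\<^sub>R e i)"
      by (metis P_def)
    moreover have "(\<Sum>i<n. \<phi> i v *\<^sub>R e i) \<in> span (e ` {..<n})" for v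
      by (intro span_sum span_scale span_base) auto
    ultimately have "UNIV \<subseteq> span (e ` {..<n})"
      by (metis subsetI)
    then have "dim (UNIV :: 'e set) \<le> card (e ` {..<n})"
      by (intro dim_le_card) auto
    also have "\<dots> \<le> n"
      using card_image_le[of "{..<n}" e] by simp
    finally have "dim (UNIV :: 'e set) = 0"
      using Suc.prems by auto
    obtain B :: "'e set" where B: "B \<subseteq> UNIV" "independent B" "UNIV \<subseteq> span B" "card B = dim (UNIV :: 'e set)"
      by (rule basis_exists)
    moreover have "finite B"
      using independent_span_bound[OF _ B(2), of "e ` {..<n}"] \<open>UNIV \<subseteq> span (e ` {..<n})\<close> by auto
    ultimately have "B = {}"
      using \<open>dim (UNIV :: 'e set) = 0\<close> by simp
    then show False
      using assms(1) B(3) by auto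
  qed
  then obtain v where v: "P v \<noteq> v"
    by blast
  define w where "w = v - P v"
  have "w \<noteq> 0"
    using v by (simp add: w_def)
  have \<phi>w: "\<phi> j w = 0" if "j < n" for j
    using \<phi>P[OF that, of v] linear_diff[OF bounded_linear.linear[OF \<phi>(1)[OF that]]] by (simp add: w_def)
  then have Pw: "P w = 0"
    by (simp add: P_def)
  obtain \<psi> where \<psi>: "bounded_linear \<psi>" "\<psi> w = norm w"
    using norming_functional[of w] by blast
  define \<theta> where "\<theta> x = \<psi> (x - P x)" for x
  have \<theta>: "bounded_linear \<theta>"
    unfolding \<theta>_def using P by (intro bounded_linear_compose[OF \<psi>(1)] bounded_linear_sub bounded_linear_ident)
  have "\<theta> w = norm w"
    by (simp add: \<theta>_def Pw \<psi>)
  moreover have "\<theta> (e j) = 0" if "j < n" for j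
    using linear_0[OF bounded_linear.linear[OF \<psi>(1)]] by (simp add: \<theta>_def Pe that)
  ultimately show ?case
    using \<phi> \<phi>w \<theta> \<open>w \<noteq> 0\<close> linear_scale[OF bounded_linear.linear[OF \<theta>]] linear_scale[OF bounded_linear.linear[OF \<phi>(1)]]
    by (intro exI[of _ "\<lambda>i. if i < n then e i else inverse (norm w) *\<^sub>R w"] exI[of _ "\<lambda>i. if i < n then \<phi> i else \<theta>"])
      (auto simp: less_Suc_eq)
qed simp

text \<open>All functions on a finite space are continuous, so they correspond to coefficient
  vectors: \<open>J\<close> forms linear combinations and the biorthogonal functionals recover the
  coefficients.\<close>

lemma complemented_finite:
  assumes "finite (UNIV :: 'l::metric_space set)" "\<exists>x :: 'e::real_normed_vector. x \<noteq> 0"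
    and "dim (UNIV :: 'e set) = 0 \<or> card (UNIV :: 'l set) \<le> dim (UNIV :: 'e set)"
  shows "\<exists>F (J :: ('l \<Rightarrow>\<^sub>C real) \<Rightarrow> 'e). complemented F \<and> isomorphism_onto J F"
proof -
  define N where "N = card (UNIV :: 'l set)"
  obtain e :: "nat \<Rightarrow> 'e" and \<phi> where \<phi>: "\<And>i. i < N \<Longrightarrow> bounded_linear (\<phi> i)"
    "\<And>i j. i < N \<Longrightarrow> j < N \<Longrightarrow> \<phi> i (e j) = (if i = j then 1 else 0 :: real)"
    using biorthogonal_system[OF assms(2), of N] assms(3) unfolding N_def by metis
  obtain p :: "'l \<Rightarrow> nat" where p: "bij_betw p UNIV {..<N}"
    using ex_bij_betw_finite_nat[OF assms(1)] by (auto simp: N_def lessThan_atLeast0)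
  have pN: "p x < N" for x
    using p by (auto simp: bij_betw_def)
  have pinj: "p x = p y \<longleftrightarrow> x = y" for x y
    using p by (auto simp: bij_betw_def inj_def)
  have bc: "g \<in> bcontfun" for g :: "'l \<Rightarrow> real"
  proof -
    have "continuous_on UNIV g"
      using assms(1) by (rule continuous_on_finite)
    moreover have "bounded (range g)"
      using assms(1) by (intro finite_imp_bounded finite_imageI)
    ultimately show ?thesis
      by (simp add: bcontfun_def)
  qed
  define J where "J f = (\<Sum>x\<in>UNIV. apply_bcontfun f x *\<^sub>R e (p x))" for f :: "'l \<Rightarrow>\<^sub>C real"
  define Q where "Q y = Bcontfun (\<lambda>x :: 'l. \<phi> (p x) y)" for y
  have Q: "apply_bcontfun (Q y) x = \<phi> (p x) y" for x y
    unfolding Q_def by (simp add: Bcontfun_inverse bc)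
  have J: "bounded_linear J"
    unfolding J_def
  proof (intro bounded_linear_sum bounded_linear_scaleR_const)
    show "bounded_linear (\<lambda>f. apply_bcontfun f x)" for x :: 'l
      by (rule bounded_linear_intro[where K = 1])
        (use norm_bounded in \<open>auto simp: plus_bcontfun.rep_eq scaleR_bcontfun.rep_eq\<close>)
  qed
  have "\<forall>i. \<exists>K. i < N \<longrightarrow> (\<forall>y. norm (\<phi> i y) \<le> norm y * K)"
    using \<phi>(1) bounded_linear.bounded by blast
  then obtain K where K: "\<And>i y. i < N \<Longrightarrow> norm (\<phi> i y) \<le> norm y * K i"
    by metis
  have "bounded_linear Q"
  proof (rule bounded_linear_intro)
    show "Q (y + z) = Q y + Q z" for y z
      using linear_add[OF bounded_linear.linear[OF \<phi>(1)[OF pN]]] by (intro bcontfun_eqI) (simp add: Q plus_bcontfun.rep_eq)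
    show "Q (r *\<^sub>R y) = r *\<^sub>R Q y" for r y
      using linear_scale[OF bounded_linear.linear[OF \<phi>(1)[OF pN]]] by (intro bcontfun_eqI) (simp add: Q scaleR_bcontfun.rep_eq)
    show "norm (Q y) \<le> norm y * (\<Sum>i<N. \<bar>K i\<bar>)" for y
    proof (rule norm_bound)
      fix x
      have "norm (\<phi> (p x) y) \<le> norm y * K (p x)"
        by (rule K[OF pN])
      also have "\<dots> \<le> norm y * (\<Sum>i<N. \<bar>K i\<bar>)"
        using member_le_sum[of "p x" "{..<N}" "\<lambda>i. \<bar>K i\<bar>"] pN[of x]
        by (intro mult_left_mono) (auto intro: order_trans[OF abs_ge_self])
      finally show "norm (apply_bcontfun (Q y) x) \<le> norm y * (\<Sum>i<N. \<bar>K i\<bar>)"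
        by (simp add: Q)
    qed
  qed
  moreover have "Q (J f) = f" for f
  proof (rule bcontfun_eqI)
    fix x
    interpret bounded_linear "\<phi> (p x)"
      by (rule \<phi>(1)[OF pN])
    have "\<phi> (p x) (J f) = (\<Sum>z\<in>UNIV. apply_bcontfun f z * \<phi> (p x) (e (p z)))"
      by (simp add: J_def sum scaleR)
    also have "\<dots> = (\<Sum>z\<in>UNIV. if z = x then apply_bcontfun f z else 0)"
      using \<phi>(2)[OF pN pN] by (intro sum.cong) (auto simp: pinj)
    finally show "apply_bcontfun (Q (J f)) x = apply_bcontfun f x"
      using assms(1) by (simp add: Q)
  qed
  ultimately show ?thesis
    using complemented_range[OF J] by blast
qed

section \<open>The equivalence\<close>

text \<open>The second assumption only concerns finite spaces: on the real line, for instance, a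
  tree of rank 1 exists, but a two-point space has a two-dimensional function space. The value 0 of
  \<open>dim\<close> admits all infinite-dimensional spaces, and the zero space as well, for which
  both sides fail.\<close>

theorem theorem1p2:
  assumes "compact (UNIV :: 'l::metric_space set)"
    and "finite (UNIV :: 'l set) \<longrightarrow>
      dim (UNIV :: 'e::banach set) = 0 \<or> card (UNIV :: 'l set) \<le> dim (UNIV :: 'e set)"
  shows "(\<exists>(F :: 'e set) (J :: ('l \<Rightarrow>\<^sub>C real) \<Rightarrow> 'e). complemented F \<and> isomorphism_onto J F)
    \<longleftrightarrow>
    (\<exists>\<Lambda> (T :: (nat list \<Rightarrow> real) \<Rightarrow> 'e) \<rho>. projectional_tree (ht (UNIV :: 'l set)) \<Lambda> T \<rho>)"
proof
  assume "\<exists>(F :: 'e set) (J :: ('l \<Rightarrow>\<^sub>C real) \<Rightarrow> 'e). complemented F \<and> isomorphism_onto J F"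
  then show "\<exists>\<Lambda> (T :: (nat list \<Rightarrow> real) \<Rightarrow> 'e) \<rho>. projectional_tree (ht (UNIV :: 'l set)) \<Lambda> T \<rho>"
    using projectional_tree_if_complemented_C[OF assms(1)] by blast
next
  assume "\<exists>\<Lambda> (T :: (nat list \<Rightarrow> real) \<Rightarrow> 'e) \<rho>. projectional_tree (ht (UNIV :: 'l set)) \<Lambda> T \<rho>"
  then obtain \<Lambda> and T :: "(nat list \<Rightarrow> real) \<Rightarrow> 'e" and \<rho> where
    tree: "projectional_tree (ht (UNIV :: 'l set)) \<Lambda> T \<rho>"
    by blast
  show "\<exists>(F :: 'e set) (J :: ('l \<Rightarrow>\<^sub>C real) \<Rightarrow> 'e). complemented F \<and> isomorphism_onto J F"
  proof (cases "ht (UNIV :: 'l set)")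
    case None
    then have "\<Lambda> = UNIV"
      using tree by (simp add: projectional_tree_def)
    then show ?thesis
      using complemented_if_projectional_tree_UNIV[OF assms(1)] tree by blast
  next
    case (Some \<beta>)
    obtain \<alpha> where \<alpha>: "\<beta> = osuc \<alpha>" "derived (UNIV :: 'l set) \<alpha> \<noteq> {}" "derived (UNIV :: 'l set) \<beta> = {}"
      using ht_Some_compact[OF assms(1) Some] by blast
    show ?thesis
    proof (cases "finite (UNIV :: 'l set)")
      case True
      have \<Lambda>: "hereditary \<Lambda>" "[] \<in> \<Lambda>"
        using tree full_tree by (auto simp: projectional_tree_def)
      \<comment> \<open>The constant tree function 1 has value 1 under the functional at the root,
        so its image under \<open>T\<close> shows that the Banach space is nonzero.\<close>
      define a where "a = tree_diff \<Lambda> (\<lambda>_. 1)"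
      have "a \<in> tree_space \<Lambda>"
        unfolding a_def by (rule tree_diff_in_tree_space[OF \<Lambda>]) (auto simp: tree_cont_def)
      then have "blinfun_apply (\<rho> []) (T a) = 1"
        using tree \<Lambda> by (simp add: projectional_tree_def a_def tree_diff_def)
      then have "T a \<noteq> 0"
        by auto
      then show ?thesis
        using complemented_finite[OF True] assms(2) True by blast
    next
      case False
      then show ?thesis
        using complemented_if_projectional_tree_scattered[OF assms(1) False] \<alpha> tree Some by simp
    qed
  qed
qed

end
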